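(* Consider the cyclically closed double-chain three-state generalized Potts model with real couplings $J_{\mu_1,\mu_2,\mu_3}$, at temperature $T>0$ (all notation as in the context). Let $\lambda_{max}(T)$ be the principal eigenvalue of the $3\times 3$ matrix $\Theta_1$ (defined at zero external field), and let $\lambda_{max}(\vec h,T)$ be the principal eigenvalue of the $9\times9$ transfer-matrix $\Theta(\vec h,T)$ in external field $\vec h=(h_0,h_1,h_2)$, so that $\lambda_{max}(\vec 0,T)=\lambda_{max}(T)$. Then at zero external field $\vec h=\vec 0$, in the thermodynamic limit $L\to\infty$, the free energy $f$, internal energy $u$, entropy $S$, heat capacity $c$, partial magnetizations $m_\mu$ and partial susceptibilities $\chi_{\mu_0,\mu_1}$ ($\mu,\mu_0,\mu_1\in\{0,1,2\}$) can be expressed through $\lambda_{max}$: $$f(T) = -T\,\frac{\ln(\lambda_{max}(T))}{2},$$ $$u(T) = T^2 \frac{\partial}{\partial T} \frac{\ln(\lambda_{max}(T))}{2},$$ $$S(T) = \frac{1}{2} \left(\ln (\lambda_{max}(T)) + \frac{T}{\lambda_{max}(T)} \frac{\partial \lambda_{max}(T)}{\partial T}\right),$$ $$c(T) = 2T \frac{\partial}{\partial T} \frac{\ln (\lambda_{max}(T))}{2} + T^2 \frac{\partial^2}{\partial T^2}\frac{\ln (\lambda_{max}(T))}{2},$$ $$m_{\mu}(\vec{h},T) \Big|_{\vec{h}=\vec{0}} = \frac{T}{2} \frac{1}{\lambda_{max}(T)} \frac{\partial \lambda_{max}(\vec{h},T)}{\partial h_{\mu}} \Big|_{\vec{h}=\vec{0}}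 =\frac{1}{3},$$ $$\chi_{\mu_0, \mu_1}(\vec{h},T) \Big|_{\vec{h}=\vec{0}} =\left\{ \frac{T}{2}\left(\frac{1}{\lambda_{max}(T)}\frac{\partial^2 \lambda_{max}(\vec{h},T)}{\partial h_{\mu_0} \partial h_{\mu_1}} -\frac{1}{\lambda^2_{max}(T)} \frac{\partial \lambda_{max}(\vec{h},T)}{\partial h_{\mu_0}} \frac{\partial \lambda_{max}(\vec{h},T)}{\partial h_{\mu_1}} \right) \right\} \bigg|_{\vec{h}=\vec{0}},$$ where the partial derivatives of $\lambda_{max}=\lambda_{max}(\vec h,T)$ have the form $$\frac{\partial \lambda_{max}(\vec{h},T)}{\partial h_{\mu}} = -\frac{\sum_{n=0}^9 \frac{\partial a_n}{\partial h_{\mu}} \lambda_{max}^n}{\sum_{n=0}^8(n+1)a_{n+1}\lambda_{max}^n},$$ $$\frac{\partial^2 \lambda_{max}(\vec{h},T)}{\partial h_{\mu_0} \partial h_{\mu_1}} =\frac{-1}{\sum_{n=0}^8 (n+1)a_{n+1} \lambda_{max}^n} \Bigg( \sum_{n=0}^9 \frac{\partial^2 a_n}{\partial h_{\mu_0} \partial h_{\mu_1}} \lambda_{max}^n + \frac{\partial \lambda_{max}}{\partial h_{\mu_1}} \sum_{n=0}^8 (n+1) \frac{\partial a_{n+1}}{\partial h_{\mu_0}} \lambda_{max}^n $$ $$\qquad+\frac{\partial \lambda_{max}}{\partial h_{\mu_0}} \left[ \sum_{n=0}^8 (n+1) \frac{\partial a_{n+1}}{\partial h_{\mu_1}} \lambda_{max}^n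 + \frac{\partial \lambda_{max}}{\partial h_{\mu_1}} \sum_{n=0}^7 (n+2)(n+1) a_{n+2} \lambda_{max}^n \right]\Bigg),$$ and $a_n=a_n(\vec h,T)$, $n=0,\dots,9$, are the coefficients of the secular (characteristic) equation $\sum_{n=0}^9 a_n\lambda^n=0$ of $\Theta(\vec h,T)$.
   Context: **Model.** The lattice is $\mathcal{L}_{2,L}=\{t_i^j : i=0,\dots,L-1,\ j=0,1\}$ with cyclic closure $t_L^j\equiv t_0^j$. A spin configuration is $\sigma=(\sigma_i^j)\in X^{\mathcal{L}_{2,L}}$ with $X=\{0,1,2\}$, and $\sigma_L^j=\sigma_0^j$. The Hamiltonian is $$\mathcal{H}_L(\sigma)=\sum_{i=0}^{L-1}H(\sigma_i^0,\sigma_i^1;\sigma_{i+1}^0,\sigma_{i+1}^1),$$ $$H(\sigma_0,\sigma_1;\sigma_2,\sigma_3)=-\left(\sum_{(\mu_1,\mu_2,\mu_3)\in X^3}J_{\mu_1,\mu_2,\mu_3}\,\delta_{\sigma_0,\ \mu_1+\sigma_1,\ \mu_2+\sigma_2,\ \mu_3+\sigma_3}+\sum_{\mu\in X}h_\mu\sum_{r=0}^{3}\delta_{\mu,\sigma_r}\right),$$ where the $J_{\mu_1,\mu_2,\mu_3}$ are real constants, $\vec h=(h_0,h_1,h_2)$ is the external field, and $\delta_{a_1,\dots,a_s}=1$ if all $a_r$ are congruent modulo $3$, and $0$ otherwise. The Boltzmann constant is $1$. The partition function is $Z_L=\sum_{\sigma}e^{-\mathcal{H}_L(\sigma)/T}$,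 and $\langle\cdot\rangle$ denotes expectation under the Gibbs probability $e^{-\mathcal{H}_L(\sigma)/T}/Z_L$. **Transfer-matrix.** $\Theta=\Theta(\vec h,T)$ is the $9\times 9$ matrix with entries $\langle\sigma_0,\sigma_1|\Theta|\sigma_2,\sigma_3\rangle=\exp[-H(\sigma_0,\sigma_1;\sigma_2,\sigma_3)/T]$. Rows are indexed by $(\sigma_0,\sigma_1)$ and columns by $(\sigma_2,\sigma_3)$, both in the order $(0,0),(1,0),(2,0),(0,1),(1,1),(2,1),(0,2),(1,2),(2,2)$. At $\vec h=\vec 0$, $H$ is invariant under adding $1$ (in $\mathbb{Z}_3$) to all four spins. Denote the first three rows of $\Theta(\vec 0,T)$ by $$(a,d,e,f,g,h,i,j,k),\quad (l,b,m,n,o,p,q,r,s),\quad (t,u,c,v,w,x,y,z,A)$$ (these letters are merely names for positive real entries), and put $$\Theta_1=\begin{pmatrix} a+g+k & d+h+i & e+f+j \\ l+o+s & b+p+q & m+n+r \\ t+w+A & u+x+y & c+v+z \end{pmatrix}.$$ **Principal eigenvalue.** The principal eigenvalue of a matrix with positive entries is its single largest real eigenvalue. **Thermodynamic characteristics.** For a strip of length $L$ (with $N=2L$ sites): free energy $f=-\frac{T}{N}\ln Z_L$; internal energy $u=-T^2\frac{\partial}{\partial T}\left(\frac{f}{T}\right)$; entropy $S=-\frac{\partial f}{\partial T}$; heat capacity $c=\frac{\partial u}{\partial T}$. In the thermodynamic limit these are taken as $L\to\infty$. With the random variable $\mathcal{M}_\mu=\sum_{i=0}^{L-1}\sum_{j=0}^{1}\delta_{\mu,\sigma_i^j}$,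 the partial magnetization and partial susceptibility are $$m_\mu=\lim_{L\to\infty}\frac{1}{2L}\langle\mathcal{M}_\mu\rangle,\qquad \chi_{\mu_0,\mu_1}=\lim_{L\to\infty}\frac{\langle\mathcal{M}_{\mu_0}\mathcal{M}_{\mu_1}\rangle-\langle\mathcal{M}_{\mu_0}\rangle\langle\mathcal{M}_{\mu_1}\rangle}{2LT},$$ quantities which are stated, as part of their definition, to be calculated from the free energy by $m_\mu(\vec h,T)=-\frac{\partial}{\partial h_\mu}f(\vec h,T)$ and $\chi_{\mu_0,\mu_1}=-\frac{\partial^2}{\partial h_{\mu_0}\partial h_{\mu_1}}f(\vec h,T)$.
   Formalization: As printed, H counts each site's field twice, so the m_μ chain fails (J=0 gives 2/3, not 1/3); shown instead: lim⟨M_μ⟩/2L=1/3, −∂f/∂h_μ=(T/2λ)∂λ/∂h_μ=2/3, and the χ formula equals −∂²f/∂h∂h and 4 times the covariance limit. *)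

theory Defs
  imports
    "HOL-Library.Numeral_Type"
    "HOL-Analysis.Derivative"
    "Jordan_Normal_Form.Char_Poly"
begin

text \<open>
  Spins live in the type \<^typ>\<open>3\<close> of integers modulo 3, so that congruence modulo 3 is equality.
  An external field is a function \<open>h :: 3 \<Rightarrow> real\<close>, the couplings a function
  \<open>J :: 3 \<Rightarrow> 3 \<Rightarrow> 3 \<Rightarrow> real\<close>.
\<close>

type_synonym spin = 3
type_synonym field = "spin \<Rightarrow> real"
type_synonym coupling = "spin \<Rightarrow> spin \<Rightarrow> spin \<Rightarrow> real"
type_synonym config = "nat \<times> nat \<Rightarrow> spin"

abbreviation zero_field :: field where
  "zero_field \<equiv> (\<lambda>_. 0)"

definition delta :: "spin list \<Rightarrow> real" where
  "delta xs = of_bool (\<forall>x\<in>set xs. \<forall>y\<in>set xs. x = y)"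

text \<open>
  The field term runs over all four spins of a plaquette. As every site belongs to two plaquettes
  of the closed strip, the total field energy is $-2\sum_\mu h_\mu \mathcal{M}_\mu$, with
  $\mathcal{M}_\mu$ the \<open>magn\<close> below. Hence field derivatives of the free energy carry a
  factor 2 per derivative compared with the moments of $\mathcal{M}_\mu$.
\<close>

definition local_H :: "coupling \<Rightarrow> field \<Rightarrow> spin \<times> spin \<Rightarrow> spin \<times> spin \<Rightarrow> real" where
  "local_H J h = (\<lambda>(s0, s1) (s2, s3).
     - ((\<Sum>\<mu>1\<in>UNIV. \<Sum>\<mu>2\<in>UNIV. \<Sum>\<mu>3\<in>UNIV.
            J \<mu>1 \<mu>2 \<mu>3 * delta [s0, \<mu>1 + s1, \<mu>2 + s2, \<mu>3 + s3])
        + (\<Sum>\<mu>\<in>UNIV. h \<mu> * (\<Sum>s\<leftarrow>[s0, s1, s2, s3]. delta [\<mu>, s]))))"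

subsection \<open>The Gibbs ensemble on the strip of length \<open>L\<close>\<close>

text \<open>The spin at the lattice point $t_i^j$ is \<open>\<sigma> (i, j)\<close>.\<close>

definition configs :: "nat \<Rightarrow> config set" where
  "configs L = PiE ({..<L} \<times> {..<2}) (\<lambda>_. UNIV)"

definition hamiltonian :: "coupling \<Rightarrow> nat \<Rightarrow> field \<Rightarrow> config \<Rightarrow> real" where
  "hamiltonian J L h \<sigma> =
     (\<Sum>i<L. local_H J h (\<sigma> (i, 0), \<sigma> (i, 1))
                         (\<sigma> ((i + 1) mod L, 0), \<sigma> ((i + 1) mod L, 1)))"

definition partition_fun :: "coupling \<Rightarrow> nat \<Rightarrow> field \<Rightarrow> real \<Rightarrow> real" where
  "partition_fun J L h T = (\<Sum>\<sigma>\<in>configs L. exp (- hamiltonian J L h \<sigma> / T))"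

definition gibbs_mean :: "coupling \<Rightarrow> nat \<Rightarrow> field \<Rightarrow> real \<Rightarrow> (config \<Rightarrow> real) \<Rightarrow> real" where
  "gibbs_mean J L h T F =
     (\<Sum>\<sigma>\<in>configs L. F \<sigma> * (exp (- hamiltonian J L h \<sigma> / T) / partition_fun J L h T))"

definition magn :: "nat \<Rightarrow> spin \<Rightarrow> config \<Rightarrow> real" where
  "magn L \<mu> \<sigma> = (\<Sum>i<L. \<Sum>j<2. delta [\<mu>, \<sigma> (i, j)])"

definition strip_magnetization :: "coupling \<Rightarrow> nat \<Rightarrow> spin \<Rightarrow> field \<Rightarrow> real \<Rightarrow> real" where
  "strip_magnetization J L \<mu> h T = 1 / (2 * real L) * gibbs_mean J L h T (magn L \<mu>)"

definition strip_susceptibility ::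
    "coupling \<Rightarrow> nat \<Rightarrow> spin \<Rightarrow> spin \<Rightarrow> field \<Rightarrow> real \<Rightarrow> real" where
  "strip_susceptibility J L \<mu>0 \<mu>1 h T =
     (gibbs_mean J L h T (\<lambda>\<sigma>. magn L \<mu>0 \<sigma> * magn L \<mu>1 \<sigma>)
        - gibbs_mean J L h T (magn L \<mu>0) * gibbs_mean J L h T (magn L \<mu>1))
     / (2 * real L * T)"

definition strip_free_energy :: "coupling \<Rightarrow> nat \<Rightarrow> field \<Rightarrow> real \<Rightarrow> real" where
  "strip_free_energy J L h T = - (T / (2 * real L)) * ln (partition_fun J L h T)"

definition strip_internal_energy :: "coupling \<Rightarrow> nat \<Rightarrow> field \<Rightarrow> real \<Rightarrow> real" where
  "strip_internal_energy J L h T = - T\<^sup>2 * deriv (\<lambda>t. strip_free_energy J L h t / t) T"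

definition strip_entropy :: "coupling \<Rightarrow> nat \<Rightarrow> field \<Rightarrow> real \<Rightarrow> real" where
  "strip_entropy J L h T = - deriv (\<lambda>t. strip_free_energy J L h t) T"

definition strip_heat_capacity :: "coupling \<Rightarrow> nat \<Rightarrow> field \<Rightarrow> real \<Rightarrow> real" where
  "strip_heat_capacity J L h T = deriv (\<lambda>t. strip_internal_energy J L h t) T"

definition free_energy :: "coupling \<Rightarrow> field \<Rightarrow> real \<Rightarrow> real" where
  "free_energy J h T = lim (\<lambda>L. strip_free_energy J L h T)"

subsection \<open>Transfer matrix\<close>

text \<open>
  Rows and columns are numbered in the order
  $(0,0),(1,0),(2,0),(0,1),(1,1),(2,1),(0,2),(1,2),(2,2)$, the first spin varying fastest.
\<close>

definition spin_pair :: "nat \<Rightarrow> spin \<times> spin" where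
  "spin_pair k = (of_nat (k mod 3), of_nat (k div 3))"

definition Theta :: "coupling \<Rightarrow> field \<Rightarrow> real \<Rightarrow> real mat" where
  "Theta J h T = Matrix.mat 9 9 (\<lambda>(r, c). exp (- local_H J h (spin_pair r) (spin_pair c) / T))"

text \<open>
  In terms of the first three rows $(a,d,e,f,g,h,i,j,k)$, $(l,b,m,n,o,p,q,r,s)$,
  $(t,u,c,v,w,x,y,z,A)$ of the transfer matrix at zero field, the first row of the following
  matrix is $(a+g+k,\; d+h+i,\; e+f+j)$, and likewise for the other two.
\<close>

definition Theta1 :: "coupling \<Rightarrow> real \<Rightarrow> real mat" where
  "Theta1 J T = (let M = Theta J zero_field T in
     mat_of_rows_list 3
       [[M $$ (0,0) + M $$ (0,4) + M $$ (0,8),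
         M $$ (0,1) + M $$ (0,5) + M $$ (0,6),
         M $$ (0,2) + M $$ (0,3) + M $$ (0,7)],
        [M $$ (1,0) + M $$ (1,4) + M $$ (1,8),
         M $$ (1,1) + M $$ (1,5) + M $$ (1,6),
         M $$ (1,2) + M $$ (1,3) + M $$ (1,7)],
        [M $$ (2,0) + M $$ (2,4) + M $$ (2,8),
         M $$ (2,1) + M $$ (2,5) + M $$ (2,6),
         M $$ (2,2) + M $$ (2,3) + M $$ (2,7)]])"

definition principal_eigenvalue :: "real mat \<Rightarrow> real" where
  "principal_eigenvalue M = Max {x. eigenvalue M x}"

definition lambda_max :: "coupling \<Rightarrow> field \<Rightarrow> real \<Rightarrow> real" where
  "lambda_max J h T = principal_eigenvalue (Theta J h T)"

definition lambda_max1 :: "coupling \<Rightarrow> real \<Rightarrow> real" where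
  "lambda_max1 J T = principal_eigenvalue (Theta1 J T)"

definition sec_coeff :: "coupling \<Rightarrow> nat \<Rightarrow> field \<Rightarrow> real \<Rightarrow> real" where
  "sec_coeff J n h T = coeff (char_poly (Theta J h T)) n"

subsection \<open>Partial derivatives with respect to field components\<close>

definition pdh :: "spin \<Rightarrow> (field \<Rightarrow> real) \<Rightarrow> field \<Rightarrow> real" where
  "pdh \<mu> F h = deriv (\<lambda>x. F (h(\<mu> := x))) (h \<mu>)"

definition pdh_exists :: "spin \<Rightarrow> (field \<Rightarrow> real) \<Rightarrow> field \<Rightarrow> bool" where
  "pdh_exists \<mu> F h \<longleftrightarrow> (\<lambda>x. F (h(\<mu> := x))) field_differentiable at (h \<mu>)"

end

theory Submission
  imports Defs "HOL-Analysis.Brouwer_Fixpoint" "HOL-Analysis.Cartesian_Euclidean_Space"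
begin

text \<open>
  The partition function is the trace of the \<open>L\<close>-th power of the transfer matrix. A positive matrix
  \<open>\<Theta>\<close> with Perron pair \<open>(\<lambda>, u)\<close> is diagonally conjugate to \<open>\<lambda> S\<close> with \<open>S\<close> stochastic, so
  that $\frac1L \ln Z_L = \ln\lambda + \frac1L \ln \mathrm{tr}\, S^L$. The powers of \<open>S\<close> contract the
  oscillation of vectors, and so do their first and mixed second parameter derivatives; hence
  $\mathrm{tr}\, S^L \to 1$ and its derivatives tend to \<open>0\<close>. All limits of derivatives of the free
  energy therefore agree with the derivatives of \<open>\<lambda>\<close>, which exist because \<open>\<lambda>\<close> is a simple root of
  the secular equation. At zero field the Perron vector is invariant under the global spin shift,
  which reduces \<open>\<Theta>\<close> to \<open>\<Theta>\<^sub>1\<close> and fixes the magnetizations.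
\<close>

section \<open>Two-parameter jets\<close>

text \<open>The strip quantities are derivatives taken at finite L, so convergence of the free
  energies alone would not give their limits: differentiation and the limit have to be exchanged.
  This is why whole jets are carried through the matrix powers, with an error bound on each
  component. A jet asks for no more than an iterated partial derivative at one point uses: the
  t-derivative at \<open>t = 0\<close> for every s near 0, and then the s-derivative of the result.
  This weak demand keeps the closure rules short and matches the nested \<open>deriv\<close> of the
  definitions. The second obstacle is that the eigenvalue is given only as a maximum of roots,
  without any regularity. Its continuity comes from comparing positive matrices entrywise; once it
  is known, simplicity of the root gives differentiability by a difference quotient, and no branch
  of roots has to be selected.\<close>

text \<open>\<open>a\<close>, \<open>b\<close>, \<open>c\<close>, \<open>d\<close> are the values at the origin of \<open>f\<close>, $\partial_s f$, $\partial_t f$ and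
  $\partial_s \partial_t f$. One parameter is covered by \<open>f s t = \<phi> (x + s + t)\<close>, where \<open>d\<close> is
  the second derivative of \<open>\<phi>\<close>.\<close>

definition has_jet :: "(real \<Rightarrow> real \<Rightarrow> real) \<Rightarrow> real \<Rightarrow> real \<Rightarrow> real \<Rightarrow> real \<Rightarrow> bool" where
  "has_jet f a b c d \<longleftrightarrow> f 0 0 = a \<and> ((\<lambda>s. f s 0) has_real_derivative b) (at 0) \<and>
     (\<exists>g. (\<forall>\<^sub>F s in nhds 0. (f s has_real_derivative g s) (at 0)) \<and> g 0 = c \<and>
          (g has_real_derivative d) (at 0))"

lemma has_jetI:
  assumes "f 0 0 = a" "((\<lambda>s. f s 0) has_real_derivative b) (at 0)"
    "\<forall>\<^sub>F s in nhds 0. (f s has_real_derivative g s) (at 0)" "g 0 = c"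
    "(g has_real_derivative d) (at 0)"
  shows "has_jet f a b c d"
  using assms unfolding has_jet_def by blast

lemma has_jetE:
  assumes "has_jet f a b c d"
  obtains g where "f 0 0 = a" "((\<lambda>s. f s 0) has_real_derivative b) (at 0)"
    "\<forall>\<^sub>F s in nhds 0. (f s has_real_derivative g s) (at 0)" "g 0 = c"
    "(g has_real_derivative d) (at 0)"
  using assms unfolding has_jet_def by blast

lemma has_jet_imp_deriv:
  assumes "has_jet f a b c d"
  shows "f 0 0 = a" "((\<lambda>s. f s 0) has_real_derivative b) (at 0)"
    "(f 0 has_real_derivative c) (at 0)"
    "((\<lambda>s. deriv (f s) 0) has_real_derivative d) (at 0)"
proof -
  obtain g where g: "f 0 0 = a" "((\<lambda>s. f s 0) has_real_derivative b) (at 0)"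
    "\<forall>\<^sub>F s in nhds 0. (f s has_real_derivative g s) (at 0)" "g 0 = c"
    "(g has_real_derivative d) (at 0)"
    using assms by (rule has_jetE)
  show "f 0 0 = a" "((\<lambda>s. f s 0) has_real_derivative b) (at 0)" by fact+
  show "(f 0 has_real_derivative c) (at 0)"
    using eventually_nhds_x_imp_x[OF g(3)] g(4) by simp
  have "\<forall>\<^sub>F s in nhds 0. deriv (f s) 0 = g s"
    using g(3) by eventually_elim (rule DERIV_imp_deriv)
  then show "((\<lambda>s. deriv (f s) 0) has_real_derivative d) (at 0)"
    using g(5) by (subst DERIV_cong_ev[OF refl _ refl])
qed

lemma has_jet_unique:
  assumes "has_jet f a b c d" "has_jet f a' b' c' d'"
  shows "a = a'" "b = b'" "c = c'" "d = d'"
  using has_jet_imp_deriv[OF assms(1)] has_jet_imp_deriv[OF assms(2)]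
  by (auto dest: DERIV_unique)

text \<open>The neighbourhood of t may depend on s, because each t-derivative is taken at a fixed s.
  The nested filters are also the form in which \<open>jet2_eventually_nonzero\<close> provides its
  neighbourhoods.\<close>

lemma has_jet_cong_ev:
  assumes "has_jet f a b c d" "\<forall>\<^sub>F s in nhds 0. \<forall>\<^sub>F t in nhds 0. f s t = f' s t"
  shows "has_jet f' a b c d"
proof -
  obtain g where g: "f 0 0 = a" "((\<lambda>s. f s 0) has_real_derivative b) (at 0)"
    "\<forall>\<^sub>F s in nhds 0. (f s has_real_derivative g s) (at 0)" "g 0 = c"
    "(g has_real_derivative d) (at 0)"
    using assms(1) by (rule has_jetE)
  have ev: "\<forall>\<^sub>F s in nhds 0. f s 0 = f' s 0"
    using assms(2) by eventually_elim (rule eventually_nhds_x_imp_x)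
  show ?thesis
  proof (rule has_jetI[OF _ _ _ g(4,5)])
    show "f' 0 0 = a" using eventually_nhds_x_imp_x[OF ev] g(1) by simp
    show "((\<lambda>s. f' s 0) has_real_derivative b) (at 0)"
      using g(2) DERIV_cong_ev[OF refl ev refl] by blast
    show "\<forall>\<^sub>F s in nhds 0. (f' s has_real_derivative g s) (at 0)"
      using g(3) assms(2)
    proof eventually_elim
      case (elim s)
      then show ?case using DERIV_cong_ev[OF refl, of "f s" "f' s"] by blast
    qed
  qed
qed

lemma has_jet_const [simp]: "has_jet (\<lambda>_ _. a) a 0 0 0"
  by (rule has_jetI[where g = "\<lambda>_. 0"]) auto

lemma has_jet_fst: "has_jet (\<lambda>s t. s) 0 1 0 0"
  by (rule has_jetI[where g = "\<lambda>_. 0"]) auto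

lemma has_jet_snd: "has_jet (\<lambda>s t. t) 0 0 1 0"
  by (rule has_jetI[where g = "\<lambda>_. 1"]) auto

lemma has_jet_add:
  assumes "has_jet f a b c d" "has_jet f' a' b' c' d'"
  shows "has_jet (\<lambda>s t. f s t + f' s t) (a + a') (b + b') (c + c') (d + d')"
proof -
  obtain g where g: "f 0 0 = a" "((\<lambda>s. f s 0) has_real_derivative b) (at 0)"
    "\<forall>\<^sub>F s in nhds 0. (f s has_real_derivative g s) (at 0)" "g 0 = c"
    "(g has_real_derivative d) (at 0)"
    using assms(1) by (rule has_jetE)
  obtain g' where g': "f' 0 0 = a'" "((\<lambda>s. f' s 0) has_real_derivative b') (at 0)"
    "\<forall>\<^sub>F s in nhds 0. (f' s has_real_derivative g' s) (at 0)" "g' 0 = c'"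
    "(g' has_real_derivative d') (at 0)"
    using assms(2) by (rule has_jetE)
  show ?thesis
  proof (rule has_jetI[where g = "\<lambda>s. g s + g' s"])
    show "\<forall>\<^sub>F s in nhds 0. ((\<lambda>t. f s t + f' s t) has_real_derivative g s + g' s) (at 0)"
      using g(3) g'(3) by eventually_elim (rule DERIV_add)
  qed (use g(1,2,4,5) g'(1,2,4,5) in \<open>auto intro: DERIV_add\<close>)
qed

lemma has_jet_mult:
  assumes "has_jet f a b c d" "has_jet f' a' b' c' d'"
  shows "has_jet (\<lambda>s t. f s t * f' s t) (a * a') (b * a' + a * b') (c * a' + a * c')
           (d * a' + b * c' + c * b' + a * d')"
proof -
  obtain g where g: "f 0 0 = a" "((\<lambda>s. f s 0) has_real_derivative b) (at 0)"
    "\<forall>\<^sub>F s in nhds 0. (f s has_real_derivative g s) (at 0)" "g 0 = c"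
    "(g has_real_derivative d) (at 0)"
    using assms(1) by (rule has_jetE)
  obtain g' where g': "f' 0 0 = a'" "((\<lambda>s. f' s 0) has_real_derivative b') (at 0)"
    "\<forall>\<^sub>F s in nhds 0. (f' s has_real_derivative g' s) (at 0)" "g' 0 = c'"
    "(g' has_real_derivative d') (at 0)"
    using assms(2) by (rule has_jetE)
  show ?thesis
  proof (rule has_jetI[where g = "\<lambda>s. g s * f' s 0 + f s 0 * g' s"])
    show "\<forall>\<^sub>F s in nhds 0. ((\<lambda>t. f s t * f' s t) has_real_derivative g s * f' s 0 + f s 0 * g' s) (at 0)"
      using g(3) g'(3)
      by eventually_elim (auto intro!: derivative_eq_intros)
    show "((\<lambda>s. g s * f' s 0 + f s 0 * g' s) has_real_derivative
            d * a' + b * c' + c * b' + a * d') (at 0)"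
      using g(1,2,4,5) g'(1,2,4,5) by (auto intro!: derivative_eq_intros)
  qed (use g(1,2,4,5) g'(1,2,4,5) in \<open>auto intro!: derivative_eq_intros\<close>)
qed

text \<open>The t-derivative of the composite is taken at the moving point \<open>f s 0\<close>,
  hence differentiability of the outer function is required near a, and that of its derivative only
  at a.\<close>

lemma has_jet_compose:
  assumes "has_jet f a b c d"
    and "\<forall>\<^sub>F x in nhds a. (\<phi> has_real_derivative \<phi>' x) (at x)"
    and "(\<phi>' has_real_derivative e) (at a)"
  shows "has_jet (\<lambda>s t. \<phi> (f s t)) (\<phi> a) (\<phi>' a * b) (\<phi>' a * c) (e * b * c + \<phi>' a * d)"
proof -
  obtain g where g: "f 0 0 = a" "((\<lambda>s. f s 0) has_real_derivative b) (at 0)"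
    "\<forall>\<^sub>F s in nhds 0. (f s has_real_derivative g s) (at 0)" "g 0 = c"
    "(g has_real_derivative d) (at 0)"
    using assms(1) by (rule has_jetE)
  have "isCont (\<lambda>s. f s 0) 0" using g(2) by (rule DERIV_isCont)
  then have "filterlim (\<lambda>s. f s 0) (nhds a) (nhds 0)"
    using g(1) tendsto_at_iff_tendsto_nhds[of "\<lambda>s. f s 0" 0] unfolding isCont_def by simp
  then have ev: "\<forall>\<^sub>F s in nhds 0. (\<phi> has_real_derivative \<phi>' (f s 0)) (at (f s 0))"
    using assms(2) by (rule filterlim_iff[THEN iffD1, rule_format])
  have at_a: "(\<phi> has_real_derivative \<phi>' a) (at a)"
    using assms(2) by (rule eventually_nhds_x_imp_x)
  show ?thesis
  proof (rule has_jetI[where g = "\<lambda>s. \<phi>' (f s 0) * g s"])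
    show "\<forall>\<^sub>F s in nhds 0. ((\<lambda>t. \<phi> (f s t)) has_real_derivative \<phi>' (f s 0) * g s) (at 0)"
      using g(3) ev by eventually_elim (rule DERIV_chain2)
    show "((\<lambda>s. \<phi> (f s 0)) has_real_derivative \<phi>' a * b) (at 0)"
      using at_a g(1,2) by (intro DERIV_chain2) auto
    have "((\<lambda>s. \<phi>' (f s 0)) has_real_derivative e * b) (at 0)"
      using assms(3) g(1,2) by (intro DERIV_chain2) auto
    then show "((\<lambda>s. \<phi>' (f s 0) * g s) has_real_derivative e * b * c + \<phi>' a * d) (at 0)"
      using g(1,4,5) by (auto intro!: derivative_eq_intros)
  qed (use g(1,4,5) in auto)
qed

lemma has_jet_cmult: "has_jet f a b c d \<Longrightarrow> has_jet (\<lambda>s t. k * f s t) (k * a) (k * b) (k * c) (k * d)"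
  using has_jet_mult[OF has_jet_const[of k], of f a b c d] by simp

lemma has_jet_sum:
  assumes "\<And>i. i \<in> I \<Longrightarrow> has_jet (f i) (a i) (b i) (c i) (d i)"
  shows "has_jet (\<lambda>s t. \<Sum>i\<in>I. f i s t) (\<Sum>i\<in>I. a i) (\<Sum>i\<in>I. b i) (\<Sum>i\<in>I. c i) (\<Sum>i\<in>I. d i)"
  using assms by (induction I rule: infinite_finite_induct) (auto intro: has_jet_add)

lemma has_jet_exp:
  assumes "has_jet f a b c d"
  shows "has_jet (\<lambda>s t. exp (f s t)) (exp a) (exp a * b) (exp a * c) (exp a * b * c + exp a * d)"
  by (rule has_jet_compose[OF assms]) (auto intro!: derivative_eq_intros always_eventually)

lemma has_jet_ln:
  assumes "has_jet f a b c d" "a > 0"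
  shows "has_jet (\<lambda>s t. ln (f s t)) (ln a) (b / a) (c / a) (d / a - b * c / a\<^sup>2)"
proof -
  have "\<forall>\<^sub>F x in nhds a. (ln has_real_derivative inverse x) (at x)"
    using eventually_nhds_in_open[of "{0<..}" a] \<open>a > 0\<close>
    by (auto elim!: eventually_mono intro!: derivative_eq_intros simp: inverse_eq_divide)
  moreover have "(inverse has_real_derivative - (inverse a)\<^sup>2) (at a)"
    using \<open>a > 0\<close> by (auto intro!: derivative_eq_intros simp: power2_eq_square)
  ultimately show ?thesis
    using has_jet_compose[OF assms(1), of ln inverse "- (inverse a)\<^sup>2"]
      \<open>a > 0\<close> by (simp add: divide_simps power2_eq_square)
qed

lemma has_jet_inverse:
  assumes "has_jet f a b c d" "a \<noteq> 0"
  shows "\<exists>b c d. has_jet (\<lambda>s t. inverse (f s t)) (inverse a) b c d"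
proof -
  have "\<forall>\<^sub>F x in nhds a. (inverse has_real_derivative - (inverse x ^ 2)) (at x)"
    using eventually_nhds_in_open[of "- {0}" a, OF open_delete[of UNIV 0, unfolded Compl_eq_Diff_UNIV[symmetric]]] \<open>a \<noteq> 0\<close>
    by (auto elim!: eventually_mono intro!: derivative_eq_intros simp: power2_eq_square)
  moreover have "((\<lambda>x. - (inverse x ^ 2)) has_real_derivative 2 * inverse a ^ 3) (at a)"
    using \<open>a \<noteq> 0\<close> by (auto intro!: derivative_eq_intros simp: power2_eq_square power3_eq_cube)
  ultimately show ?thesis
    using has_jet_compose[OF assms(1), of inverse "\<lambda>x. - (inverse x ^ 2)" "2 * inverse a ^ 3"] by blast
qed

text \<open>Truncated subtraction in the exponents is harmless: wherever it takes effect, the factor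
  \<open>real n\<close> or \<open>real n * real (n - 1)\<close> vanishes.\<close>

lemma has_jet_power:
  assumes "has_jet f a b c d"
  shows "has_jet (\<lambda>s t. f s t ^ n) (a ^ n) (real n * a ^ (n - 1) * b) (real n * a ^ (n - 1) * c)
     (real n * real (n - 1) * a ^ (n - 2) * b * c + real n * a ^ (n - 1) * d)"
proof -
  have "((\<lambda>x. real n * x ^ (n - 1)) has_real_derivative real n * real (n - 1) * a ^ (n - 2)) (at a)"
    by (auto intro!: derivative_eq_intros simp: numeral_2_eq_2)
  moreover have "\<forall>x. ((\<lambda>x. x ^ n) has_real_derivative real n * x ^ (n - 1)) (at x)"
    by (auto intro!: derivative_eq_intros)
  ultimately show ?thesis
    using has_jet_compose[OF assms, of "\<lambda>x. x ^ n" "\<lambda>x. real n * x ^ (n - 1)"] by auto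
qed

section \<open>Jets with unnamed derivatives\<close>

definition jet2 :: "(real \<Rightarrow> real \<Rightarrow> real) \<Rightarrow> bool" where
  "jet2 f \<longleftrightarrow> (\<exists>a b c d. has_jet f a b c d)"

lemma jet2E:
  assumes "jet2 f"
  obtains b c d where "has_jet f (f 0 0) b c d"
  using assms has_jet_imp_deriv(1) unfolding jet2_def by blast

lemma jet2I: "has_jet f a b c d \<Longrightarrow> jet2 f"
  unfolding jet2_def by blast

lemma jet2_const [intro!]: "jet2 (\<lambda>_ _. a)"
  using has_jet_const by (rule jet2I)

lemma jet2_mult [intro!]: "jet2 f \<Longrightarrow> jet2 g \<Longrightarrow> jet2 (\<lambda>s t. f s t * g s t)"
  by (elim jet2E) (rule jet2I, rule has_jet_mult)

lemma jet2_add [intro!]: "jet2 f \<Longrightarrow> jet2 g \<Longrightarrow> jet2 (\<lambda>s t. f s t + g s t)"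
  by (elim jet2E) (rule jet2I, rule has_jet_add)

lemma jet2_minus [intro!]: "jet2 f \<Longrightarrow> jet2 (\<lambda>s t. - f s t)"
  using jet2_mult[OF jet2_const[of "-1"], of f] by simp

lemma jet2_diff [intro!]: "jet2 f \<Longrightarrow> jet2 g \<Longrightarrow> jet2 (\<lambda>s t. f s t - g s t)"
  using jet2_add[OF _ jet2_minus, of f g] by simp

lemma jet2_sum [intro!]: "(\<And>i. i \<in> I \<Longrightarrow> jet2 (f i)) \<Longrightarrow> jet2 (\<lambda>s t. \<Sum>i\<in>I. f i s t)"
  by (induction I rule: infinite_finite_induct) auto

lemma jet2_prod [intro!]: "(\<And>i. i \<in> I \<Longrightarrow> jet2 (f i)) \<Longrightarrow> jet2 (\<lambda>s t. \<Prod>i\<in>I. f i s t)"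
  by (induction I rule: infinite_finite_induct) auto

lemma jet2_divide [intro]: "jet2 f \<Longrightarrow> jet2 g \<Longrightarrow> g 0 0 \<noteq> 0 \<Longrightarrow> jet2 (\<lambda>s t. f s t / g s t)"
  unfolding divide_inverse by (intro jet2_mult) (metis has_jet_inverse jet2E jet2I)+

lemma jet2_cong_ev:
  "jet2 f \<Longrightarrow> \<forall>\<^sub>F s in nhds 0. \<forall>\<^sub>F t in nhds 0. f s t = f' s t \<Longrightarrow> jet2 f'"
  by (elim jet2E) (rule jet2I, rule has_jet_cong_ev)

text \<open>Continuity is used twice: along the s-axis at the origin, then in t at each of the
  points \<open>(s, 0)\<close> so obtained.\<close>

lemma jet2_eventually_nonzero:
  assumes "jet2 f" "f 0 0 \<noteq> 0"
  shows "\<forall>\<^sub>F s in nhds 0. \<forall>\<^sub>F t in nhds 0. f s t \<noteq> 0"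
proof -
  obtain b c d where "has_jet f (f 0 0) b c d" using assms(1) by (rule jet2E)
  then obtain g where g: "((\<lambda>s. f s 0) has_real_derivative b) (at 0)"
    "\<forall>\<^sub>F s in nhds 0. (f s has_real_derivative g s) (at 0)"
    by (rule has_jetE)
  have *: "\<forall>\<^sub>F x in nhds 0. \<phi> x \<noteq> 0" if "(\<phi> has_real_derivative e) (at 0)" "\<phi> 0 \<noteq> 0"
    for \<phi> :: "real \<Rightarrow> real" and e :: real
  proof -
    have "\<forall>\<^sub>F x in at 0. \<phi> x \<noteq> 0"
      using DERIV_isCont[OF that(1)] that(2) unfolding isCont_def by (rule tendsto_imp_eventually_ne)
    then show ?thesis
      unfolding eventually_at_filter by (rule eventually_mono) (use that(2) in auto)
  qed
  from *[OF g(1) assms(2)] g(2) show ?thesis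
    by eventually_elim (rule *)
qed

text \<open>The t-derivative of \<open>\<phi> (a + s + t)\<close> at \<open>t = 0\<close> is the
  derivative of \<phi> at \<open>a + s\<close>, so differentiating it in s yields the second
  derivative of \<phi>.\<close>

lemma has_jet_shift_deriv:
  assumes "has_jet (\<lambda>s t. \<phi> (a + s + t)) v b c d"
  shows "\<phi> a = v" "(\<phi> has_real_derivative c) (at a)" "(deriv \<phi> has_real_derivative d) (at a)" "b = c"
proof -
  note j = has_jet_imp_deriv[OF assms]
  show "\<phi> a = v" using j(1) by simp
  show c: "(\<phi> has_real_derivative c) (at a)"
    using j(3) DERIV_shift[of \<phi> c 0 a] by (simp add: add.commute)
  show "b = c" using j(2,3) by (simp add: DERIV_unique)
  have "deriv (\<lambda>t. \<phi> (a + s + t)) 0 = deriv \<phi> (a + s)" for s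
    unfolding deriv_def using DERIV_shift[of \<phi> _ 0 "a + s"] by (simp add: add.commute)
  then show "(deriv \<phi> has_real_derivative d) (at a)"
    using j(4) DERIV_shift[of "deriv \<phi>" d 0 a] by (simp add: add.commute)
qed

section \<open>Powers of stochastic matrices\<close>

text \<open>Plain functions of indices let jets and sums act entry by entry. The new factor stands
  on the left, so each column of the power is a vector to which the matrix is applied once
  more.\<close>

primrec mpow :: "nat \<Rightarrow> (nat \<Rightarrow> nat \<Rightarrow> real) \<Rightarrow> nat \<Rightarrow> nat \<Rightarrow> nat \<Rightarrow> real" where
  "mpow n A 0 = (\<lambda>i j. of_bool (i = j))"
| "mpow n A (Suc k) = (\<lambda>i j. \<Sum>l<n. A i l * mpow n A k l j)"

lemma mpow_pos:
  assumes B: "\<And>i j. i < n \<Longrightarrow> j < n \<Longrightarrow> 0 < B i j" and "0 < n" "0 < k" "i < n" "j < n"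
  shows "0 < mpow n B k i j"
proof -
  have "0 < mpow n B (Suc k) i j" if "i < n" for k i
    using that
  proof (induction k arbitrary: i)
    case 0
    then show ?case using B \<open>j < n\<close> by simp
  next
    case (Suc k)
    show ?case
      unfolding mpow.simps(2)[of n B "Suc k"] using Suc B \<open>0 < n\<close>
      by (intro sum_pos) auto
  qed
  then show ?thesis using assms(3,4) by (cases k) auto
qed

text \<open>A bound on the seminorm that vanishes exactly on the constants, which are the fixed
  vectors of a positive stochastic matrix.\<close>

definition osc_le :: "nat \<Rightarrow> (nat \<Rightarrow> real) \<Rightarrow> real \<Rightarrow> bool" where
  "osc_le n f e \<longleftrightarrow> (\<forall>i<n. \<forall>j<n. f i - f j \<le> e)"

lemma osc_leD: "osc_le n f e \<Longrightarrow> i < n \<Longrightarrow> j < n \<Longrightarrow> \<bar>f i - f j\<bar> \<le> e"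
  unfolding osc_le_def by (simp add: abs_le_iff)

lemma osc_le_add: "osc_le n f e \<Longrightarrow> osc_le n g e' \<Longrightarrow> osc_le n (\<lambda>i. f i + g i) (e + e')"
  unfolding osc_le_def by (smt (verit))

text \<open>Dobrushin's contraction: any two rows share at least the mass \<delta> in every column.
  After this common part is removed, each row has the remaining mass
  \<open>1 - n * \<delta>\<close>, which averages f between its minimum and maximum.\<close>

lemma osc_le_stochastic:
  fixes a :: "nat \<Rightarrow> nat \<Rightarrow> real"
  assumes "osc_le n f e" "n > 0"
    and sum1: "\<And>i. i < n \<Longrightarrow> (\<Sum>j<n. a i j) = 1"
    and ge: "\<And>i j. i < n \<Longrightarrow> j < n \<Longrightarrow> a i j \<ge> \<delta>" and "\<delta> \<ge> 0"
  shows "osc_le n (\<lambda>i. \<Sum>l<n. a i l * f l) ((1 - \<delta>) * e)"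
  unfolding osc_le_def
proof (intro allI impI)
  fix i j assume ij: "i < n" "j < n"
  define m where "m = Min (f ` {..<n})"
  define M where "M = Max (f ` {..<n})"
  have ne: "f ` {..<n} \<noteq> {}" using \<open>n > 0\<close> by auto
  have "m \<in> f ` {..<n}" "M \<in> f ` {..<n}"
    unfolding m_def M_def using ne by (intro Min_in Max_in; simp)+
  then have "M - m \<le> e" using assms(1) unfolding osc_le_def by auto
  have bnd: "m \<le> f l" "f l \<le> M" if "l < n" for l
    unfolding m_def M_def using that by auto
  have "m \<le> M" using bnd[of 0] \<open>n > 0\<close> by linarith
  have "(\<Sum>l<n. a i l * f l) - (\<Sum>l<n. a j l * f l)
      = (\<Sum>l<n. (a i l - \<delta>) * f l) - (\<Sum>l<n. (a j l - \<delta>) * f l)"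
    by (simp add: left_diff_distrib sum_subtractf)
  also have "\<dots> \<le> (\<Sum>l<n. (a i l - \<delta>) * M) - (\<Sum>l<n. (a j l - \<delta>) * m)"
    using ge ij bnd by (intro diff_mono sum_mono mult_left_mono) auto
  also have "\<dots> = (1 - real n * \<delta>) * (M - m)"
    using sum1 ij by (simp add: sum_distrib_right[symmetric] sum_subtractf right_diff_distrib)
  \<comment> \<open>As n is at least 1, the rate may be weakened to one that does not mention
    n.\<close>
  also have "\<dots> \<le> (1 - \<delta>) * (M - m)"
    using \<open>m \<le> M\<close> \<open>n > 0\<close> \<open>\<delta> \<ge> 0\<close> mult_right_mono[of 1 "real n" \<delta>]
    by (intro mult_right_mono) auto
  also have "\<dots> \<le> (1 - \<delta>) * e"
  proof -
    have "\<delta> \<le> (\<Sum>l<n. a i l)"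
      using member_le_sum[of i "{..<n}" "a i"] ge[OF ij(1) ij(1)] ge[OF ij(1)] ij \<open>\<delta> \<ge> 0\<close>
      by (smt (verit) finite_lessThan lessThan_iff DiffD1)
    then have "\<delta> \<le> 1" using sum1 ij by simp
    then show ?thesis using \<open>M - m \<le> e\<close> by (intro mult_left_mono) auto
  qed
  finally show "(\<Sum>l<n. a i l * f l) - (\<Sum>l<n. a j l * f l) \<le> (1 - \<delta>) * e" .
qed

text \<open>The rows of the derivative of a stochastic family sum to 0. Hence \<open>f 0\<close> may
  be subtracted from f for free, and every value is controlled by the oscillation; the factor 2
  comes from the difference of two rows.\<close>

lemma osc_le_zero_rows:
  fixes b :: "nat \<Rightarrow> nat \<Rightarrow> real"
  assumes "osc_le n f e" "n > 0"
    and sum0: "\<And>i. i < n \<Longrightarrow> (\<Sum>j<n. b i j) = 0"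
    and le: "\<And>i. i < n \<Longrightarrow> (\<Sum>j<n. \<bar>b i j\<bar>) \<le> M"
  shows "osc_le n (\<lambda>i. \<Sum>l<n. b i l * f l) (2 * M * e)"
  unfolding osc_le_def
proof (intro allI impI)
  have *: "\<bar>\<Sum>l<n. b i l * f l\<bar> \<le> M * e" if "i < n" for i
  proof -
    have "(\<Sum>l<n. b i l * f l) = (\<Sum>l<n. b i l * (f l - f 0))"
      using sum0[OF that] by (simp add: right_diff_distrib sum_subtractf flip: sum_distrib_right)
    also have "\<bar>\<dots>\<bar> \<le> (\<Sum>l<n. \<bar>b i l\<bar> * e)"
      using osc_leD[OF assms(1)] \<open>n > 0\<close>
      by (intro order.trans[OF sum_abs] sum_mono) (auto simp: abs_mult intro: mult_left_mono)
    also have "\<dots> = (\<Sum>l<n. \<bar>b i l\<bar>) * e" by (simp add: sum_distrib_right)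
    also have "\<dots> \<le> M * e"
      using le[OF that] osc_leD[OF assms(1), of 0 0] \<open>n > 0\<close> by (intro mult_right_mono) auto
    finally show ?thesis .
  qed
  then show "(\<Sum>l<n. b i l * f l) - (\<Sum>l<n. b j l * f l) \<le> 2 * M * e" if "i < n" "j < n" for i j
    using *[OF that(1)] *[OF that(2)] by (simp add: abs_le_iff)
qed

text \<open>Near a positive stochastic matrix the powers converge to a rank one matrix together with
  their derivatives: in the norm \<open>w + B (y + z) + B\<^sup>2 x\<close> on the oscillations of the
  columns of value, first and mixed derivatives, multiplication is a contraction for large \<open>B\<close>.\<close>

lemma has_jet_trace_stochastic_power:
  fixes S :: "real \<Rightarrow> real \<Rightarrow> nat \<Rightarrow> nat \<Rightarrow> real"
  assumes "n > 0"
    and jet: "\<And>i j. i < n \<Longrightarrow> j < n \<Longrightarrow> jet2 (\<lambda>s t. S s t i j)"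
    and rows: "\<And>s t i. i < n \<Longrightarrow> (\<Sum>j<n. S s t i j) = 1"
    and pos: "\<And>i j. i < n \<Longrightarrow> j < n \<Longrightarrow> S 0 0 i j > 0"
  obtains p q r v :: "nat \<Rightarrow> real" where
    "\<And>k. has_jet (\<lambda>s t. \<Sum>j<n. mpow n (S s t) k j j) (p k) (q k) (r k) (v k)"
    "p \<longlonglongrightarrow> 1" "q \<longlonglongrightarrow> 0" "r \<longlonglongrightarrow> 0" "v \<longlonglongrightarrow> 0"
proof -
  have "\<exists>b c d. \<forall>i<n. \<forall>j<n. has_jet (\<lambda>s t. S s t i j) (S 0 0 i j) (b i j) (c i j) (d i j)"
  proof -
    have "\<exists>z. i < n \<longrightarrow> j < n \<longrightarrow>
        has_jet (\<lambda>s t. S s t i j) (S 0 0 i j) (fst z) (fst (snd z)) (snd (snd z))" for i j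
      using jet[of i j] by (auto elim!: jet2E)
    then obtain z where "\<And>i j. i < n \<longrightarrow> j < n \<longrightarrow>
        has_jet (\<lambda>s t. S s t i j) (S 0 0 i j) (fst (z i j)) (fst (snd (z i j))) (snd (snd (z i j)))"
      by metis
    then show ?thesis
      by (intro exI[of _ "\<lambda>i j. fst (z i j)"] exI[of _ "\<lambda>i j. fst (snd (z i j))"]
          exI[of _ "\<lambda>i j. snd (snd (z i j))"]) auto
  qed
  then obtain b c d where S: "\<And>i j. i < n \<Longrightarrow> j < n \<Longrightarrow>
      has_jet (\<lambda>s t. S s t i j) (S 0 0 i j) (b i j) (c i j) (d i j)" by blast
  define a where "a = S 0 0"
  note S = S[folded a_def]
  \<comment> \<open>The row sums are constantly 1, so uniqueness of jets makes all their derivatives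
    vanish.\<close>
  have sums: "(\<Sum>j<n. a i j) = 1" "(\<Sum>j<n. b i j) = 0" "(\<Sum>j<n. c i j) = 0" "(\<Sum>j<n. d i j) = 0"
    if "i < n" for i
  proof -
    have "has_jet (\<lambda>s t. \<Sum>j<n. S s t i j) (\<Sum>j<n. a i j) (\<Sum>j<n. b i j) (\<Sum>j<n. c i j) (\<Sum>j<n. d i j)"
      using S[OF that] by (intro has_jet_sum) auto
    moreover have "(\<lambda>s t. \<Sum>j<n. S s t i j) = (\<lambda>s t. 1)" using rows[OF that] by (intro ext)
    ultimately show "(\<Sum>j<n. a i j) = 1" "(\<Sum>j<n. b i j) = 0" "(\<Sum>j<n. c i j) = 0" "(\<Sum>j<n. d i j) = 0"
      using has_jet_unique[OF _ has_jet_const[of 1]] by auto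
  qed

  define \<delta> where "\<delta> = Min ((\<lambda>(i,j). a i j) ` ({..<n} \<times> {..<n}))"
  have "\<delta> \<in> (\<lambda>(i,j). a i j) ` ({..<n} \<times> {..<n})"
    unfolding \<delta>_def using \<open>n > 0\<close> by (intro Min_in) auto
  then have "\<delta> > 0" using pos unfolding a_def by auto
  have \<delta>: "a i j \<ge> \<delta>" if "i < n" "j < n" for i j
    unfolding \<delta>_def using that by (intro Min_le) auto
  have "\<delta> \<le> 1"
  proof -
    have "\<delta> \<le> a 0 0" using \<delta> \<open>n > 0\<close> by simp
    also have "a 0 0 \<le> (\<Sum>j<n. a 0 j)"
      using \<open>n > 0\<close> \<delta> \<open>\<delta> > 0\<close> by (intro member_le_sum) (auto intro: order.trans[OF less_imp_le])
    finally show ?thesis using sums(1) \<open>n > 0\<close> by simp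
  qed
  define \<rho> where "\<rho> = 1 - \<delta>"
  have \<rho>: "0 \<le> \<rho>" "\<rho> < 1" unfolding \<rho>_def using \<open>\<delta> > 0\<close> \<open>\<delta> \<le> 1\<close> by auto
  define N where "N = (\<Sum>i<n. \<Sum>j<n. \<bar>b i j\<bar> + \<bar>c i j\<bar> + \<bar>d i j\<bar>)"
  have N: "(\<Sum>j<n. \<bar>b i j\<bar>) \<le> N" "(\<Sum>j<n. \<bar>c i j\<bar>) \<le> N" "(\<Sum>j<n. \<bar>d i j\<bar>) \<le> N" if "i < n" for i
  proof -
    have *: "(\<Sum>j<n. \<bar>b i j\<bar> + \<bar>c i j\<bar> + \<bar>d i j\<bar>) \<le> N"
      unfolding N_def using that
      by (intro member_le_sum[of i "{..<n}" "\<lambda>i. \<Sum>j<n. \<bar>b i j\<bar> + \<bar>c i j\<bar> + \<bar>d i j\<bar>"])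
         (auto intro!: sum_nonneg)
    show "(\<Sum>j<n. \<bar>b i j\<bar>) \<le> N" "(\<Sum>j<n. \<bar>c i j\<bar>) \<le> N" "(\<Sum>j<n. \<bar>d i j\<bar>) \<le> N"
      by (rule order.trans[OF _ *], rule sum_mono, simp)+
  qed
  have "N \<ge> 0" using N(1)[OF \<open>n > 0\<close>] by (rule order.trans[rotated]) (auto intro!: sum_nonneg)
  define M where "M = 2 * N"
  have "M \<ge> 0" using \<open>N \<ge> 0\<close> unfolding M_def by simp
  note osc_a = osc_le_stochastic[OF _ \<open>n > 0\<close> sums(1) \<delta> less_imp_le[OF \<open>\<delta> > 0\<close>], folded \<rho>_def]
  note osc_b = osc_le_zero_rows[OF _ \<open>n > 0\<close> sums(2) N(1), folded M_def]
  note osc_c = osc_le_zero_rows[OF _ \<open>n > 0\<close> sums(3) N(2), folded M_def]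
  note osc_d = osc_le_zero_rows[OF _ \<open>n > 0\<close> sums(4) N(3), folded M_def]

  \<comment> \<open>The cross terms are \<open>M * (y + z)\<close> and
    \<open>M * x + 2 * B * M * x\<close>, the latter at most \<open>3 * B * M * x\<close>. The
    condition \<open>6 * M \<le> B * (1 - \<rho>)\<close> lets half of the gap
    \<open>1 - \<rho>\<close> absorb them; the other half remains in the rate
    \<open>\<rho>'\<close>.\<close>
  define B where "B = 1 + 6 * M / (1 - \<rho>)"
  have "B \<ge> 1" unfolding B_def using \<rho> \<open>M \<ge> 0\<close> by simp
  have B: "6 * M \<le> B * (1 - \<rho>)"
  proof -
    have "B * (1 - \<rho>) = (1 - \<rho>) + 6 * M" unfolding B_def using \<rho> by (simp add: distrib_right)
    then show ?thesis using \<rho> by simp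
  qed
  define \<rho>' where "\<rho>' = (1 + \<rho>) / 2"
  have \<rho>': "0 < \<rho>'" "\<rho>' < 1" unfolding \<rho>'_def using \<rho> by auto

  \<comment> \<open>Induction over the power for a fixed column j. The identity column has
    oscillation at most 1 and no derivatives, which explains the initial bound
    \<open>B\<^sup>2\<close>.\<close>
  have main: "\<exists>X Y Z W x y z w.
      (\<forall>i<n. has_jet (\<lambda>s t. mpow n (S s t) k i j) (X i) (Y i) (Z i) (W i)) \<and>
      osc_le n X x \<and> osc_le n Y y \<and> osc_le n Z z \<and> osc_le n W w \<and>
      0 \<le> x \<and> 0 \<le> y \<and> 0 \<le> z \<and> 0 \<le> w \<and> w + B * (y + z) + B\<^sup>2 * x \<le> B\<^sup>2 * \<rho>' ^ k" for k j
  proof (induction k)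
    case 0
    show ?case
      by (rule exI[of _ "\<lambda>i. of_bool (i = j)"], (rule exI[of _ "\<lambda>i. 0"])+, rule exI[of _ 1],
          (rule exI[of _ 0])+) (auto simp: osc_le_def)
  next
    case (Suc k)
    then obtain X Y Z W x y z w where
      jets: "\<And>i. i < n \<Longrightarrow> has_jet (\<lambda>s t. mpow n (S s t) k i j) (X i) (Y i) (Z i) (W i)" and
      osc: "osc_le n X x" "osc_le n Y y" "osc_le n Z z" "osc_le n W w" and
      nn: "0 \<le> x" "0 \<le> y" "0 \<le> z" "0 \<le> w" and
      le: "w + B * (y + z) + B\<^sup>2 * x \<le> B\<^sup>2 * \<rho>' ^ k" by blast
    have key: "(M * x + M * z + M * y + \<rho> * w) + B * ((M * x + \<rho> * y) + (M * x + \<rho> * z)) + B\<^sup>2 * (\<rho> * x)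
        \<le> \<rho>' * (w + B * (y + z) + B\<^sup>2 * x)"
    proof -
      have "2 * (M * (y + z)) \<le> (1 - \<rho>) * (B * (y + z))"
      proof -
        have "6 * M * (y + z) \<le> B * (1 - \<rho>) * (y + z)"
          using B nn by (intro mult_right_mono) auto
        moreover have "0 \<le> M * (y + z)" using nn \<open>M \<ge> 0\<close> by simp
        ultimately show ?thesis by (simp add: mult.assoc mult.left_commute[of "1 - \<rho>"])
      qed
      moreover have "2 * (M * x + 2 * (B * (M * x))) \<le> (1 - \<rho>) * (B\<^sup>2 * x)"
      proof -
        have "M * x \<le> B * (M * x)" using \<open>B \<ge> 1\<close> \<open>M \<ge> 0\<close> nn mult_right_mono[of 1 B "M * x"] by simp
        moreover have "B * x * (6 * M) \<le> B * x * (B * (1 - \<rho>))"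
          using B nn \<open>B \<ge> 1\<close> by (intro mult_left_mono) auto
        ultimately show ?thesis by (simp add: power2_eq_square algebra_simps)
      qed
      moreover have "0 \<le> (1 - \<rho>) * w" using \<rho> nn by simp
      ultimately show ?thesis unfolding \<rho>'_def by (simp add: algebra_simps add_divide_distrib)
    qed
    let ?X = "\<lambda>i. \<Sum>l<n. a i l * X l"
    let ?Y = "\<lambda>i. (\<Sum>l<n. b i l * X l) + (\<Sum>l<n. a i l * Y l)"
    let ?Z = "\<lambda>i. (\<Sum>l<n. c i l * X l) + (\<Sum>l<n. a i l * Z l)"
    let ?W = "\<lambda>i. (\<Sum>l<n. d i l * X l) + (\<Sum>l<n. b i l * Z l) + (\<Sum>l<n. c i l * Y l) + (\<Sum>l<n. a i l * W l)"
    have "has_jet (\<lambda>s t. mpow n (S s t) (Suc k) i j) (?X i) (?Y i) (?Z i) (?W i)" if "i < n" for i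
      using has_jet_sum[of "{..<n}", OF has_jet_mult[OF S[OF that] jets]]
      by (simp add: sum.distrib)
    moreover have "osc_le n ?X (\<rho> * x)" by (intro osc_a osc)
    moreover have "osc_le n ?Y (M * x + \<rho> * y)" by (intro osc_le_add osc_a osc_b osc)
    moreover have "osc_le n ?Z (M * x + \<rho> * z)" by (intro osc_le_add osc_a osc_c osc)
    moreover have "osc_le n ?W (M * x + M * z + M * y + \<rho> * w)"
      by (intro osc_le_add osc_a osc_b osc_c osc_d osc)
    moreover have "(M * x + M * z + M * y + \<rho> * w) + B * ((M * x + \<rho> * y) + (M * x + \<rho> * z)) + B\<^sup>2 * (\<rho> * x)
        \<le> B\<^sup>2 * \<rho>' ^ Suc k"
      using order.trans[OF key mult_left_mono[OF le]] \<rho>' by (simp add: algebra_simps)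
    moreover have "0 \<le> \<rho> * x" "0 \<le> M * x + \<rho> * y" "0 \<le> M * x + \<rho> * z"
      "0 \<le> M * x + M * z + M * y + \<rho> * w"
      using nn \<rho> \<open>M \<ge> 0\<close> by (auto intro!: add_nonneg_nonneg)
    ultimately show ?case
      by - (rule exI[of _ ?X], rule exI[of _ ?Y], rule exI[of _ ?Z], rule exI[of _ ?W],
          rule exI[of _ "\<rho> * x"], rule exI[of _ "M * x + \<rho> * y"],
          rule exI[of _ "M * x + \<rho> * z"], rule exI[of _ "M * x + M * z + M * y + \<rho> * w"], blast)
  qed
  have main': "\<exists>D. (\<forall>i<n. has_jet (\<lambda>s t. mpow n (S s t) k i j) (D 0 i) (D 1 i) (D 2 i) (D (3::nat) i)) \<and>
      (\<forall>m<4. osc_le n (D m) (B\<^sup>2 * \<rho>' ^ k))" for k j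
  proof -
    obtain X Y Z W x y z w where
      jets: "\<forall>i<n. has_jet (\<lambda>s t. mpow n (S s t) k i j) (X i) (Y i) (Z i) (W i)" and
      osc: "osc_le n X x" "osc_le n Y y" "osc_le n Z z" "osc_le n W w" and
      nn: "0 \<le> x" "0 \<le> y" "0 \<le> z" "0 \<le> w" and
      le: "w + B * (y + z) + B\<^sup>2 * x \<le> B\<^sup>2 * \<rho>' ^ k" using main[of k j] by blast
    have "y \<le> B * y" "z \<le> B * z" "x \<le> B\<^sup>2 * x"
      using nn \<open>B \<ge> 1\<close> mult_right_mono[of 1 B] mult_right_mono[of 1 "B\<^sup>2"] by (auto simp: one_le_power)
    then have "x \<le> B\<^sup>2 * \<rho>' ^ k" "y \<le> B\<^sup>2 * \<rho>' ^ k" "z \<le> B\<^sup>2 * \<rho>' ^ k" "w \<le> B\<^sup>2 * \<rho>' ^ k"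
      using le nn by (simp_all add: algebra_simps)
    then have "osc_le n X (B\<^sup>2 * \<rho>' ^ k)" "osc_le n Y (B\<^sup>2 * \<rho>' ^ k)"
      "osc_le n Z (B\<^sup>2 * \<rho>' ^ k)" "osc_le n W (B\<^sup>2 * \<rho>' ^ k)"
      using osc unfolding osc_le_def by (meson order.trans)+
    then show ?thesis using jets
      by (intro exI[of _ "\<lambda>m. if m = 0 then X else if m = 1 then Y else if m = 2 then Z else W"])
         (auto simp: less_Suc_eq numeral_eq_Suc)
  qed
  then obtain D where
    D: "\<And>k i j. i < n \<Longrightarrow> has_jet (\<lambda>s t. mpow n (S s t) k i j) (D k j 0 i) (D k j 1 i) (D k j 2 i) (D k j (3::nat) i)"
    and osc: "\<And>k j m. m < 4 \<Longrightarrow> osc_le n (D k j m) (B\<^sup>2 * \<rho>' ^ k)" by metis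
  have row: "(\<Sum>j<n. mpow n (S s t) k i j) = 1" if "i < n" for s t k i
    using that
  proof (induction k arbitrary: i)
    case (Suc k)
    have "(\<Sum>j<n. mpow n (S s t) (Suc k) i j) = (\<Sum>l<n. S s t i l * (\<Sum>j<n. mpow n (S s t) k l j))"
      by (simp add: sum_distrib_left) (rule sum.swap)
    also have "\<dots> = 1" using Suc rows by simp
    finally show ?case .
  qed simp
  \<comment> \<open>Row 0 of the power sums to 1 identically, so its jet is known exactly. The trace
    differs from this row sum only by differences within the columns, and these are bounded by the
    oscillations.\<close>
  have "has_jet (\<lambda>s t. \<Sum>j<n. mpow n (S s t) k 0 j)
      (\<Sum>j<n. D k j 0 0) (\<Sum>j<n. D k j 1 0) (\<Sum>j<n. D k j 2 0) (\<Sum>j<n. D k j 3 0)" for k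
    using D \<open>n > 0\<close> by (intro has_jet_sum) auto
  then have "has_jet (\<lambda>s t. 1)
      (\<Sum>j<n. D k j 0 0) (\<Sum>j<n. D k j 1 0) (\<Sum>j<n. D k j 2 0) (\<Sum>j<n. D k j 3 0)" for k
    using row \<open>n > 0\<close> by simp
  note first = has_jet_unique[OF this has_jet_const]
  have lim: "(\<lambda>k. (\<Sum>j<n. D k j m j) - (\<Sum>j<n. D k j m 0)) \<longlonglongrightarrow> 0" if "m < 4" for m
  proof (rule Lim_null_comparison)
    have "\<bar>(\<Sum>j<n. D k j m j) - (\<Sum>j<n. D k j m 0)\<bar> \<le> (\<Sum>j<n. B\<^sup>2 * \<rho>' ^ k)" for k
      unfolding sum_subtractf[symmetric]
      using osc_leD[OF osc[OF that]] \<open>n > 0\<close> by (intro order.trans[OF sum_abs] sum_mono) auto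
    then show "\<forall>\<^sub>F k in sequentially.
        norm ((\<Sum>j<n. D k j m j) - (\<Sum>j<n. D k j m 0)) \<le> real n * B\<^sup>2 * \<rho>' ^ k"
      by (simp add: mult.assoc)
    show "(\<lambda>k. real n * B\<^sup>2 * \<rho>' ^ k) \<longlonglongrightarrow> 0"
      using \<rho>' by (intro tendsto_mult_right_zero LIMSEQ_realpow_zero) auto
  qed
  show ?thesis
  proof (rule that)
    show "has_jet (\<lambda>s t. \<Sum>j<n. mpow n (S s t) k j j)
      (\<Sum>j<n. D k j 0 j) (\<Sum>j<n. D k j 1 j) (\<Sum>j<n. D k j 2 j) (\<Sum>j<n. D k j 3 j)" for k
      using D by (intro has_jet_sum) auto
    show "(\<lambda>k. \<Sum>j<n. D k j 0 j) \<longlonglongrightarrow> 1"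
      using tendsto_add[OF lim[of 0] tendsto_const[of 1]] first(1) by simp
    show "(\<lambda>k. \<Sum>j<n. D k j 1 j) \<longlonglongrightarrow> 0" "(\<lambda>k. \<Sum>j<n. D k j 2 j) \<longlonglongrightarrow> 0"
      "(\<lambda>k. \<Sum>j<n. D k j 3 j) \<longlonglongrightarrow> 0"
      using lim[of 1] lim[of 2] lim[of 3] first(2-4) by simp_all
  qed
qed

section \<open>Positive matrices\<close>

text \<open>The normalization \<open>u 0 = 1\<close> picks one vector on the Perron ray. It makes u
  unique, and it lets Cramer's rule at column 0 reproduce a determinant without a factor.\<close>

definition perron :: "nat \<Rightarrow> (nat \<Rightarrow> nat \<Rightarrow> real) \<Rightarrow> real \<Rightarrow> (nat \<Rightarrow> real) \<Rightarrow> bool" where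
  "perron n A l u \<longleftrightarrow> 0 < n \<and> (\<forall>i<n. \<forall>j<n. 0 < A i j) \<and> (\<forall>i<n. 0 < u i) \<and> u 0 = 1 \<and>
     (\<forall>i<n. (\<Sum>j<n. A i j * u j) = l * u i)"

text \<open>The Doob transform of A: conjugation by the diagonal matrix of u, divided by the
  eigenvalue.\<close>

definition pstoch :: "(nat \<Rightarrow> nat \<Rightarrow> real) \<Rightarrow> real \<Rightarrow> (nat \<Rightarrow> real) \<Rightarrow> nat \<Rightarrow> nat \<Rightarrow> real" where
  "pstoch A l u i j = A i j * u j / (l * u i)"

text \<open>Brouwer's theorem for the map sending x to \<open>A x\<close> divided by its coordinate
  sum, on the probability simplex. The theorem lives in \<open>real^'n\<close>, so the indices below
  n are transported to a type with n elements.\<close>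

lemma perron_exists:
  assumes card: "CARD('n::finite) = n" and pos: "\<And>i j. i < n \<Longrightarrow> j < n \<Longrightarrow> 0 < A i j"
  shows "\<exists>l u. perron n A l u"
proof -
  have "n > 0" using card by auto
  obtain h :: "nat \<Rightarrow> 'n" where h: "bij_betw h {..<n} UNIV"
    using ex_bij_betw_nat_finite[of "UNIV :: 'n set"] card by (auto simp: atLeast0LessThan)
  define g where "g = the_inv_into {..<n} h"
  have g: "bij_betw g UNIV {..<n}" unfolding g_def by (rule bij_betw_the_inv_into[OF h])
  then have g_less: "g i < n" for i by (auto simp: bij_betw_def)
  have gh: "g (h i) = i" if "i < n" for i
    unfolding g_def using that h by (intro the_inv_into_f_f) (auto simp: bij_betw_def)
  define C :: "(real^'n) set" where "C = {x. (\<forall>i. 0 \<le> vec_nth x i) \<and> (\<Sum>i\<in>UNIV. vec_nth x i) = 1}"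
  define F :: "real^'n \<Rightarrow> 'n \<Rightarrow> real" where "F x i = (\<Sum>j\<in>UNIV. A (g i) (g j) * vec_nth x j)" for x i
  define G where "G x = (\<Sum>i\<in>UNIV. F x i)" for x
  have Fpos: "F x i > 0" if "x \<in> C" for x i
  proof -
    have "\<exists>j. vec_nth x j \<noteq> 0" using that unfolding C_def by (auto intro: ccontr)
    then obtain j where "vec_nth x j \<noteq> 0" by blast
    then have "vec_nth x j > 0" using that unfolding C_def by (simp add: less_le)
    then have "0 < A (g i) (g j) * vec_nth x j" using pos g_less by simp
    also have "\<dots> \<le> F x i"
      unfolding F_def using that pos[OF g_less g_less]
      by (intro member_le_sum) (auto simp: C_def less_imp_le)
    finally show ?thesis .
  qed
  have Gpos: "G x > 0" if "x \<in> C" for x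
    unfolding G_def using Fpos[OF that] by (intro sum_pos) auto
  have contF: "continuous_on C (\<lambda>x. F x i)" for i
    unfolding F_def by (intro continuous_intros continuous_on_component)
  have contG: "continuous_on C G"
    unfolding G_def by (intro continuous_intros contF)
  have "compact C"
  proof -
    have "norm x \<le> 1" if "x \<in> C" for x
      using norm_le_l1_cart[of x] that unfolding C_def by simp
    then have "bounded C" by (auto simp: bounded_iff)
    moreover have "closed C"
      unfolding C_def by (intro closed_Collect_conj closed_Collect_all closed_Collect_le
          closed_Collect_eq continuous_intros)
    ultimately show ?thesis by (simp add: compact_eq_bounded_closed)
  qed
  moreover have "convex C"
    unfolding C_def convex_def
    by (auto simp: sum.distrib simp flip: sum_distrib_left)
  moreover have "C \<noteq> {}"
  proof -
    have "vec_lambda (\<lambda>i. 1 / real n) \<in> C" using card \<open>n > 0\<close> by (simp add: C_def)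
    then show ?thesis by blast
  qed
  moreover have "continuous_on C (\<lambda>x. vec_lambda (\<lambda>i. F x i / G x))"
    using Gpos by (intro continuous_intros contF contG) (auto simp: less_imp_neq[symmetric])
  moreover have "(\<lambda>x. vec_lambda (\<lambda>i. F x i / G x)) \<in> C \<rightarrow> C"
  proof
    fix x assume x: "x \<in> C"
    have "(\<Sum>i\<in>UNIV. F x i / G x) = 1"
      using Gpos[OF x] unfolding sum_divide_distrib[symmetric] G_def[symmetric] by simp
    then show "vec_lambda (\<lambda>i. F x i / G x) \<in> C"
      using Gpos[OF x] Fpos[OF x] by (simp add: C_def less_imp_le)
  qed
  ultimately obtain x where x: "x \<in> C" "vec_lambda (\<lambda>i. F x i / G x) = x"
    by (rule brouwer)
  have fx: "F x i = G x * vec_nth x i" for i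
    using arg_cong[OF x(2), of "\<lambda>y. vec_nth y i"] Gpos[OF x(1)] by (simp add: field_simps)
  then have xpos: "vec_nth x i > 0" for i
    using Fpos[OF x(1), of i] Gpos[OF x(1)] by (simp add: zero_less_mult_iff)
  \<comment> \<open>The fixed point has eigenvalue \<open>G x\<close>; dividing by the entry with
    index 0 gives the normalization.\<close>
  define u where "u i = vec_nth x (h i) / vec_nth x (h 0)" for i
  have "(\<Sum>j<n. A i j * u j) = G x * u i" if "i < n" for i
  proof -
    have "(\<Sum>j<n. A i j * vec_nth x (h j)) = (\<Sum>j<n. A (g (h i)) (g (h j)) * vec_nth x (h j))"
      using gh that by (intro sum.cong) auto
    also have "\<dots> = (\<Sum>j\<in>UNIV. A (g (h i)) (g j) * vec_nth x j)"
      by (rule sum.reindex_bij_betw[OF h])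
    also have "\<dots> = G x * vec_nth x (h i)" using fx unfolding F_def .
    finally show ?thesis unfolding u_def by (simp add: sum_divide_distrib[symmetric])
  qed
  moreover have "u i > 0" for i unfolding u_def using xpos by simp
  moreover have "u 0 = 1" unfolding u_def using xpos[of "h 0"] by simp
  ultimately show ?thesis unfolding perron_def using pos \<open>n > 0\<close> by blast
qed

context
  fixes n A l u
  assumes P: "perron n A l u"
begin

lemma perron_dim: "0 < n" and perron_entry: "i < n \<Longrightarrow> j < n \<Longrightarrow> 0 < A i j"
  and perron_vec: "i < n \<Longrightarrow> 0 < u i" and perron_vec0: "u 0 = 1"
  and perron_eq: "i < n \<Longrightarrow> (\<Sum>j<n. A i j * u j) = l * u i"
  using P unfolding perron_def by auto

lemma perron_value_pos: "0 < l"
proof -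
  have "0 < (\<Sum>j<n. A 0 j * u j)"
    using perron_dim perron_entry perron_vec by (intro sum_pos) auto
  then show ?thesis using perron_eq[of 0] perron_vec0 perron_dim by simp
qed

text \<open>The Collatz-Wielandt argument: at an index where \<open>v i / u i\<close> attains its
  maximum m, v equals \<open>m * u\<close>, while \<open>v \<le> m * u\<close> elsewhere, so the row
  of A at this index gives the bound. The factor e serves the comparison of two matrices.\<close>

lemma perron_subinvariant:
  assumes nn: "\<And>i. i < n \<Longrightarrow> 0 \<le> v i" and "k < n" "v k \<noteq> 0" and "e \<ge> 0"
    and le: "\<And>i. i < n \<Longrightarrow> x * v i \<le> e * (\<Sum>j<n. A i j * v j)"
  shows "x \<le> e * l"
proof -
  define m where "m = Max ((\<lambda>i. v i / u i) ` {..<n})"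
  have "m \<in> (\<lambda>i. v i / u i) ` {..<n}"
    unfolding m_def using perron_dim by (intro Max_in) auto
  then obtain i where i: "i < n" "m = v i / u i" by auto
  have m: "v j \<le> m * u j" if "j < n" for j
  proof -
    have "v j / u j \<le> m" unfolding m_def using that by (intro Max_ge) auto
    then show ?thesis using perron_vec[OF that] by (simp add: field_simps)
  qed
  have vi: "v i = m * u i" using i perron_vec[OF i(1)] by simp
  have "0 < m"
    using m[OF \<open>k < n\<close>] nn[OF \<open>k < n\<close>] \<open>v k \<noteq> 0\<close> perron_vec[OF \<open>k < n\<close>]
    by (smt (verit) mult_nonpos_nonneg)
  have "x * v i \<le> e * (\<Sum>j<n. A i j * v j)" by (rule le[OF i(1)])
  also have "\<dots> \<le> e * (\<Sum>j<n. A i j * (m * u j))"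
    using perron_entry[OF i(1)] m \<open>e \<ge> 0\<close>
    by (intro mult_left_mono sum_mono) (auto simp: less_imp_le)
  also have "(\<Sum>j<n. A i j * (m * u j)) = m * (l * u i)"
    using perron_eq[OF i(1), symmetric] by (simp add: sum_distrib_left mult.left_commute)
  finally have "x * (m * u i) \<le> (e * l) * (m * u i)" using vi by (simp add: mult_ac)
  then show ?thesis using \<open>0 < m\<close> perron_vec[OF i(1)] by (simp add: mult_le_cancel_right)
qed

text \<open>By the triangle inequality the absolute values of an eigenvector form a subinvariant
  vector.\<close>

lemma perron_eigenvalue_le:
  assumes "\<And>i. i < n \<Longrightarrow> (\<Sum>j<n. A i j * v j) = x * v i" "k < n" "v k \<noteq> 0"
  shows "\<bar>x\<bar> \<le> l"
proof -
  have "\<bar>x\<bar> * \<bar>v i\<bar> \<le> 1 * (\<Sum>j<n. A i j * \<bar>v j\<bar>)" if "i < n" for i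
  proof -
    have "\<bar>x\<bar> * \<bar>v i\<bar> = \<bar>\<Sum>j<n. A i j * v j\<bar>" using assms(1)[OF that] by (simp add: abs_mult)
    also have "\<dots> \<le> (\<Sum>j<n. A i j * \<bar>v j\<bar>)"
      using perron_entry[OF that]
      by (intro order.trans[OF sum_abs] sum_mono) (auto simp: abs_mult abs_of_pos)
    finally show ?thesis by simp
  qed
  then show ?thesis using perron_subinvariant[of "\<lambda>i. \<bar>v i\<bar>" k 1] assms(2,3) by simp
qed

lemma pstoch_row: "i < n \<Longrightarrow> (\<Sum>j<n. pstoch A l u i j) = 1"
  using perron_eq[of i] perron_value_pos perron_vec[of i]
  by (simp add: pstoch_def flip: sum_divide_distrib)

lemma pstoch_pos: "i < n \<Longrightarrow> j < n \<Longrightarrow> 0 < pstoch A l u i j"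
  using perron_entry perron_vec perron_value_pos by (simp add: pstoch_def)

lemma pstoch_power:
  assumes "i < n" "j < n"
  shows "mpow n (pstoch A l u) k i j = mpow n A k i j * u j / (l ^ k * u i)"
  using assms
proof (induction k arbitrary: i)
  case 0
  then show ?case using perron_vec[of i] by auto
next
  case (Suc k)
  have "mpow n (pstoch A l u) (Suc k) i j
      = (\<Sum>m<n. pstoch A l u i m * (mpow n A k m j * u j / (l ^ k * u m)))"
    using Suc.IH[OF _ Suc.prems(2)] by simp
  also have "\<dots> = (\<Sum>m<n. A i m * mpow n A k m j * (u j / (l ^ Suc k * u i)))"
    using perron_vec by (intro sum.cong) (auto simp: pstoch_def less_imp_neq[symmetric] field_simps)
  also have "\<dots> = mpow n A (Suc k) i j * u j / (l ^ Suc k * u i)"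
    by (simp add: sum_distrib_right sum_divide_distrib)
  finally show ?case .
qed

lemma pstoch_trace: "(\<Sum>j<n. mpow n (pstoch A l u) k j j) = (\<Sum>j<n. mpow n A k j j) / l ^ k"
  unfolding sum_divide_distrib
  by (intro sum.cong refl) (use perron_vec in \<open>auto simp: pstoch_power less_imp_neq[symmetric]\<close>)

text \<open>For \<open>f = v / u\<close> and the stochastic conjugate S the hypothesis reads
  \<open>S f = f - c / l\<close>. The oscillation does not see the constant, so contraction forces f
  to be constant. With \<open>c = 0\<close> this says that the eigenspace is a line; admitting other
  c excludes a Jordan block at l.\<close>

lemma perron_kernel:
  assumes eq: "\<And>i. i < n \<Longrightarrow> (\<Sum>j<n. A i j * v j) = l * v i - c * u i"
  shows "c = 0" "i < n \<Longrightarrow> v i = v 0 * u i"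
proof -
  note l = perron_value_pos
  define f where "f i = v i / u i" for i
  have Sf: "(\<Sum>j<n. pstoch A l u i j * f j) = f i - c / l" if "i < n" for i
  proof -
    have "(\<Sum>j<n. pstoch A l u i j * f j) = (\<Sum>j<n. A i j * v j / (l * u i))"
      using perron_vec by (intro sum.cong) (auto simp: pstoch_def f_def less_imp_neq[symmetric])
    also have "\<dots> = (l * v i - c * u i) / (l * u i)"
      using eq[OF that] by (simp flip: sum_divide_distrib)
    also have "\<dots> = f i - c / l"
      using l perron_vec[OF that] by (simp add: f_def field_simps)
    finally show ?thesis .
  qed
  define \<delta> where "\<delta> = Min ((\<lambda>(i,j). pstoch A l u i j) ` ({..<n} \<times> {..<n}))"
  have "\<delta> \<in> (\<lambda>(i,j). pstoch A l u i j) ` ({..<n} \<times> {..<n})"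
    unfolding \<delta>_def using perron_dim by (intro Min_in) auto
  then have "\<delta> > 0" using pstoch_pos by auto
  have \<delta>: "pstoch A l u i j \<ge> \<delta>" if "i < n" "j < n" for i j
    unfolding \<delta>_def using that by (intro Min_le) auto
  define e where "e = Max (f ` {..<n}) - Min (f ` {..<n})"
  have ne: "f ` {..<n} \<noteq> {}" using perron_dim by auto
  have "Max (f ` {..<n}) \<in> f ` {..<n}" "Min (f ` {..<n}) \<in> f ` {..<n}"
    using ne by (intro Max_in Min_in; simp)+
  then obtain p q where pq: "p < n" "q < n" "e = f p - f q" unfolding e_def by auto
  have "f i - f j \<le> e" if "i < n" "j < n" for i j
    unfolding e_def using that by (intro diff_mono Max_ge Min_le) auto
  then have osc: "osc_le n f e" by (simp add: osc_le_def)
  have "osc_le n (\<lambda>i. \<Sum>j<n. pstoch A l u i j * f j) ((1 - \<delta>) * e)"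
    using osc_le_stochastic[OF osc perron_dim pstoch_row \<delta>] \<open>\<delta> > 0\<close> by simp
  \<comment> \<open>In the difference of the entries p and q the constant \<open>c / l\<close>
    cancels.\<close>
  then have "f p - f q \<le> (1 - \<delta>) * e"
    using pq(1,2) Sf unfolding osc_le_def by fastforce
  then have "e \<le> 0" using pq(3) \<open>\<delta> > 0\<close> by (simp add: algebra_simps mult_le_0_iff)
  moreover have "0 \<le> e" using osc_leD[OF osc, of 0 0] perron_dim by simp
  ultimately have "e = 0" by simp
  then have const: "f i = f 0" if "i < n" for i
    using osc_leD[OF osc that perron_dim] by simp
  have "(\<Sum>j<n. pstoch A l u 0 j * f j) = f 0"
  proof -
    have "(\<Sum>j<n. pstoch A l u 0 j * f j) = (\<Sum>j<n. pstoch A l u 0 j * f 0)"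
      by (intro sum.cong refl) (metis const lessThan_iff)
    then show ?thesis using pstoch_row[OF perron_dim] by (simp flip: sum_distrib_right)
  qed
  then show "c = 0" using Sf[OF perron_dim] l by simp
  show "v i = v 0 * u i" if "i < n"
    using const[OF that] perron_vec[OF that] perron_vec0 by (simp add: f_def field_simps)
qed

end

section \<open>Comparison, uniqueness and continuity of Perron values\<close>

lemma perron_le:
  assumes P: "perron n A l u" and P': "perron n A' l' u'" and "e \<ge> 0"
    and le: "\<And>i j. i < n \<Longrightarrow> j < n \<Longrightarrow> A' i j \<le> e * A i j"
  shows "l' \<le> e * l"
proof (rule perron_subinvariant[OF P, of u' 0])
  note n = perron_dim[OF P]
  show "u' 0 \<noteq> 0" using perron_vec0[OF P'] by simp
  \<comment> \<open>The eigenvector of the smaller matrix is subinvariant for the larger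
    one.\<close>
  show "l' * u' i \<le> e * (\<Sum>j<n. A i j * u' j)" if "i < n" for i
    unfolding perron_eq[OF P' that, symmetric] sum_distrib_left
    using le[OF that] perron_vec[OF P']
    by (intro sum_mono) (auto simp flip: mult.assoc intro!: mult_right_mono less_imp_le)
qed (use perron_dim[OF P] perron_vec[OF P'] \<open>e \<ge> 0\<close> in \<open>auto simp: less_imp_le\<close>)

lemma perron_unique:
  assumes P: "perron n A l u" and P': "perron n A l' u'"
  shows "l' = l" "i < n \<Longrightarrow> u' i = u i"
proof -
  show l: "l' = l" using perron_le[OF P P', of 1] perron_le[OF P' P, of 1] by simp
  show "u' i = u i" if "i < n"
    using perron_kernel(2)[OF P, of u' 0 i] perron_eq[OF P'] l perron_vec0[OF P'] that by simp
qed

text \<open>Entries that agree up to the factor \<open>1 + e\<close>, in both directions, have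
  Perron values that agree up to the same factor; no information on the eigenvectors is
  needed.\<close>

lemma perron_value_tendsto:
  assumes P: "perron n A l u" and P': "\<And>x. perron n (A' x) (l' x) (u' x)"
    and lim: "\<And>i j. i < n \<Longrightarrow> j < n \<Longrightarrow> ((\<lambda>x. A' x i j) \<longlongrightarrow> A i j) F"
  shows "(l' \<longlongrightarrow> l) F"
proof (rule tendstoI)
  fix \<epsilon> :: real assume "\<epsilon> > 0"
  note l = perron_value_pos[OF P]
  \<comment> \<open>With \<open>e \<le> 1\<close> the comparison gives
    \<open>l' x \<le> 2 * l\<close>, so both differences are at most \<open>2 * e * l\<close>,
    strictly below \<open>3 * e * l \<le> \<epsilon>\<close>.\<close>
  define e where "e = min 1 (\<epsilon> / (3 * l))"
  have e: "0 < e" "e \<le> 1" "3 * l * e \<le> \<epsilon>"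
    unfolding e_def using \<open>\<epsilon> > 0\<close> l by (auto simp: min_def field_simps)
  have "\<forall>\<^sub>F x in F. \<forall>i\<in>{..<n}. \<forall>j\<in>{..<n}. A' x i j < (1 + e) * A i j \<and> A i j < (1 + e) * A' x i j"
  proof (intro eventually_ball_finite ballI eventually_conj)
    fix i j assume ij: "i \<in> {..<n}" "j \<in> {..<n}"
    then have A: "0 < A i j" and lim': "((\<lambda>x. A' x i j) \<longlongrightarrow> A i j) F"
      using perron_entry[OF P] lim by auto
    show "\<forall>\<^sub>F x in F. A' x i j < (1 + e) * A i j"
      by (rule order_tendstoD(2)[OF lim']) (use A e in simp)
    show "\<forall>\<^sub>F x in F. A i j < (1 + e) * A' x i j"
      by (rule order_tendstoD(1)[OF tendsto_mult_left[OF lim']]) (use A e in simp)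
  qed auto
  then show "\<forall>\<^sub>F x in F. dist (l' x) l < \<epsilon>"
  proof eventually_elim
    case (elim x)
    have 1: "l' x \<le> (1 + e) * l"
      using elim e by (intro perron_le[OF P P']) (auto intro: less_imp_le)
    have 2: "l \<le> (1 + e) * l' x"
      using elim e by (intro perron_le[OF P' P]) (auto intro: less_imp_le)
    have "e * l' x \<le> e * (2 * l)"
    proof (rule mult_left_mono)
      have "(1 + e) * l \<le> 2 * l" using e l by (intro mult_right_mono) auto
      then show "l' x \<le> 2 * l" using 1 by linarith
    qed (use e in simp)
    moreover have "0 < l * e" using e l by simp
    ultimately have "\<bar>l' x - l\<bar> < 3 * l * e"
      using 1 2 by (simp add: algebra_simps abs_less_iff)
    then show ?case using e(3) by (simp add: dist_real_def)
  qed
qed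

section \<open>The secular equation\<close>

abbreviation nmat :: "nat \<Rightarrow> (nat \<Rightarrow> nat \<Rightarrow> 'a) \<Rightarrow> 'a mat" where
  "nmat n A \<equiv> Matrix.mat n n (\<lambda>(i, j). A i j)"

lemma nmat_mult_vec: "i < n \<Longrightarrow> vec_index (nmat n A *\<^sub>v Matrix.vec n v) i = (\<Sum>j<n. A i j * v j)"
  by (auto simp: mult_mat_vec_def scalar_prod_def atLeast0LessThan intro!: sum.cong)

lemma eigenvalue_nmat_iff:
  "eigenvalue (nmat n A) x \<longleftrightarrow>
     (\<exists>v. (\<exists>i<n. v i \<noteq> 0) \<and> (\<forall>i<n. (\<Sum>j<n. A i j * v j) = x * v i))" (is "?l \<longleftrightarrow> ?r")
proof
  assume ?l
  then obtain w where w: "w \<in> carrier_vec n" "w \<noteq> 0\<^sub>v n" "nmat n A *\<^sub>v w = x \<cdot>\<^sub>v w"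
    unfolding eigenvalue_def eigenvector_def by auto
  have wv: "w = Matrix.vec n (\<lambda>i. vec_index w i)" using w(1) by auto
  have "(\<Sum>j<n. A i j * vec_index w j) = x * vec_index w i" if "i < n" for i
    using nmat_mult_vec[OF that, of A "\<lambda>i. vec_index w i"] wv w(1,3) that by simp
  moreover have "\<exists>i<n. vec_index w i \<noteq> 0"
    using w(1,2) by (metis carrier_vecD eq_vecI index_zero_vec)
  ultimately show ?r by blast
next
  assume ?r
  then obtain v where v: "\<exists>i<n. v i \<noteq> 0" "\<And>i. i < n \<Longrightarrow> (\<Sum>j<n. A i j * v j) = x * v i" by blast
  have "nmat n A *\<^sub>v Matrix.vec n v = x \<cdot>\<^sub>v Matrix.vec n v"
    by (rule eq_vecI) (use v(2) nmat_mult_vec[of _ n A v] in auto)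
  moreover have "Matrix.vec n v \<noteq> 0\<^sub>v n"
  proof
    assume "Matrix.vec n v = 0\<^sub>v n"
    then have "\<forall>i<n. v i = 0" by (metis index_vec index_zero_vec(1))
    then show False using v(1) by blast
  qed
  ultimately have "eigenvector (nmat n A) (Matrix.vec n v) x"
    unfolding eigenvector_def by simp
  then show ?l unfolding eigenvalue_def by blast
qed

lemma perron_eigenvalue:
  assumes P: "perron n A l u"
  shows "eigenvalue (nmat n A) l"
  unfolding eigenvalue_nmat_iff
  using perron_dim[OF P] perron_vec0[OF P] perron_eq[OF P] by (intro exI[of _ u]) auto

lemma perron_principal_eigenvalue:
  assumes P: "perron n A l u"
  shows "principal_eigenvalue (nmat n A) = l"
proof -
  let ?E = "{x. eigenvalue (nmat n A) x}"
  have "?E = {x. poly (char_poly (nmat n A)) x = 0}"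
    using eigenvalue_root_char_poly[of "nmat n A" n] by auto
  moreover have "char_poly (nmat n A) \<noteq> 0"
    using degree_monic_char_poly[of "nmat n A" n] by auto
  ultimately have "finite ?E" using poly_roots_finite by simp
  moreover have "x \<le> l" if x: "x \<in> ?E" for x
  proof -
    obtain v where "\<exists>k<n. v k \<noteq> 0" and eq: "\<And>i. i < n \<Longrightarrow> (\<Sum>j<n. A i j * v j) = x * v i"
      using x unfolding mem_Collect_eq eigenvalue_nmat_iff by blast
    then obtain k where "k < n" "v k \<noteq> 0" by blast
    then show ?thesis using perron_eigenvalue_le[OF P, of v x k] eq by simp
  qed
  moreover have "l \<in> ?E" using perron_eigenvalue[OF P] by simp
  ultimately show ?thesis unfolding principal_eigenvalue_def by (intro Max_eqI) auto
qed

definition wminus :: "(nat \<Rightarrow> nat \<Rightarrow> real) \<Rightarrow> real \<Rightarrow> nat \<Rightarrow> nat \<Rightarrow> real" where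
  "wminus A w i j = (if i = j then w else 0) - A i j"

lemma wminus_mult: "i < n \<Longrightarrow> (\<Sum>j<n. wminus A w i j * v j) = w * v i - (\<Sum>j<n. A i j * v j)"
proof -
  assume "i < n"
  have "wminus A w i j * v j = (if i = j then w * v j else 0) - A i j * v j" for j
    by (simp add: wminus_def left_diff_distrib)
  then show ?thesis using \<open>i < n\<close> by (simp add: sum_subtractf)
qed

text \<open>At the Perron pair the determinant of the bordered matrix is the derivative of the
  characteristic polynomial, so its invertibility says that the Perron root is simple.\<close>

definition bordered :: "(nat \<Rightarrow> nat \<Rightarrow> real) \<Rightarrow> real \<Rightarrow> (nat \<Rightarrow> real) \<Rightarrow> nat \<Rightarrow> nat \<Rightarrow> real" where
  "bordered A w b i j = (if j = 0 then b i else wminus A w i j)"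

lemma poly_char_poly_nmat: "poly (char_poly (nmat n A)) w = det (nmat n (wminus A w))"
  unfolding char_poly_def
  by (rule poly_det_cong[of _ n]) (auto simp: char_poly_matrix_def wminus_def)

lemma det_first_column_scale:
  assumes "0 < n"
  shows "det (nmat n (bordered A w (\<lambda>i. c * b i))) = c * det (nmat n (bordered A w b))"
proof -
  have cof: "cofactor (nmat n (bordered A w (\<lambda>i. c * b i))) i 0 = cofactor (nmat n (bordered A w b)) i 0" for i
    unfolding cofactor_def
    by (intro arg_cong[where f = "\<lambda>x. (- 1) ^ (i + 0) * det x"] eq_matI)
       (auto simp: mat_delete_def bordered_def)
  have "det (nmat n (bordered A w b)) = (\<Sum>i<n. b i * cofactor (nmat n (bordered A w b)) i 0)" for b
    using assms laplace_expansion_column[of "nmat n (bordered A w b)" n 0]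
    by (auto simp: bordered_def[of A w b _ 0] intro!: sum.cong)
  then show ?thesis by (simp add: cof sum_distrib_left mult.assoc)
qed

text \<open>The matrix \<open>w I - A\<close> maps u to \<open>(w - l) u\<close>. As
  \<open>u 0 = 1\<close>, replacing column 0 by this image leaves the determinant unchanged, and the
  factor \<open>w - l\<close> can be taken out of that column.\<close>

lemma perron_char_poly:
  assumes P: "perron n A l u"
  shows "poly (char_poly (nmat n A)) w = (w - l) * det (nmat n (bordered A w u))"
proof -
  note n = perron_dim[OF P]
  let ?D = "nmat n (wminus A w)"
  have D: "vec_index (?D *\<^sub>v Matrix.vec n u) i = (w - l) * u i" if "i < n" for i
    using perron_eq[OF P that]
    by (simp only: nmat_mult_vec[OF that] wminus_mult[OF that] left_diff_distrib)
  have "det ?D = det (replace_col ?D (?D *\<^sub>v Matrix.vec n u) 0)"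
    using cramer_lemma_mat[of ?D n "Matrix.vec n u" 0] n perron_vec0[OF P] by simp
  also have "replace_col ?D (?D *\<^sub>v Matrix.vec n u) 0 = nmat n (bordered A w (\<lambda>i. (w - l) * u i))"
    by (rule eq_matI) (use D in \<open>auto simp: replace_col_def bordered_def\<close>)
  also have "det \<dots> = (w - l) * det (nmat n (bordered A w u))"
    by (rule det_first_column_scale[OF n])
  finally show ?thesis unfolding poly_char_poly_nmat .
qed

text \<open>A null vector of the bordered matrix is a solution of \<open>(l I - A) x = c u\<close>
  with \<open>x 0 = 0\<close>; \<open>perron_kernel\<close> leaves only the trivial one.\<close>

lemma det_bordered_nonzero:
  assumes P: "perron n A l u"
  shows "det (nmat n (bordered A l u)) \<noteq> 0"
proof
  assume "det (nmat n (bordered A l u)) = 0"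
  then have "\<exists>w. w \<in> carrier_vec n \<and> w \<noteq> 0\<^sub>v n \<and> nmat n (bordered A l u) *\<^sub>v w = 0\<^sub>v n"
    using det_0_iff_vec_prod_zero[of "nmat n (bordered A l u)" n] by simp
  then obtain w where w: "w \<in> carrier_vec n" "w \<noteq> 0\<^sub>v n" "nmat n (bordered A l u) *\<^sub>v w = 0\<^sub>v n" by blast
  \<comment> \<open>Entry 0 of w multiplies the border, not a column of \<open>l I - A\<close>; it
    becomes the coefficient of u on the right-hand side.\<close>
  define x where "x i = (if i = 0 then 0 else vec_index w i)" for i
  have wv: "w = Matrix.vec n (\<lambda>i. vec_index w i)" using w(1) by auto
  have n: "0 < n" by (rule perron_dim[OF P])
  have eq: "(\<Sum>j<n. A i j * x j) = l * x i - (- (vec_index w 0)) * u i" if "i < n" for i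
  proof -
    have "0 = (\<Sum>j<n. bordered A l u i j * vec_index w j)"
      using nmat_mult_vec[OF that, of "bordered A l u" "\<lambda>i. vec_index w i"] wv w(1,3) that by simp
    also have "\<dots> = (\<Sum>j<n. (if j = 0 then u i * vec_index w 0 else 0) + wminus A l i j * x j)"
      by (intro sum.cong) (auto simp: bordered_def x_def)
    also have "\<dots> = u i * vec_index w 0 + (l * x i - (\<Sum>j<n. A i j * x j))"
      using n wminus_mult[OF that] by (simp add: sum.distrib)
    finally show ?thesis by (simp add: algebra_simps)
  qed
  have ker: "- vec_index w 0 = 0" "i < n \<Longrightarrow> x i = x 0 * u i" for i
    using perron_kernel[OF P, of x "- vec_index w 0"] eq by blast+
  have "vec_index w i = 0" if "i < n" for i
    using ker(1) ker(2)[of i] that by (cases "i = 0") (auto simp: x_def)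
  then have "w = 0\<^sub>v n" using w(1) by (intro eq_vecI) auto
  then show False using w(2) by simp
qed

section \<open>Simplicity and differentiation of the Perron root\<close>

lemma det_nmat: "det (nmat n A) = (\<Sum>p | p permutes {0..<n}. signof p * (\<Prod>i = 0..<n. A i (p i)))"
  by (subst det_def'[of _ n])
     (auto intro!: sum.cong prod.cong simp: permutes_in_image dest: permutes_in_image)

text \<open>Caratheodory's criterion: the characteristic polynomial is \<open>w - l\<close> times a
  function continuous at l, whose value there is the derivative.\<close>

lemma perron_pderiv_char_poly:
  assumes P: "perron n A l u"
  shows "poly (pderiv (char_poly (nmat n A))) l = det (nmat n (bordered A l u))"
proof -
  have "isCont (\<lambda>w. bordered A w u i j) l" for i j
    by (cases "j = 0"; cases "i = j") (auto simp: bordered_def wminus_def)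
  then have "isCont (\<lambda>w. det (nmat n (bordered A w u))) l"
    unfolding det_nmat by (intro continuous_intros)
  then have "(poly (char_poly (nmat n A)) has_real_derivative det (nmat n (bordered A l u))) (at l)"
    unfolding CARAT_DERIV
    by (intro exI[of _ "\<lambda>w. det (nmat n (bordered A w u))"]) (simp add: perron_char_poly[OF P])
  then show ?thesis using poly_DERIV DERIV_unique by blast
qed

lemma char_poly_nmat_altdef:
  "poly (char_poly (nmat n A)) x = (\<Sum>k\<le>n. coeff (char_poly (nmat n A)) k * x ^ k)"
  using degree_monic_char_poly[of "nmat n A" n] by (simp add: poly_altdef)

lemma pderiv_char_poly_nmat_altdef:
  fixes A :: "nat \<Rightarrow> nat \<Rightarrow> real"
  shows "poly (pderiv (char_poly (nmat n A))) x = (\<Sum>k\<le>n. coeff (char_poly (nmat n A)) k * (real k * x ^ (k - 1)))"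
proof -
  have "((\<lambda>x. \<Sum>k\<le>n. coeff (char_poly (nmat n A)) k * x ^ k) has_real_derivative
          (\<Sum>k\<le>n. coeff (char_poly (nmat n A)) k * (real k * x ^ (k - 1)))) (at x)"
    by (auto intro!: derivative_eq_intros sum.cong)
  then have "(poly (char_poly (nmat n A)) has_real_derivative
          (\<Sum>k\<le>n. coeff (char_poly (nmat n A)) k * (real k * x ^ (k - 1)))) (at x)"
    unfolding char_poly_nmat_altdef[abs_def] .
  then show ?thesis using poly_DERIV DERIV_unique by blast
qed

lemma perron_simple:
  "perron n A l u \<Longrightarrow> (\<Sum>k\<le>n. coeff (char_poly (nmat n A)) k * (real k * l ^ (k - 1))) \<noteq> 0"
  using det_bordered_nonzero perron_pderiv_char_poly pderiv_char_poly_nmat_altdef by metis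

lemma perron_root:
  "perron n A l u \<Longrightarrow> (\<Sum>k\<le>n. coeff (char_poly (nmat n A)) k * l ^ k) = 0"
  by (metis char_poly_nmat_altdef diff_self mult_zero_left perron_char_poly)

text \<open>In place of the implicit function theorem: with the root frozen at \<open>l x0\<close>,
  the polynomial value \<open>F x\<close> equals \<open>- G x * (l x - l x0)\<close>, where G is a
  difference quotient in the root. Continuity of l makes G continuous, and its value at x0 is the
  nonzero derivative of the polynomial, so dividing by \<open>x - x0\<close> gives the
  claim.\<close>

lemma DERIV_root_of_family:
  fixes a :: "real \<Rightarrow> nat \<Rightarrow> real"
  assumes a: "\<And>k. k \<le> n \<Longrightarrow> ((\<lambda>x. a x k) has_real_derivative a' k) (at x0)"
    and l: "isCont l x0" and root: "\<And>x. (\<Sum>k\<le>n. a x k * l x ^ k) = 0"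
    and simple: "(\<Sum>k\<le>n. a x0 k * (real k * l x0 ^ (k - 1))) \<noteq> 0"
  shows "(l has_real_derivative
     - (\<Sum>k\<le>n. a' k * l x0 ^ k) / (\<Sum>k\<le>n. a x0 k * (real k * l x0 ^ (k - 1)))) (at x0)"
proof -
  define F where "F x = (\<Sum>k\<le>n. a x k * l x0 ^ k)" for x
  define G where "G x = (\<Sum>k\<le>n. a x k * (\<Sum>i<k. l x0 ^ (k - Suc i) * l x ^ i))" for x
  have FG: "F x = - G x * (l x - l x0)" for x
  proof -
    have "0 = (\<Sum>k\<le>n. a x k * l x ^ k) - F x + F x" using root by simp
    also have "(\<Sum>k\<le>n. a x k * l x ^ k) - F x = (\<Sum>k\<le>n. a x k * (l x ^ k - l x0 ^ k))"
      unfolding F_def by (simp add: sum_subtractf right_diff_distrib)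
    also have "\<dots> = G x * (l x - l x0)"
      unfolding G_def power_diff_sumr2 sum_distrib_right[of _ _ "l x - l x0"] by (intro sum.cong) (auto simp: mult_ac)
    finally show ?thesis by simp
  qed
  have contG: "isCont G x0"
    unfolding G_def using l by (intro continuous_intros DERIV_isCont[OF a]) auto
  have G0: "G x0 = (\<Sum>k\<le>n. a x0 k * (real k * l x0 ^ (k - 1)))"
    unfolding G_def
  proof (intro sum.cong refl arg_cong2[where f = "(*)"])
    fix k
    have "l x0 ^ (k - Suc i) * l x0 ^ i = l x0 ^ (k - 1)" if "i < k" for i
      using that by (simp flip: power_add)
    then show "(\<Sum>i<k. l x0 ^ (k - Suc i) * l x0 ^ i) = real k * l x0 ^ (k - 1)" by simp
  qed
  have "(F has_real_derivative (\<Sum>k\<le>n. a' k * l x0 ^ k)) (at x0)"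
    unfolding F_def using a by (auto intro!: derivative_eq_intros)
  then have "((\<lambda>x. F x / (x - x0)) \<longlongrightarrow> (\<Sum>k\<le>n. a' k * l x0 ^ k)) (at x0)"
    using FG[of x0] by (simp add: has_field_derivative_iff)
  moreover have limG: "(G \<longlongrightarrow> G x0) (at x0)" using contG by (simp add: isCont_def)
  ultimately have "((\<lambda>x. - (F x / (x - x0)) / G x) \<longlongrightarrow> - (\<Sum>k\<le>n. a' k * l x0 ^ k) / G x0) (at x0)"
    using simple G0 by (intro tendsto_intros) auto
  moreover have "\<forall>\<^sub>F x in at x0. - (F x / (x - x0)) / G x = (l x - l x0) / (x - x0)"
    using tendsto_imp_eventually_ne[OF limG, of 0] simple G0
    by (auto elim!: eventually_mono simp: FG)
  ultimately have "((\<lambda>x. (l x - l x0) / (x - x0)) \<longlongrightarrow> - (\<Sum>k\<le>n. a' k * l x0 ^ k) / G x0) (at x0)"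
    using tendsto_cong by fast
  then show ?thesis unfolding has_field_derivative_iff G0 .
qed

section \<open>Jets of determinants and secular coefficients\<close>

lemma jet2_det:
  assumes "\<And>i j. i < n \<Longrightarrow> j < n \<Longrightarrow> jet2 (\<lambda>s t. B s t i j)"
  shows "jet2 (\<lambda>s t. det (nmat n (B s t)))"
  unfolding det_nmat
  by (intro jet2_sum jet2_mult jet2_prod jet2_const assms) (auto dest: permutes_in_image)

lemma jet2_coeff_prod:
  assumes "\<And>i k. i \<in> I \<Longrightarrow> jet2 (\<lambda>s t. coeff (p s t i) k)"
  shows "jet2 (\<lambda>s t. coeff (\<Prod>i\<in>I. p s t i) k)"
  using assms
proof (induction I arbitrary: k rule: infinite_finite_induct)
  case (insert i I)
  have "jet2 (\<lambda>s t. \<Sum>m\<le>k. coeff (p s t i) m * coeff (\<Prod>i\<in>I. p s t i) (k - m))"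
    using insert by (intro jet2_sum jet2_mult) auto
  then show ?case using insert.hyps by (simp add: coeff_mult)
qed auto

text \<open>By the Leibniz expansion each coefficient is a polynomial in the entries of the
  matrix.\<close>

lemma jet2_coeff_char_poly:
  assumes "\<And>i j. i < n \<Longrightarrow> j < n \<Longrightarrow> jet2 (\<lambda>s t. A s t i j)"
  shows "jet2 (\<lambda>s t. coeff (char_poly (nmat n (A s t))) k)"
proof -
  have eq: "coeff (char_poly (nmat n (A s t))) k = (\<Sum>p | p permutes {0..<n}.
      signof p * coeff (\<Prod>i = 0..<n. if i = p i then [:- A s t i (p i), 1:] else [:- A s t i (p i):]) k)" for s t
  proof -
    have "char_poly_matrix (nmat n (A s t)) =
        nmat n (\<lambda>i j. if i = j then [:- A s t i j, 1:] else [:- A s t i j:])"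
      by (rule eq_matI) (auto simp: char_poly_matrix_def)
    then have "char_poly (nmat n (A s t)) = (\<Sum>p | p permutes {0..<n}.
      of_int (sign p) * (\<Prod>i = 0..<n. if i = p i then [:- A s t i (p i), 1:] else [:- A s t i (p i):]))"
      unfolding char_poly_def by (simp only: det_nmat)
    then show ?thesis
      by (auto simp: coeff_sum sign_def intro!: sum.cong)
  qed
  show ?thesis unfolding eq
  proof (intro jet2_sum jet2_mult jet2_const jet2_coeff_prod)
    fix p i k assume "p \<in> {p. p permutes {0..<n}}" "i \<in> {0..<n}"
    then have "i < n" "p i < n" by (auto dest: permutes_in_image)
    then have "jet2 (\<lambda>s t. - A s t i (p i))" by (intro jet2_minus assms)
    then show "jet2 (\<lambda>s t. coeff (if i = p i then [:- A s t i (p i), 1:] else [:- A s t i (p i):]) k)"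
      by (cases k; cases "i = p i") (simp_all add: coeff_pCons jet2_const)
  qed
qed

section \<open>Smoothness of the Perron pair\<close>

lemma jet2_imp_differentiable:
  assumes "jet2 f"
  shows "(\<lambda>s. f s 0) field_differentiable at 0"
    "\<forall>\<^sub>F s in nhds 0. (f s has_real_derivative deriv (f s) 0) (at 0)"
    "(\<lambda>s. deriv (f s) 0) field_differentiable at 0"
proof -
  obtain a b c d where j: "has_jet f a b c d" using assms unfolding jet2_def by blast
  show "(\<lambda>s. f s 0) field_differentiable at 0" "(\<lambda>s. deriv (f s) 0) field_differentiable at 0"
    using has_jet_imp_deriv(2,4)[OF j] by (auto simp: field_differentiable_def)
  obtain g where "\<forall>\<^sub>F s in nhds 0. (f s has_real_derivative g s) (at 0)"
    using j by (rule has_jetE)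
  then show "\<forall>\<^sub>F s in nhds 0. (f s has_real_derivative deriv (f s) 0) (at 0)"
    by eventually_elim (simp add: DERIV_imp_deriv)
qed

lemma jet2_differentiableI:
  assumes "(\<lambda>s. f s 0) field_differentiable at 0"
    "\<forall>\<^sub>F s in nhds 0. (f s has_real_derivative g s) (at 0)" "g field_differentiable at 0"
  shows "jet2 f"
  using assms unfolding field_differentiable_def by (blast intro: jet2I has_jetI)

lemma perron_value_DERIV:
  fixes A :: "real \<Rightarrow> nat \<Rightarrow> nat \<Rightarrow> real" and n :: nat
  defines "a \<equiv> \<lambda>x k. coeff (char_poly (nmat n (A x))) k"
  assumes P: "\<And>x. perron n (A x) (l x) (u x)"
    and cont: "\<And>i j. i < n \<Longrightarrow> j < n \<Longrightarrow> isCont (\<lambda>x. A x i j) x0"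
    and a: "\<And>k. k \<le> n \<Longrightarrow> ((\<lambda>x. a x k) has_real_derivative a' k) (at x0)"
  shows "(l has_real_derivative
     - (\<Sum>k\<le>n. a' k * l x0 ^ k) / (\<Sum>k\<le>n. a x0 k * (real k * l x0 ^ (k - 1)))) (at x0)"
proof (rule DERIV_root_of_family[OF a])
  show "isCont l x0"
    using perron_value_tendsto[OF P[of x0] P, where F = "at x0"] cont by (simp add: isCont_def)
qed (use perron_root[OF P] perron_simple[OF P] in \<open>simp_all add: a_def\<close>)

context
  fixes A :: "real \<Rightarrow> real \<Rightarrow> nat \<Rightarrow> nat \<Rightarrow> real" and l u n
  assumes P: "\<And>s t. perron n (A s t) (l s t) (u s t)"
    and jet: "\<And>i j. i < n \<Longrightarrow> j < n \<Longrightarrow> jet2 (\<lambda>s t. A s t i j)"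
begin

text \<open>The one-parameter formula is applied along the s-axis, and in t at each s near 0. The
  second application expresses the t-derivative through secular coefficients and
  \<open>l s 0\<close>, whose differentiability in s is then already known.\<close>

lemma jet2_perron_value: "jet2 l"
proof -
  define a where "a s t k = coeff (char_poly (nmat n (A s t))) k" for s t k
  have ja: "jet2 (\<lambda>s t. a s t k)" for k unfolding a_def by (rule jet2_coeff_char_poly[OF jet])
  note da = jet2_imp_differentiable[OF ja] and dA = jet2_imp_differentiable[OF jet]
  obtain b where b: "\<And>k. ((\<lambda>s. a s 0 k) has_real_derivative b k) (at 0)"
    using da(1) unfolding field_differentiable_def by metis
  have "((\<lambda>s. l s 0) has_real_derivative
      - (\<Sum>k\<le>n. b k * l 0 0 ^ k) / (\<Sum>k\<le>n. a 0 0 k * (real k * l 0 0 ^ (k - 1)))) (at 0)"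
    unfolding a_def
    by (rule perron_value_DERIV[OF P])
       (use dA(1) b in \<open>auto simp: a_def field_differentiable_imp_continuous_at\<close>)
  then have dl: "(\<lambda>s. l s 0) field_differentiable at 0" by (auto simp: field_differentiable_def)
  define D where "D s k = deriv (\<lambda>t. a s t k) 0" for s k
  define G where "G s = - (\<Sum>k\<le>n. D s k * l s 0 ^ k) / (\<Sum>k\<le>n. a s 0 k * (real k * l s 0 ^ (k - 1)))" for s
  have "\<forall>\<^sub>F s in nhds 0. \<forall>k\<in>{..n}. ((\<lambda>t. a s t k) has_real_derivative D s k) (at 0)"
    unfolding D_def by (intro eventually_ball_finite ballI da(2)) auto
  moreover have "\<forall>\<^sub>F s in nhds 0. \<forall>i\<in>{..<n}. \<forall>j\<in>{..<n}. isCont (\<lambda>t. A s t i j) 0"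
  proof (intro eventually_ball_finite ballI)
    fix i j assume "i \<in> {..<n}" "j \<in> {..<n}"
    then show "\<forall>\<^sub>F s in nhds 0. isCont (\<lambda>t. A s t i j) 0"
      using dA(2)[of i j] by (auto elim!: eventually_mono intro: DERIV_isCont)
  qed auto
  ultimately have "\<forall>\<^sub>F s in nhds 0. (l s has_real_derivative G s) (at 0)"
  proof eventually_elim
    case (elim s)
    then show ?case unfolding G_def a_def
      by (intro perron_value_DERIV[OF P]) auto
  qed
  moreover have "G field_differentiable at 0"
    unfolding G_def using dl da(1,3) perron_simple[OF P[of 0 0]] unfolding D_def
    by (intro derivative_intros field_differentiable_divide field_differentiable_sum
        field_differentiable_minus field_differentiable_mult field_differentiable_power
        field_differentiable_const) (auto simp: a_def)
  ultimately show ?thesis using dl by (intro jet2_differentiableI)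
qed

text \<open>Cramer's rule for the bordered system, whose border is frozen at the base point.\<close>

lemma jet2_perron_vec:
  assumes "i < n"
  shows "jet2 (\<lambda>s t. u s t i)"
proof -
  \<comment> \<open>The border stays at \<open>u 0 0\<close>: a border moving with u would
    presuppose the differentiability that is to be shown. At the origin it is the true Perron
    vector, so the determinant is nonzero there.\<close>
  define K where "K s t = bordered (A s t) (l s t) (u 0 0)" for s t
  \<comment> \<open>The known entry \<open>u s t 0 = 1\<close> is moved to the right-hand side as
    column 0 of \<open>l I - A\<close>. As y has 0 in its place, the border does not contribute to
    \<open>K y\<close>, whatever its entries are.\<close>
  define y where "y s t j = (if j = 0 then 0 else u s t j)" for s t and j :: nat
  define R where "R s t m j = (if j = i then - wminus (A s t) (l s t) m 0 else K s t m j)" for s t m j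
  note n = perron_dim[OF P[of 0 0]]
  have jw: "jet2 (\<lambda>s t. wminus (A s t) (l s t) m j)" if "m < n" "j < n" for m j
    using jet2_perron_value jet[OF that] unfolding wminus_def by (cases "m = j") auto
  have jK: "jet2 (\<lambda>s t. K s t m j)" if "m < n" "j < n" for m j
    unfolding K_def bordered_def using jw[OF that] by (cases "j = 0") auto
  have jR: "jet2 (\<lambda>s t. R s t m j)" if "m < n" "j < n" for m j
    unfolding R_def using jw[OF that(1) n] jK[OF that] by (cases "j = i") auto
  have det0: "det (nmat n (K 0 0)) \<noteq> 0"
    unfolding K_def by (rule det_bordered_nonzero[OF P])
  have cramer: "det (nmat n (R s t)) = y s t i * det (nmat n (K s t))" for s t
  proof -
    let ?K = "nmat n (K s t)" and ?y = "Matrix.vec n (y s t)"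
    have "vec_index (?K *\<^sub>v ?y) m = - wminus (A s t) (l s t) m 0" if "m < n" for m
    proof -
      have "(\<Sum>j<n. wminus (A s t) (l s t) m j * u s t j) = 0"
        using wminus_mult[OF that] perron_eq[OF P that] by simp
      moreover have "(\<Sum>j<n. wminus (A s t) (l s t) m j * u s t j) =
          (\<Sum>j<n. (if j = 0 then wminus (A s t) (l s t) m 0 else 0) + K s t m j * y s t j)"
        using perron_vec0[OF P] by (intro sum.cong) (auto simp: K_def bordered_def y_def)
      moreover have "(\<Sum>j<n. (if j = 0 then wminus (A s t) (l s t) m 0 else 0) + K s t m j * y s t j) =
          wminus (A s t) (l s t) m 0 + (\<Sum>j<n. K s t m j * y s t j)"
        using n by (simp add: sum.distrib)
      ultimately show ?thesis unfolding nmat_mult_vec[OF that] by linarith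
    qed
    then have "replace_col ?K (?K *\<^sub>v ?y) i = nmat n (R s t)"
      by (intro eq_matI) (auto simp: replace_col_def R_def)
    then show ?thesis using cramer_lemma_mat[of ?K n ?y i] assms by simp
  qed
  have "jet2 (\<lambda>s t. det (nmat n (R s t)) / det (nmat n (K s t)))"
    using det0 by (intro jet2_divide jet2_det jR jK)
  moreover have "\<forall>\<^sub>F s in nhds 0. \<forall>\<^sub>F t in nhds 0. det (nmat n (K s t)) \<noteq> 0"
    by (rule jet2_eventually_nonzero[OF jet2_det[OF jK] det0])
  then have "\<forall>\<^sub>F s in nhds 0. \<forall>\<^sub>F t in nhds 0. det (nmat n (R s t)) / det (nmat n (K s t)) = y s t i"
    by (auto elim!: eventually_mono simp: cramer)
  ultimately have "jet2 (\<lambda>s t. y s t i)" by (rule jet2_cong_ev)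
  then show ?thesis
    using perron_vec0[OF P] by (cases "i = 0") (auto simp: y_def)
qed

text \<open>The logarithm splits off \<open>ln l\<close>, and the remainder is
  \<open>ln (tr S^k) / k\<close>. Its jet tends to 0 because that of \<open>tr S^k\<close> converges
  to that of the constant 1. The jet is claimed only eventually, once k is positive and the trace at
  the origin is known to be positive from its limit.\<close>

lemma has_jet_ln_trace_power:
  assumes l: "has_jet l a b c d"
  shows "\<exists>\<alpha> \<beta> \<gamma> \<eta>.
    (\<forall>\<^sub>F k in sequentially.
      has_jet (\<lambda>s t. ln (\<Sum>j<n. mpow n (A s t) k j j) / real k) (\<alpha> k) (\<beta> k) (\<gamma> k) (\<eta> k)) \<and>
    \<alpha> \<longlonglongrightarrow> ln a \<and> \<beta> \<longlonglongrightarrow> b / a \<and> \<gamma> \<longlonglongrightarrow> c / a \<and> \<eta> \<longlonglongrightarrow> d / a - b * c / a\<^sup>2"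
proof -
  define S where "S s t = pstoch (A s t) (l s t) (u s t)" for s t
  note n = perron_dim[OF P[of 0 0]]
  have a: "a = l 0 0" using has_jet_imp_deriv(1)[OF l] by simp
  have "0 < a" using perron_value_pos[OF P] a by simp
  have "jet2 (\<lambda>s t. S s t i j)" if "i < n" "j < n" for i j
    unfolding S_def pstoch_def
    using perron_value_pos[OF P[of 0 0]] perron_vec[OF P[of 0 0] that(1)] that
    by (intro jet2_divide jet2_mult jet jet2_perron_vec jet2_perron_value) auto
  moreover have "(\<Sum>j<n. S s t i j) = 1" if "i < n" for s t i
    unfolding S_def by (rule pstoch_row[OF P that])
  moreover have S_pos: "0 < S s t i j" if "i < n" "j < n" for s t i j
    unfolding S_def by (rule pstoch_pos[OF P that])
  ultimately have "\<exists>p q r v. (\<forall>k. has_jet (\<lambda>s t. \<Sum>j<n. mpow n (S s t) k j j) (p k) (q k) (r k) (v k)) \<and>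
      p \<longlonglongrightarrow> 1 \<and> q \<longlonglongrightarrow> 0 \<and> r \<longlonglongrightarrow> 0 \<and> v \<longlonglongrightarrow> 0"
    by (rule has_jet_trace_stochastic_power[OF n]) blast+
  then obtain p q r v where
    tr: "\<And>k. has_jet (\<lambda>s t. \<Sum>j<n. mpow n (S s t) k j j) (p k) (q k) (r k) (v k)" and
    lim: "p \<longlonglongrightarrow> 1" "q \<longlonglongrightarrow> 0" "r \<longlonglongrightarrow> 0" "v \<longlonglongrightarrow> 0" by blast
  define \<alpha> \<beta> \<gamma> \<eta> where
    "\<alpha> k = ln a + ln (p k) / real k" and "\<beta> k = b / a + q k / p k / real k" and
    "\<gamma> k = c / a + r k / p k / real k" and
    "\<eta> k = d / a - b * c / a\<^sup>2 + (v k / p k - q k * r k / (p k)\<^sup>2) / real k" for k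
  have "\<forall>\<^sub>F k in sequentially. 0 < p k"
    by (rule order_tendstoD(1)[OF lim(1)]) simp
  then have "\<forall>\<^sub>F k in sequentially. has_jet (\<lambda>s t. ln (\<Sum>j<n. mpow n (A s t) k j j) / real k) (\<alpha> k) (\<beta> k) (\<gamma> k) (\<eta> k)"
    using eventually_gt_at_top[of 0]
  proof eventually_elim
    case (elim k)
    have "ln (\<Sum>j<n. mpow n (A s t) k j j) / real k =
        ln (l s t) + 1 / real k * ln (\<Sum>j<n. mpow n (S s t) k j j)" for s t
    proof -
      have "0 < (\<Sum>j<n. mpow n (A s t) k j j)" if "0 < k"
        using mpow_pos[OF perron_entry[OF P]] n elim by (intro sum_pos) auto
      then show ?thesis
        using perron_value_pos[OF P, of s t] elim unfolding S_def pstoch_trace[OF P]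
        by (simp add: ln_div ln_realpow field_simps)
    qed
    moreover have "has_jet (\<lambda>s t. ln (l s t) + 1 / real k * ln (\<Sum>j<n. mpow n (S s t) k j j))
        (\<alpha> k) (\<beta> k) (\<gamma> k) (\<eta> k)"
      using has_jet_add[OF has_jet_ln[OF l \<open>0 < a\<close>] has_jet_cmult[OF has_jet_ln[OF tr elim(1)], of "1 / real k"]]
      by (simp add: \<alpha>_def \<beta>_def \<gamma>_def \<eta>_def mult.commute)
    ultimately show ?case by simp
  qed
  moreover have "\<alpha> \<longlonglongrightarrow> ln a + ln 1 * 0" "\<beta> \<longlonglongrightarrow> b / a + 0 / 1 * 0" "\<gamma> \<longlonglongrightarrow> c / a + 0 / 1 * 0"
    "\<eta> \<longlonglongrightarrow> d / a - b * c / a\<^sup>2 + (0 / 1 - 0 * 0 / 1\<^sup>2) * 0"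
    unfolding \<alpha>_def \<beta>_def \<gamma>_def \<eta>_def divide_inverse[of _ "real _"]
    by (intro tendsto_intros lim lim_inverse_n; simp)+
  ultimately show ?thesis
    by - (rule exI[of _ \<alpha>], rule exI[of _ \<beta>], rule exI[of _ \<gamma>], rule exI[of _ \<eta>], simp)
qed

end

section \<open>The transfer matrix of the strip\<close>

lemma spin_cases:
  fixes x :: spin
  shows "x = 0 \<or> x = 1 \<or> x = 2"
proof (induct x)
  case (of_int z)
  then have "z = 0 \<or> z = 1 \<or> z = 2" by fastforce
  then show ?case by auto
qed

lemma lessThan_9: "{..<9::nat} = {0, 1, 2, 3, 4, 5, 6, 7, 8}"
  by auto

lemma bij_betw_spin_pair: "bij_betw spin_pair {..<9} UNIV"
proof -
  have surj: "UNIV = spin_pair ` {..<9}"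
  proof (rule UNIV_eq_I)
    fix p :: "spin \<times> spin"
    show "p \<in> spin_pair ` {..<9}"
      using spin_cases[of "fst p"] spin_cases[of "snd p"]
      unfolding lessThan_9 by (cases p) (auto simp: spin_pair_def)
  qed
  moreover have "inj_on spin_pair {..<9}"
    by (intro eq_card_imp_inj_on) (simp_all add: card_prod flip: surj)
  ultimately show ?thesis by (simp add: bij_betw_def)
qed

definition pair_index :: "spin \<times> spin \<Rightarrow> nat" where
  "pair_index = the_inv_into {..<9} spin_pair"

lemma spin_pair_index [simp]: "spin_pair (pair_index p) = p"
  unfolding pair_index_def using bij_betw_spin_pair
  by (auto simp: bij_betw_def intro!: f_the_inv_into_f)

lemma pair_index_less [simp]: "pair_index p < 9"
  using bij_betw_the_inv_into[OF bij_betw_spin_pair]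
  unfolding pair_index_def bij_betw_def by auto

lemma pair_index_spin_pair [simp]: "k < 9 \<Longrightarrow> pair_index (spin_pair k) = k"
  unfolding pair_index_def using bij_betw_spin_pair
  by (auto simp: bij_betw_def intro!: the_inv_into_f_f)

definition weight :: "coupling \<Rightarrow> field \<Rightarrow> real \<Rightarrow> nat \<Rightarrow> nat \<Rightarrow> real" where
  "weight J h T i j = exp (- local_H J h (spin_pair i) (spin_pair j) / T)"

lemma Theta_eq_nmat: "Theta J h T = nmat 9 (weight J h T)"
  by (simp add: Theta_def weight_def)

lemma weight_pos: "0 < weight J h T i j"
  by (simp add: weight_def)

lemma perron_weight:
  obtains u where "perron 9 (weight J h T) (lambda_max J h T) u"
proof -
  obtain l u where P: "perron 9 (weight J h T) l u"
    using perron_exists[where 'n = 9, of 9 "weight J h T"] weight_pos by auto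
  then show ?thesis
    using that perron_principal_eigenvalue[OF P] by (simp add: lambda_max_def Theta_eq_nmat)
qed

section \<open>The partition function as a sum over closed walks\<close>

primrec path_weight :: "('a \<Rightarrow> 'a \<Rightarrow> real) \<Rightarrow> 'a \<Rightarrow> 'a list \<Rightarrow> 'a \<Rightarrow> real" where
  "path_weight W x [] y = W x y"
| "path_weight W x (z # zs) y = W x z * path_weight W z zs y"

lemma path_weight_eq:
  "path_weight W x zs y = (\<Prod>i\<le>length zs. W ((x # zs @ [y]) ! i) ((x # zs @ [y]) ! Suc i))"
  by (induction zs arbitrary: x) (simp_all add: prod.atMost_shift lessThan_Suc_atMost del: prod.atMost_Suc)

text \<open>The endpoints stay outside the list, so \<open>k + 1\<close> factors have k intermediate
  states, and one more factor on the left is one more element at the head.\<close>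

lemma mpow_eq_sum_paths:
  "mpow n W (Suc k) x y = (\<Sum>zs\<in>{zs. set zs \<subseteq> {..<n} \<and> length zs = k}. path_weight W x zs y)"
  if "y < n"
proof (induction k arbitrary: x)
  case 0
  have "{zs. set zs \<subseteq> {..<n} \<and> length zs = 0} = {[]}" by auto
  then show ?case using that by simp
next
  case (Suc k)
  have "mpow n W (Suc (Suc k)) x y
      = (\<Sum>z<n. \<Sum>zs\<in>{zs. set zs \<subseteq> {..<n} \<and> length zs = k}. W x z * path_weight W z zs y)"
    unfolding mpow.simps(2)[of n W "Suc k"] Suc.IH by (simp add: sum_distrib_left)
  also have "\<dots> = (\<Sum>(z, zs)\<in>{..<n} \<times> {zs. set zs \<subseteq> {..<n} \<and> length zs = k}. path_weight W x (z # zs) y)"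
    by (simp add: sum.cartesian_product)
  also have "\<dots> = (\<Sum>zs\<in>{zs. set zs \<subseteq> {..<n} \<and> length zs = Suc k}. path_weight W x zs y)"
    by (rule sum.reindex_bij_witness[of _ "\<lambda>zs. (hd zs, tl zs)" "\<lambda>(z, zs). z # zs"])
       (auto simp: length_Suc_conv)
  finally show ?case .
qed

text \<open>The common endpoint of a closed walk becomes the head of the list; the index modulo L
  turns the last factor into the return to it.\<close>

lemma trace_mpow_eq_sum_cycles:
  assumes "0 < L"
  shows "(\<Sum>j<n. mpow n W L j j) =
    (\<Sum>zs\<in>{zs. set zs \<subseteq> {..<n} \<and> length zs = L}. \<Prod>i<L. W (zs ! i) (zs ! ((i + 1) mod L)))"
proof -
  obtain k where L: "L = Suc k" using assms by (cases L) auto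
  have "(\<Sum>j<n. mpow n W L j j)
      = (\<Sum>(z, zs)\<in>{..<n} \<times> {zs. set zs \<subseteq> {..<n} \<and> length zs = k}. path_weight W z zs z)"
    unfolding L by (simp add: mpow_eq_sum_paths sum.cartesian_product del: mpow.simps)
  also have "\<dots> = (\<Sum>zs\<in>{zs. set zs \<subseteq> {..<n} \<and> length zs = L}. \<Prod>i<L. W (zs ! i) (zs ! ((i + 1) mod L)))"
  proof (rule sum.reindex_bij_witness[of _ "\<lambda>zs. (hd zs, tl zs)" "\<lambda>(z, zs). z # zs"])
    fix p assume "p \<in> {..<n} \<times> {zs. set zs \<subseteq> {..<n} \<and> length zs = k}"
    then obtain z zs where p: "p = (z, zs)" "length zs = k" by auto
    have "path_weight W z zs z = (\<Prod>i<L. W ((z # zs) ! i) ((z # zs) ! ((i + 1) mod L)))"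
      unfolding path_weight_eq p(2) L lessThan_Suc_atMost
    proof (intro prod.cong refl arg_cong2[where f = W])
      fix i assume "i \<in> {..k}"
      then show "(z # zs @ [z]) ! i = (z # zs) ! i"
        using nth_append[of "z # zs" "[z]" i] p(2) by simp
      show "(z # zs @ [z]) ! Suc i = (z # zs) ! ((i + 1) mod Suc k)"
        using nth_append[of "z # zs" "[z]" "Suc i"] p(2) \<open>i \<in> {..k}\<close> by (cases "i = k") auto
    qed
    then show "(\<Prod>i<L. W ((case p of (z, zs) \<Rightarrow> z # zs) ! i) ((case p of (z, zs) \<Rightarrow> z # zs) ! ((i + 1) mod L)))
        = (case p of (z, zs) \<Rightarrow> path_weight W z zs z)"
      using p(1) by simp
  qed (auto simp: L length_Suc_conv)
  finally show ?thesis .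
qed

lemma finite_configs: "finite (configs L)"
  unfolding configs_def by (intro finite_PiE) auto

text \<open>A configuration is read as the list of its L rungs, each encoded by an index below 9;
  the Boltzmann factor is then the product of transfer weights around a cycle.\<close>

lemma partition_fun_eq_trace:
  assumes "0 < L"
  shows "partition_fun J L h T = (\<Sum>j<9. mpow 9 (weight J h T) L j j)"
proof -
  let ?D = "{..<L} \<times> {..<2::nat}"
  define f :: "nat list \<Rightarrow> config" where
    "f zs = (\<lambda>p\<in>?D. if snd p = 0 then fst (spin_pair (zs ! fst p)) else snd (spin_pair (zs ! fst p)))" for zs
  define g :: "config \<Rightarrow> nat list" where
    "g \<sigma> = map (\<lambda>i. pair_index (\<sigma> (i, 0), \<sigma> (i, 1))) [0..<L]" for \<sigma>
  have "partition_fun J L h T = (\<Sum>zs\<in>{zs. set zs \<subseteq> {..<9} \<and> length zs = L}.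
      \<Prod>i<L. weight J h T (zs ! i) (zs ! ((i + 1) mod L)))"
    unfolding partition_fun_def
  proof (rule sum.reindex_bij_witness[of _ f g])
    fix \<sigma> assume \<sigma>: "\<sigma> \<in> configs L"
    show "f (g \<sigma>) = \<sigma>"
    proof
      fix p :: "nat \<times> nat"
      \<comment> \<open>Configurations are extensional functions, so the inverse must reproduce
        \<open>undefined\<close> outside the strip as well.\<close>
      have "\<sigma> p = undefined" if "p \<notin> ?D"
        using \<sigma> that unfolding configs_def by (rule PiE_arb)
      then show "f (g \<sigma>) p = \<sigma> p"
        by (cases p) (auto simp: f_def g_def less_2_cases_iff)
    qed
    show "g \<sigma> \<in> {zs. set zs \<subseteq> {..<9} \<and> length zs = L}" by (auto simp: g_def)
    have "- hamiltonian J L h \<sigma> / T = (\<Sum>i<L. - local_H J h (\<sigma> (i, 0), \<sigma> (i, 1))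
        (\<sigma> ((i + 1) mod L, 0), \<sigma> ((i + 1) mod L, 1)) / T)"
      unfolding hamiltonian_def by (simp add: sum_negf sum_divide_distrib)
    then show "(\<Prod>i<L. weight J h T (g \<sigma> ! i) (g \<sigma> ! ((i + 1) mod L))) = exp (- hamiltonian J L h \<sigma> / T)"
      using assms by (simp add: exp_sum weight_def g_def)
  next
    fix zs :: "nat list" assume zs: "zs \<in> {zs. set zs \<subseteq> {..<9} \<and> length zs = L}"
    then have "zs ! i < 9" if "i < L" for i using that nth_mem by blast
    then show "g (f zs) = zs"
      using zs by (intro nth_equalityI) (auto simp: g_def f_def)
    show "f zs \<in> configs L" by (auto simp: f_def configs_def)
  qed
  then show ?thesis using trace_mpow_eq_sum_cycles[OF assms] by simp
qed

section \<open>The field term and the global spin shift\<close>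

definition plaquette_count :: "spin \<Rightarrow> spin \<times> spin \<Rightarrow> spin \<times> spin \<Rightarrow> real" where
  "plaquette_count \<mu> p q = delta [\<mu>, fst p] + delta [\<mu>, snd p] + delta [\<mu>, fst q] + delta [\<mu>, snd q]"

lemma local_H_field:
  "local_H J h p q = local_H J zero_field p q - (\<Sum>\<mu>\<in>UNIV. h \<mu> * plaquette_count \<mu> p q)"
  by (cases p; cases q) (simp add: local_H_def plaquette_count_def add.assoc)

lemma hamiltonian_field:
  assumes "0 < L"
  shows "hamiltonian J L h \<sigma> = hamiltonian J L zero_field \<sigma> - 2 * (\<Sum>\<mu>\<in>UNIV. h \<mu> * magn L \<mu> \<sigma>)"
proof -
  \<comment> \<open>Cyclic rotation makes the right-hand rungs of all plaquettes contribute as much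
    as the left-hand ones, which is the source of the factor 2.\<close>
  have rot: "(\<Sum>i<L. F ((i + 1) mod L)) = (\<Sum>i<L. F i)" for F :: "nat \<Rightarrow> real"
  proof (rule sum.reindex_bij_betw)
    have "inj_on (\<lambda>i. (i + 1) mod L) {..<L}"
    proof (rule inj_onI)
      fix i j assume "i \<in> {..<L}" "j \<in> {..<L}" "(i + 1) mod L = (j + 1) mod L"
      then show "i = j" by (cases "i + 1 = L"; cases "j + 1 = L") auto
    qed
    moreover have "(\<lambda>i. (i + 1) mod L) ` {..<L} \<subseteq> {..<L}" using assms by auto
    ultimately show "bij_betw (\<lambda>i. (i + 1) mod L) {..<L} {..<L}"
      by (simp add: bij_betw_def endo_inj_surj)
  qed
  have "(\<Sum>i<L. plaquette_count \<mu> (\<sigma> (i, 0), \<sigma> (i, 1)) (\<sigma> ((i + 1) mod L, 0), \<sigma> ((i + 1) mod L, 1)))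
      = 2 * magn L \<mu> \<sigma>" for \<mu>
    using rot[of "\<lambda>i. delta [\<mu>, \<sigma> (i, 0)] + delta [\<mu>, \<sigma> (i, 1)]"]
    by (simp add: plaquette_count_def magn_def sum.distrib numeral_2_eq_2)
  then have "(\<Sum>i<L. \<Sum>\<mu>\<in>UNIV. h \<mu> * plaquette_count \<mu> (\<sigma> (i, 0), \<sigma> (i, 1))
        (\<sigma> ((i + 1) mod L, 0), \<sigma> ((i + 1) mod L, 1))) = (\<Sum>\<mu>\<in>UNIV. h \<mu> * (2 * magn L \<mu> \<sigma>))"
    by (subst sum.swap) (simp flip: sum_distrib_left)
  then show ?thesis
    unfolding hamiltonian_def
    by (subst local_H_field) (simp add: sum_subtractf sum_distrib_left mult.left_commute)
qed

lemma delta_shift: "delta (map (\<lambda>x. x + c) xs) = delta xs"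
  by (auto simp: delta_def)

lemma local_H_shift:
  "local_H J zero_field (s0 + c, s1 + c) (s2 + c, s3 + c) = local_H J zero_field (s0, s1) (s2, s3)"
  using delta_shift[of c "[s0, _ + s1, _ + s2, _ + s3]"]
  by (simp add: local_H_def add.assoc)

lemma gibbs_mean_magn_shift:
  assumes "0 < L"
  shows "gibbs_mean J L zero_field T (magn L (\<mu> + c)) = gibbs_mean J L zero_field T (magn L \<mu>)"
proof -
  define sh :: "spin \<Rightarrow> config \<Rightarrow> config" where "sh c \<sigma> = (\<lambda>p\<in>{..<L} \<times> {..<2}. \<sigma> p + c)" for c \<sigma>
  have sh_in: "sh c \<sigma> \<in> configs L" for \<sigma> c by (auto simp: sh_def configs_def)
  have sh_sh: "sh c (sh d \<sigma>) = \<sigma>" if "\<sigma> \<in> configs L" "c + d = 0" for \<sigma> c d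
  proof
    fix p
    have "\<sigma> p + d + c = \<sigma> p" using that(2) by (simp add: add.assoc add.commute)
    moreover have "\<sigma> p = undefined" if "p \<notin> {..<L} \<times> {..<2}"
      using \<open>\<sigma> \<in> configs L\<close> that unfolding configs_def by (rule PiE_arb)
    ultimately show "sh c (sh d \<sigma>) p = \<sigma> p" by (auto simp: sh_def)
  qed
  have H: "hamiltonian J L zero_field (sh c \<sigma>) = hamiltonian J L zero_field \<sigma>" for \<sigma> c
    using assms by (simp add: hamiltonian_def sh_def local_H_shift)
  have "delta [\<mu> + c, x + c] = delta [\<mu>, x]" for x
    using delta_shift[of c "[\<mu>, x]"] by simp
  then have M: "magn L (\<mu> + c) (sh c \<sigma>) = magn L \<mu> \<sigma>" for \<sigma>
    by (simp add: magn_def sh_def)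
  show ?thesis
    unfolding gibbs_mean_def
    by (rule sum.reindex_bij_witness[of _ "sh c" "sh (- c)"])
       (use sh_in sh_sh H M in \<open>auto simp: H M simp flip: M[of "sh (- c) _"]\<close>)
qed

lemma partition_fun_pos: "0 < L \<Longrightarrow> 0 < partition_fun J L h T"
proof -
  have "configs L \<noteq> {}" by (auto simp: configs_def PiE_eq_empty_iff)
  then show ?thesis unfolding partition_fun_def using finite_configs by (intro sum_pos) auto
qed

text \<open>The three means are equal by the shift symmetry, and their sum is the number
  \<open>2 * L\<close> of sites.\<close>

lemma gibbs_mean_magn_zero_field:
  assumes "0 < L"
  shows "gibbs_mean J L zero_field T (magn L \<mu>) = 2 * real L / 3"
proof -
  let ?G = "\<lambda>\<mu>. gibbs_mean J L zero_field T (magn L \<mu>)"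
  have eq: "?G \<nu> = ?G \<mu>" for \<nu>
    using gibbs_mean_magn_shift[OF assms, of J T \<mu> "\<nu> - \<mu>"] by simp
  have "delta [\<nu>, x] = (if x = \<nu> then 1 else 0)" for \<nu> x by (auto simp: delta_def)
  then have one: "(\<Sum>\<nu>\<in>UNIV. delta [\<nu>, x]) = 1" for x by simp
  have "(\<Sum>\<nu>\<in>UNIV. magn L \<nu> \<sigma>) = 2 * real L" for \<sigma>
  proof -
    have "(\<Sum>\<nu>\<in>UNIV. magn L \<nu> \<sigma>) = (\<Sum>i<L. \<Sum>j<2. \<Sum>\<nu>\<in>UNIV. delta [\<nu>, \<sigma> (i, j)])"
      unfolding magn_def by (subst sum.swap, rule sum.cong[OF refl], subst sum.swap, rule refl)
    then show ?thesis by (simp add: one)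
  qed
  then have "(\<Sum>\<nu>\<in>UNIV. ?G \<nu>) = (\<Sum>\<sigma>\<in>configs L. 2 * real L * (exp (- hamiltonian J L zero_field \<sigma> / T) / partition_fun J L zero_field T))"
    unfolding gibbs_mean_def by (subst sum.swap) (simp only: sum_distrib_right[symmetric])
  also have "\<dots> = 2 * real L * (partition_fun J L zero_field T / partition_fun J L zero_field T)"
    unfolding sum_distrib_left[symmetric] sum_divide_distrib[symmetric] by (simp only: partition_fun_def)
  also have "\<dots> = 2 * real L" using partition_fun_pos[OF assms, of J zero_field T] by simp
  finally have "(\<Sum>\<nu>\<in>UNIV. ?G \<nu>) = 2 * real L" .
  moreover have "(\<Sum>\<nu>\<in>UNIV. ?G \<nu>) = 3 * ?G \<mu>"
    by (subst sum.cong[OF refl eq]) simp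
  ultimately show ?thesis by simp
qed

section \<open>Reduction from \<open>Theta\<close> to \<open>Theta1\<close> at zero field\<close>

lemma pair_index_numerals:
  "pair_index (0, 0) = 0" "pair_index (1, 1) = 4" "pair_index (2, 2) = 8"
  "pair_index (1, 0) = 1" "pair_index (2, 1) = 5" "pair_index (0, 2) = 6"
  "pair_index (2, 0) = 2" "pair_index (0, 1) = 3" "pair_index (1, 2) = 7"
  using pair_index_spin_pair[of 0] pair_index_spin_pair[of 1] pair_index_spin_pair[of 2]
    pair_index_spin_pair[of 3] pair_index_spin_pair[of 4] pair_index_spin_pair[of 5]
    pair_index_spin_pair[of 6] pair_index_spin_pair[of 7] pair_index_spin_pair[of 8]
  by (simp_all add: spin_pair_def)

text \<open>The shift permutes the indices and preserves the weights, so the shifted vector is again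
  a positive eigenvector and equals \<open>c * u\<close> by uniqueness.\<close>

lemma perron_zero_field_shift_invariant:
  assumes P: "perron 9 (weight J zero_field T) l u"
  shows "u (pair_index (a + 1, b + 1)) = u (pair_index (a, b))"
proof -
  define \<tau> where "\<tau> c k = pair_index (fst (spin_pair k) + c, snd (spin_pair k) + c)" for c :: spin and k
  let ?W = "weight J zero_field T"
  have W: "?W (\<tau> c i) (\<tau> c j) = ?W i j" for c i j
    using local_H_shift[of J "fst (spin_pair i)" c "snd (spin_pair i)" "fst (spin_pair j)" "snd (spin_pair j)"]
    by (simp add: weight_def \<tau>_def)
  have inv: "\<tau> c (\<tau> d k) = k" if "k < 9" "c + d = 0" for c d k
    using that by (simp add: \<tau>_def add.assoc add.commute[of d c])
  have less: "\<tau> c k < 9" for c k by (simp add: \<tau>_def)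
  have reindex: "(\<Sum>j<9. F (\<tau> 1 j)) = (\<Sum>j<9. F j)" for F :: "nat \<Rightarrow> real"
    by (rule sum.reindex_bij_witness[of _ "\<tau> (- 1)" "\<tau> 1"]) (auto simp: inv less)
  define c where "c = u (\<tau> 1 0)"
  have "0 < c" unfolding c_def using perron_vec[OF P less] .
  have "(\<Sum>j<9. ?W i j * (u (\<tau> 1 j) / c)) = l * (u (\<tau> 1 i) / c)" if "i < 9" for i
  proof -
    have "(\<Sum>j<9. ?W i j * u (\<tau> 1 j)) = (\<Sum>j<9. ?W (\<tau> 1 i) (\<tau> 1 j) * u (\<tau> 1 j))"
      by (simp only: W)
    also have "\<dots> = (\<Sum>j<9. ?W (\<tau> 1 i) j * u j)" by (rule reindex)
    also have "\<dots> = l * u (\<tau> 1 i)" by (rule perron_eq[OF P less])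
    finally show ?thesis by (simp flip: sum_divide_distrib)
  qed
  moreover have "u (\<tau> 1 0) / c = 1" using \<open>0 < c\<close> unfolding c_def by simp
  ultimately have "perron 9 ?W l (\<lambda>i. u (\<tau> 1 i) / c)"
    unfolding perron_def using weight_pos perron_vec[OF P less] less_imp_neq[OF \<open>0 < c\<close>, symmetric] by simp
  then have u: "u (\<tau> 1 i) = c * u i" if "i < 9" for i
    using perron_unique(2)[OF P _ that] \<open>0 < c\<close> by (simp add: field_simps)
  \<comment> \<open>The sum of all entries is unchanged by the permutation and positive, which
    forces \<open>c = 1\<close>.\<close>
  have "(\<Sum>i<9. u i) = (\<Sum>i<9. u (\<tau> 1 i))" using reindex[of u] by simp
  also have "\<dots> = c * (\<Sum>i<9. u i)" using u by (simp add: sum_distrib_left)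
  finally have "c * (\<Sum>i<9. u i) = 1 * (\<Sum>i<9. u i)" by simp
  moreover have "0 < (\<Sum>i<9. u i)" using perron_vec[OF P] by (intro sum_pos) (auto simp: lessThan_empty_iff)
  ultimately have "c = 1" by (metis mult_right_cancel less_irrefl)
  then show ?thesis using u[of "pair_index (a, b)"] by (simp add: \<tau>_def)
qed

lemma lessThan_3: "{..<3::nat} = {0, 1, 2}"
  by auto

text \<open>The shift has the orbits {0, 4, 8}, {1, 5, 6} and {2, 3, 7} on the indices, and u is
  constant on each. The columns of one orbit can therefore be added up, and the restriction of u to
  the representatives 0, 1, 2 is a Perron vector of the lumped matrix for the same
  eigenvalue.\<close>

lemma perron_Theta1:
  assumes P: "perron 9 (weight J zero_field T) l u"
  obtains B where "Theta1 J T = nmat 3 B" "perron 3 B l u"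
proof -
  let ?W = "weight J zero_field T"
  define B where "B i j = (if j = 0 then ?W i 0 + ?W i 4 + ?W i 8
      else if j = 1 then ?W i 1 + ?W i 5 + ?W i 6 else ?W i 2 + ?W i 3 + ?W i 7)" for i j :: nat
  have less3: "i < 3 \<longleftrightarrow> i = 0 \<or> i = 1 \<or> i = 2" for i :: nat by auto
  have "Theta1 J T = nmat 3 B"
    unfolding Theta1_def Let_def Theta_eq_nmat
    by (rule eq_matI) (auto simp: mat_of_rows_list_def B_def less3)
  moreover have "perron 3 B l u"
  proof -
    note sh = perron_zero_field_shift_invariant[OF P]
    have plus_one: "0 + 1 = (1::spin)" "1 + 1 = (2::spin)" "2 + 1 = (0::spin)" by simp_all
    have u: "u 4 = u 0" "u 8 = u 0" "u 5 = u 1" "u 6 = u 1" "u 3 = u 2" "u 7 = u 2"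
      using sh[of 0 0] sh[of 1 1] sh[of 1 0] sh[of 2 1] sh[of 2 0] sh[of 0 1]
      unfolding plus_one pair_index_numerals by simp_all
    have "(\<Sum>j<3. B i j * u j) = l * u i" if "i < 3" for i
    proof -
      have "(\<Sum>j<3. B i j * u j) = (\<Sum>j<9. ?W i j * u j)"
        by (simp add: lessThan_3 lessThan_9 B_def u distrib_right)
      then show ?thesis using perron_eq[OF P, of i] that by simp
    qed
    then show ?thesis
      using perron_vec[OF P] perron_vec0[OF P] weight_pos unfolding perron_def
      by (auto simp: B_def intro!: add_pos_pos)
  qed
  ultimately show ?thesis by (rule that)
qed

lemma lambda_max1_eq: "lambda_max1 J T = lambda_max J zero_field T"
  and eigenvalue_Theta1: "eigenvalue (Theta1 J T) (lambda_max1 J T)"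
proof -
  obtain u where "perron 9 (weight J zero_field T) (lambda_max J zero_field T) u"
    by (rule perron_weight)
  then obtain B where B: "Theta1 J T = nmat 3 B" "perron 3 B (lambda_max J zero_field T) u"
    by (rule perron_Theta1)
  show "lambda_max1 J T = lambda_max J zero_field T" "eigenvalue (Theta1 J T) (lambda_max1 J T)"
    using perron_principal_eigenvalue[OF B(2)] perron_eigenvalue[OF B(2)]
    by (simp_all add: lambda_max1_def B(1))
qed

section \<open>Response to fields and temperature\<close>

text \<open>The two increments are added, not overwritten: for equal directions the field depends on
  \<open>s + t\<close>, and the jet gives the pure second derivative.\<close>

definition field_shift :: "field \<Rightarrow> spin \<Rightarrow> spin \<Rightarrow> real \<Rightarrow> real \<Rightarrow> field" where
  "field_shift h \<mu>0 \<mu>1 s t = (\<lambda>\<mu>. h \<mu> + (if \<mu> = \<mu>0 then s else 0) + (if \<mu> = \<mu>1 then t else 0))"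

lemma field_shift_0_0 [simp]: "field_shift h \<mu>0 \<mu>1 0 0 = h"
  by (auto simp: field_shift_def)

lemma pdh_eq: "pdh \<mu> F g = deriv (\<lambda>t. F (g(\<mu> := g \<mu> + t))) 0"
  unfolding pdh_def deriv_def using DERIV_shift[of "\<lambda>x. F (g(\<mu> := x))" _ 0 "g \<mu>"]
  by (simp add: add.commute)

lemma pdh_exists_iff: "pdh_exists \<mu> F g \<longleftrightarrow> (\<lambda>t. F (g(\<mu> := g \<mu> + t))) field_differentiable at 0"
  unfolding pdh_exists_def field_differentiable_def
  using DERIV_shift[of "\<lambda>x. F (g(\<mu> := x))" _ 0 "g \<mu>"] by (simp add: add.commute)

text \<open>The inner derivative, in t, belongs to \<open>\<mu>1\<close> and the outer one, in s, to
  \<open>\<mu>0\<close>, the nesting order of \<open>pdh\<close>.\<close>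

lemma has_jet_field_shift_imp_pdh:
  assumes "has_jet (\<lambda>s t. F (field_shift h \<mu>0 \<mu>1 s t)) a b c d"
  shows "F h = a" "pdh \<mu>0 F h = b" "pdh \<mu>1 F h = c" "pdh \<mu>0 (pdh \<mu>1 F) h = d"
    "pdh_exists \<mu>1 F h" "pdh_exists \<mu>0 (pdh \<mu>1 F) h"
proof -
  note j = has_jet_imp_deriv[OF assms]
  have 0: "field_shift h \<mu>0 \<mu>1 s 0 = h(\<mu>0 := h \<mu>0 + s)" for s
    by (auto simp: field_shift_def)
  have 1: "field_shift h \<mu>0 \<mu>1 0 t = h(\<mu>1 := h \<mu>1 + t)" for t
    by (auto simp: field_shift_def)
  have 2: "deriv (\<lambda>t. F (field_shift h \<mu>0 \<mu>1 s t)) 0 = pdh \<mu>1 F (h(\<mu>0 := h \<mu>0 + s))" for s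
    unfolding pdh_eq
    by (rule arg_cong[where f = "\<lambda>f. deriv f 0"], rule ext, rule arg_cong[where f = F])
       (auto simp: field_shift_def)
  show "F h = a" using j(1) by simp
  show "pdh \<mu>0 F h = b" using j(2) unfolding 0 pdh_eq by (rule DERIV_imp_deriv)
  show "pdh \<mu>1 F h = c" using j(3) unfolding 1 pdh_eq by (rule DERIV_imp_deriv)
  show "pdh_exists \<mu>1 F h" using j(3) unfolding 1 pdh_exists_iff field_differentiable_def by blast
  show "pdh \<mu>0 (pdh \<mu>1 F) h = d" using j(4) unfolding 2 pdh_eq[of \<mu>0] by (rule DERIV_imp_deriv)
  show "pdh_exists \<mu>0 (pdh \<mu>1 F) h"
    using j(4) unfolding 2 pdh_exists_iff field_differentiable_def by blast
qed

lemma sum_field_shift: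
  "(\<Sum>\<mu>\<in>UNIV. field_shift h \<mu>0 \<mu>1 s t \<mu> * f \<mu>) = (\<Sum>\<mu>\<in>UNIV. h \<mu> * f \<mu>) + s * f \<mu>0 + t * f \<mu>1"
proof -
  have "field_shift h \<mu>0 \<mu>1 s t \<mu> * f \<mu> =
      h \<mu> * f \<mu> + (if \<mu> = \<mu>0 then s * f \<mu> else 0) + (if \<mu> = \<mu>1 then t * f \<mu> else 0)" for \<mu>
    by (simp add: field_shift_def distrib_right)
  then show ?thesis by (simp add: sum.distrib)
qed

lemma has_jet_exp_affine:
  "has_jet (\<lambda>s t. exp (a + s * b + t * c)) (exp a) (exp a * b) (exp a * c) (exp a * b * c)"
  using has_jet_exp[OF has_jet_add[OF has_jet_add[OF has_jet_const[of a]
      has_jet_mult[OF has_jet_fst has_jet_const[of b]]] has_jet_mult[OF has_jet_snd has_jet_const[of c]]]]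
  by simp

lemma jet2_weight_field: "jet2 (\<lambda>s t. weight J (field_shift h \<mu>0 \<mu>1 s t) T i j)"
proof -
  let ?n = "\<lambda>\<mu>. plaquette_count \<mu> (spin_pair i) (spin_pair j)"
  let ?E = "local_H J h (spin_pair i) (spin_pair j)"
  have "weight J (field_shift h \<mu>0 \<mu>1 s t) T i j = exp (- ?E / T + s * (?n \<mu>0 / T) + t * (?n \<mu>1 / T))" for s t
    unfolding weight_def
    by (subst (1 2) local_H_field) (simp add: sum_field_shift diff_divide_distrib add_divide_distrib)
  then show ?thesis using has_jet_exp_affine[of "- ?E / T" "?n \<mu>0 / T" "?n \<mu>1 / T"] by (simp add: jet2I)
qed

lemma jet2_weight_temperature:
  assumes "T \<noteq> 0"
  shows "jet2 (\<lambda>s t. weight J h (T + s + t) i j)"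
proof -
  let ?E = "local_H J h (spin_pair i) (spin_pair j)"
  have "jet2 (\<lambda>s t. T + s + t)"
    by (intro jet2_add jet2_const jet2I[OF has_jet_fst] jet2I[OF has_jet_snd])
  then have "jet2 (\<lambda>s t. - ?E / (T + s + t))" using assms by (intro jet2_divide jet2_const) auto
  then show ?thesis unfolding weight_def jet2_def using has_jet_exp by blast
qed

text \<open>Implicit differentiation: the jet of the left-hand side of the secular equation is
  compared with the jet of the constant 0, and its third and fourth components are solved for c and
  d.\<close>

lemma has_jet_root_formula:
  assumes a: "\<And>k. k \<le> n \<Longrightarrow> has_jet (\<lambda>s t. a s t k) (a0 k) (a1 k) (a2 k) (a12 k)"
    and l: "has_jet l l0 b c d" and root: "\<And>s t. (\<Sum>k\<le>n. a s t k * l s t ^ k) = 0"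
    and D: "D = (\<Sum>k\<le>n. a0 k * (real k * l0 ^ (k - 1)))" "D \<noteq> 0"
  shows "c = - (\<Sum>k\<le>n. a2 k * l0 ^ k) / D"
    "d = - 1 / D * ((\<Sum>k\<le>n. a12 k * l0 ^ k) + c * (\<Sum>k\<le>n. a1 k * (real k * l0 ^ (k - 1)))
       + b * ((\<Sum>k\<le>n. a2 k * (real k * l0 ^ (k - 1)))
              + c * (\<Sum>k\<le>n. a0 k * (real k * real (k - 1) * l0 ^ (k - 2)))))"
proof -
  have "has_jet (\<lambda>s t. \<Sum>k\<le>n. a s t k * l s t ^ k)
      (\<Sum>k\<le>n. a0 k * l0 ^ k) (\<Sum>k\<le>n. a1 k * l0 ^ k + a0 k * (real k * l0 ^ (k - 1) * b))
      (\<Sum>k\<le>n. a2 k * l0 ^ k + a0 k * (real k * l0 ^ (k - 1) * c))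
      (\<Sum>k\<le>n. a12 k * l0 ^ k + a1 k * (real k * l0 ^ (k - 1) * c) + a2 k * (real k * l0 ^ (k - 1) * b)
        + a0 k * (real k * real (k - 1) * l0 ^ (k - 2) * b * c + real k * l0 ^ (k - 1) * d))"
    by (intro has_jet_sum has_jet_mult a has_jet_power l) auto
  then have "has_jet (\<lambda>s t. 0)
      (\<Sum>k\<le>n. a0 k * l0 ^ k) (\<Sum>k\<le>n. a1 k * l0 ^ k + a0 k * (real k * l0 ^ (k - 1) * b))
      (\<Sum>k\<le>n. a2 k * l0 ^ k + a0 k * (real k * l0 ^ (k - 1) * c))
      (\<Sum>k\<le>n. a12 k * l0 ^ k + a1 k * (real k * l0 ^ (k - 1) * c) + a2 k * (real k * l0 ^ (k - 1) * b)
        + a0 k * (real k * real (k - 1) * l0 ^ (k - 2) * b * c + real k * l0 ^ (k - 1) * d))"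
    unfolding root .
  note eq = has_jet_unique[OF this has_jet_const]
  have "(\<Sum>k\<le>n. a2 k * l0 ^ k) + D * c = 0"
    using eq(3) unfolding D(1) by (simp add: sum.distrib sum_distrib_right sum_distrib_left mult_ac)
  then show "c = - (\<Sum>k\<le>n. a2 k * l0 ^ k) / D"
    using D(2) by (simp add: field_simps)
  have "(\<Sum>k\<le>n. a12 k * l0 ^ k) + c * (\<Sum>k\<le>n. a1 k * (real k * l0 ^ (k - 1)))
       + b * ((\<Sum>k\<le>n. a2 k * (real k * l0 ^ (k - 1)))
              + c * (\<Sum>k\<le>n. a0 k * (real k * real (k - 1) * l0 ^ (k - 2)))) + d * D = 0"
  proof -
    have "(\<Sum>k\<le>n. a12 k * l0 ^ k) + c * (\<Sum>k\<le>n. a1 k * (real k * l0 ^ (k - 1)))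
       + b * ((\<Sum>k\<le>n. a2 k * (real k * l0 ^ (k - 1)))
              + c * (\<Sum>k\<le>n. a0 k * (real k * real (k - 1) * l0 ^ (k - 2)))) + d * D
      = (\<Sum>k\<le>n. a12 k * l0 ^ k + a1 k * (real k * l0 ^ (k - 1) * c) + a2 k * (real k * l0 ^ (k - 1) * b)
        + a0 k * (real k * real (k - 1) * l0 ^ (k - 2) * b * c + real k * l0 ^ (k - 1) * d))"
      unfolding D(1) sum_distrib_left sum.distrib[symmetric] by (intro sum.cong) (auto simp: algebra_simps)
    then show ?thesis using eq(4) by simp
  qed
  then show "d = - 1 / D * ((\<Sum>k\<le>n. a12 k * l0 ^ k) + c * (\<Sum>k\<le>n. a1 k * (real k * l0 ^ (k - 1)))
       + b * ((\<Sum>k\<le>n. a2 k * (real k * l0 ^ (k - 1)))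
              + c * (\<Sum>k\<le>n. a0 k * (real k * real (k - 1) * l0 ^ (k - 2)))))"
    using D(2) by (simp add: field_simps)
qed

text \<open>The term with index 0 carries the factor 0; dropping it shifts the index by one, into
  the form of the stated formulas.\<close>

lemma sum_atMost_Suc_power_deriv:
  "(\<Sum>k\<le>Suc m. f k * (real k * x ^ (k - 1))) = (\<Sum>k\<le>m. (real k + 1) * f (k + 1) * x ^ k)"
  by (subst sum.atMost_Suc_shift) (simp add: algebra_simps)

lemma sum_atMost_Suc_power_deriv2:
  "(\<Sum>k\<le>Suc (Suc m). f k * (real k * real (k - 1) * x ^ (k - 2)))
     = (\<Sum>k\<le>m. (real k + 2) * (real k + 1) * f (k + 2) * x ^ k)"
  by (subst sum.atMost_Suc_shift, subst sum.atMost_Suc_shift) (simp add: algebra_simps)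

text \<open>The choice turns existence into a function of the parameters. By uniqueness it leaves no
  freedom in the nine relevant entries, so it cannot spoil their differentiability.\<close>

definition perron_vector :: "coupling \<Rightarrow> field \<Rightarrow> real \<Rightarrow> nat \<Rightarrow> real" where
  "perron_vector J h T = (SOME u. perron 9 (weight J h T) (lambda_max J h T) u)"

lemma perron_perron_vector: "perron 9 (weight J h T) (lambda_max J h T) (perron_vector J h T)"
proof -
  obtain u where "perron 9 (weight J h T) (lambda_max J h T) u" by (rule perron_weight)
  then show ?thesis 
    unfolding perron_vector_def by (rule someI[of "perron 9 (weight J h T) (lambda_max J h T)"])
qed

lemma jet2_lambda_max_field: "jet2 (\<lambda>s t. lambda_max J (field_shift h \<mu>0 \<mu>1 s t) T)"
  by (rule jet2_perron_value[OF perron_perron_vector jet2_weight_field])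

lemma jet2_lambda_max_temperature:
  "T \<noteq> 0 \<Longrightarrow> jet2 (\<lambda>s t. lambda_max J h (T + s + t))"
  by (rule jet2_perron_value[OF perron_perron_vector jet2_weight_temperature])

lemma sec_coeff_eq: "sec_coeff J k h T = coeff (char_poly (nmat 9 (weight J h T))) k"
  by (simp add: sec_coeff_def Theta_eq_nmat)

lemma lambda_max_pos: "0 < lambda_max J h T"
  by (rule perron_value_pos[OF perron_perron_vector])

lemma eigenvalue_lambda_max: "eigenvalue (Theta J h T) (lambda_max J h T)"
  unfolding Theta_eq_nmat by (rule perron_eigenvalue[OF perron_perron_vector])

lemma secular_derivative_eq:
  "(\<Sum>k\<le>9. sec_coeff J k h T * (real k * x ^ (k - 1)))
     = (\<Sum>n\<le>8. (real n + 1) * sec_coeff J (n + 1) h T * x ^ n)"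
  using sum_atMost_Suc_power_deriv[of "\<lambda>k. sec_coeff J k h T" x 8] by simp

lemma secular_derivative_nonzero:
  "(\<Sum>n\<le>8. (real n + 1) * sec_coeff J (n + 1) h T * lambda_max J h T ^ n) \<noteq> 0"
  unfolding secular_derivative_eq[symmetric] unfolding sec_coeff_eq
  by (rule perron_simple[OF perron_perron_vector])

lemma lambda_max_pdh:
  fixes J :: coupling and h :: field and T :: real
  defines "l \<equiv> lambda_max J h T"
    and "pl \<equiv> \<lambda>\<mu>. pdh \<mu> (\<lambda>h. lambda_max J h T) h"
    and "D \<equiv> \<Sum>n\<le>8. (real n + 1) * sec_coeff J (n + 1) h T * lambda_max J h T ^ n"
  shows "pl \<mu>1 = - (\<Sum>n\<le>9. pdh \<mu>1 (\<lambda>h. sec_coeff J n h T) h * l ^ n) / D" (is ?first)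
    "pdh \<mu>0 (pdh \<mu>1 (\<lambda>h. lambda_max J h T)) h
       = - 1 / D * ((\<Sum>n\<le>9. pdh \<mu>0 (pdh \<mu>1 (\<lambda>h. sec_coeff J n h T)) h * l ^ n)
         + pl \<mu>1 * (\<Sum>n\<le>8. (real n + 1) * pdh \<mu>0 (\<lambda>h. sec_coeff J (n + 1) h T) h * l ^ n)
         + pl \<mu>0 * ((\<Sum>n\<le>8. (real n + 1) * pdh \<mu>1 (\<lambda>h. sec_coeff J (n + 1) h T) h * l ^ n)
           + pl \<mu>1 * (\<Sum>n\<le>7. (real n + 2) * (real n + 1) * sec_coeff J (n + 2) h T * l ^ n)))" (is ?second)
proof -
  let ?h = "field_shift h \<mu>0 \<mu>1"
  obtain a b c where l: "has_jet (\<lambda>s t. lambda_max J (?h s t) T) l a b c"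
    using jet2_lambda_max_field[of J h \<mu>0 \<mu>1 T] unfolding l_def by (auto elim!: jet2E)
  \<comment> \<open>Existence of the jet is what identifies its components with the values of the
    total operator \<open>pdh\<close>.\<close>
  have coeffs: "has_jet (\<lambda>s t. sec_coeff J k (?h s t) T) (sec_coeff J k h T)
      (pdh \<mu>0 (\<lambda>h. sec_coeff J k h T) h) (pdh \<mu>1 (\<lambda>h. sec_coeff J k h T) h)
      (pdh \<mu>0 (pdh \<mu>1 (\<lambda>h. sec_coeff J k h T)) h)" for k
  proof -
    have "jet2 (\<lambda>s t. sec_coeff J k (?h s t) T)"
      unfolding sec_coeff_eq by (intro jet2_coeff_char_poly jet2_weight_field)
    then obtain b c d where j: "has_jet (\<lambda>s t. sec_coeff J k (?h s t) T) (sec_coeff J k (?h 0 0) T) b c d"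
      by (rule jet2E)
    show ?thesis using j has_jet_field_shift_imp_pdh(2-4)[OF j] by simp
  qed
  have root: "(\<Sum>k\<le>9. sec_coeff J k (?h s t) T * lambda_max J (?h s t) T ^ k) = 0" for s t
    unfolding sec_coeff_eq by (rule perron_root[OF perron_perron_vector])
  have D: "D = (\<Sum>k\<le>9. sec_coeff J k h T * (real k * l ^ (k - 1)))" "D \<noteq> 0"
    using secular_derivative_nonzero unfolding D_def l_def secular_derivative_eq by auto
  have pl: "pl \<mu>0 = a" "pl \<mu>1 = b" "pdh \<mu>0 (pdh \<mu>1 (\<lambda>h. lambda_max J h T)) h = c"
    using has_jet_field_shift_imp_pdh[OF l] unfolding pl_def by auto
  note formula = has_jet_root_formula[OF coeffs l root D]
  show ?first using formula(1) unfolding pl .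
  have "(\<Sum>k\<le>9. f k * (real k * l ^ (k - 1))) = (\<Sum>n\<le>8. (real n + 1) * f (n + 1) * l ^ n)"
    "(\<Sum>k\<le>9. f k * (real k * real (k - 1) * l ^ (k - 2)))
       = (\<Sum>n\<le>7. (real n + 2) * (real n + 1) * f (n + 2) * l ^ n)" for f
    using sum_atMost_Suc_power_deriv[of f l 8] sum_atMost_Suc_power_deriv2[of f l 7] by simp_all
  with formula(2) show ?second unfolding pl by (simp only:)
qed

section \<open>The thermodynamic limit\<close>

text \<open>\<open>ln Z\<close> generates the cumulants: its first derivatives are means and the
  mixed second one is the covariance. Each derivative contributes the factor \<open>2 / T\<close>,
  as the energy contains the magnetization twice.\<close>

lemma has_jet_ln_partition_fun_field:
  assumes "0 < L"
  shows "has_jet (\<lambda>s t. ln (partition_fun J L (field_shift h \<mu>0 \<mu>1 s t) T))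
    (ln (partition_fun J L h T))
    (2 / T * gibbs_mean J L h T (magn L \<mu>0)) (2 / T * gibbs_mean J L h T (magn L \<mu>1))
    (4 / T\<^sup>2 * (gibbs_mean J L h T (\<lambda>\<sigma>. magn L \<mu>0 \<sigma> * magn L \<mu>1 \<sigma>)
      - gibbs_mean J L h T (magn L \<mu>0) * gibbs_mean J L h T (magn L \<mu>1)))"
proof -
  define w where "w \<sigma> = exp (- hamiltonian J L h \<sigma> / T)" for \<sigma>
  define Z where "Z = partition_fun J L h T"
  have "0 < Z" unfolding Z_def by (rule partition_fun_pos[OF assms])
  have Z: "Z = (\<Sum>\<sigma>\<in>configs L. w \<sigma>)" by (simp add: Z_def w_def partition_fun_def)
  have mean: "gibbs_mean J L h T F = (\<Sum>\<sigma>\<in>configs L. F \<sigma> * w \<sigma>) / Z" for F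
    by (simp add: gibbs_mean_def w_def Z_def sum_divide_distrib)
  have "exp (- hamiltonian J L (field_shift h \<mu>0 \<mu>1 s t) \<sigma> / T)
      = exp (- hamiltonian J L h \<sigma> / T + s * (2 / T * magn L \<mu>0 \<sigma>) + t * (2 / T * magn L \<mu>1 \<sigma>))" for s t \<sigma>
    by (subst (1 2) hamiltonian_field[OF assms])
       (simp add: sum_field_shift diff_divide_distrib add_divide_distrib distrib_left mult.left_commute)
  then have "has_jet (\<lambda>s t. partition_fun J L (field_shift h \<mu>0 \<mu>1 s t) T)
      (\<Sum>\<sigma>\<in>configs L. w \<sigma>) (\<Sum>\<sigma>\<in>configs L. w \<sigma> * (2 / T * magn L \<mu>0 \<sigma>))
      (\<Sum>\<sigma>\<in>configs L. w \<sigma> * (2 / T * magn L \<mu>1 \<sigma>))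
      (\<Sum>\<sigma>\<in>configs L. w \<sigma> * (2 / T * magn L \<mu>0 \<sigma>) * (2 / T * magn L \<mu>1 \<sigma>))"
    unfolding partition_fun_def w_def by (simp only:) (intro has_jet_sum has_jet_exp_affine)
  from has_jet_ln[OF this[folded Z] \<open>0 < Z\<close>]
  have "has_jet (\<lambda>s t. ln (partition_fun J L (field_shift h \<mu>0 \<mu>1 s t) T))
      (ln Z) ((\<Sum>\<sigma>\<in>configs L. w \<sigma> * (2 / T * magn L \<mu>0 \<sigma>)) / Z)
      ((\<Sum>\<sigma>\<in>configs L. w \<sigma> * (2 / T * magn L \<mu>1 \<sigma>)) / Z)
      ((\<Sum>\<sigma>\<in>configs L. w \<sigma> * (2 / T * magn L \<mu>0 \<sigma>) * (2 / T * magn L \<mu>1 \<sigma>)) / Z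
        - (\<Sum>\<sigma>\<in>configs L. w \<sigma> * (2 / T * magn L \<mu>0 \<sigma>)) * (\<Sum>\<sigma>\<in>configs L. w \<sigma> * (2 / T * magn L \<mu>1 \<sigma>)) / Z\<^sup>2)" .
  moreover have "(\<Sum>\<sigma>\<in>configs L. w \<sigma> * (2 / T * magn L \<mu> \<sigma>)) = 2 / T * (\<Sum>\<sigma>\<in>configs L. magn L \<mu> \<sigma> * w \<sigma>)" for \<mu>
    by (simp add: sum_distrib_left mult_ac)
  moreover have "(\<Sum>\<sigma>\<in>configs L. w \<sigma> * (2 / T * magn L \<mu>0 \<sigma>) * (2 / T * magn L \<mu>1 \<sigma>))
      = 4 / T\<^sup>2 * (\<Sum>\<sigma>\<in>configs L. magn L \<mu>0 \<sigma> * magn L \<mu>1 \<sigma> * w \<sigma>)"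
    unfolding sum_distrib_left by (intro sum.cong) (auto simp: power2_eq_square)
  ultimately show ?thesis
    unfolding mean Z_def[symmetric] by (simp add: power2_eq_square right_diff_distrib)
qed

text \<open>Field and temperature are both left as functions of the two parameters, so that one
  limit statement covers field response and thermal response.\<close>

lemma has_jet_ln_partition_fun_tendsto:
  assumes jet: "\<And>i j. jet2 (\<lambda>s t. weight J (H s t) (\<theta> s t) i j)"
    and l: "has_jet (\<lambda>s t. lambda_max J (H s t) (\<theta> s t)) l b c d"
  shows "\<exists>\<alpha> \<beta> \<gamma> \<eta>.
    (\<forall>\<^sub>F L in sequentially. 0 < L \<and>
      has_jet (\<lambda>s t. ln (partition_fun J L (H s t) (\<theta> s t)) / real L) (\<alpha> L) (\<beta> L) (\<gamma> L) (\<eta> L)) \<and>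
    \<alpha> \<longlonglongrightarrow> ln l \<and> \<beta> \<longlonglongrightarrow> b / l \<and> \<gamma> \<longlonglongrightarrow> c / l \<and> \<eta> \<longlonglongrightarrow> d / l - b * c / l\<^sup>2"
proof -
  obtain \<alpha> \<beta> \<gamma> \<eta> where
    ev: "\<forall>\<^sub>F L in sequentially. has_jet (\<lambda>s t. ln (\<Sum>j<9. mpow 9 (weight J (H s t) (\<theta> s t)) L j j) / real L)
      (\<alpha> L) (\<beta> L) (\<gamma> L) (\<eta> L)" and
    lim: "\<alpha> \<longlonglongrightarrow> ln l" "\<beta> \<longlonglongrightarrow> b / l" "\<gamma> \<longlonglongrightarrow> c / l" "\<eta> \<longlonglongrightarrow> d / l - b * c / l\<^sup>2"
    using has_jet_ln_trace_power[OF perron_perron_vector jet l] by blast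
  have "\<forall>\<^sub>F L in sequentially. 0 < L \<and>
      has_jet (\<lambda>s t. ln (partition_fun J L (H s t) (\<theta> s t)) / real L) (\<alpha> L) (\<beta> L) (\<gamma> L) (\<eta> L)"
    using ev eventually_gt_at_top[of 0] by eventually_elim (simp add: partition_fun_eq_trace)
  then show ?thesis using lim by blast
qed

text \<open>The jet of \<open>ln Z / L\<close> is computed in two ways, from the trace with known
  limits and from cumulants at finite L; uniqueness of jets identifies them. The covariance enters
  with \<open>4 / T\<^sup>2\<close>, which leaves 4 beside the normalization of the
  susceptibility.\<close>

lemma gibbs_tendsto:
  assumes "T > 0" and l: "has_jet (\<lambda>s t. lambda_max J (field_shift h \<mu>0 \<mu>1 s t) T) l b c d"
  shows "(\<lambda>L. ln (partition_fun J L h T) / real L) \<longlonglongrightarrow> ln l"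
    "(\<lambda>L. 2 / T * gibbs_mean J L h T (magn L \<mu>0) / real L) \<longlonglongrightarrow> b / l"
    "(\<lambda>L. 4 * strip_susceptibility J L \<mu>0 \<mu>1 h T) \<longlonglongrightarrow> T / 2 * (d / l - b * c / l\<^sup>2)"
proof -
  obtain \<alpha> \<beta> \<gamma> \<eta> where
    ev: "\<forall>\<^sub>F L in sequentially. 0 < L \<and>
      has_jet (\<lambda>s t. ln (partition_fun J L (field_shift h \<mu>0 \<mu>1 s t) T) / real L) (\<alpha> L) (\<beta> L) (\<gamma> L) (\<eta> L)" and
    lim: "\<alpha> \<longlonglongrightarrow> ln l" "\<beta> \<longlonglongrightarrow> b / l" "\<gamma> \<longlonglongrightarrow> c / l" "\<eta> \<longlonglongrightarrow> d / l - b * c / l\<^sup>2"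
    using has_jet_ln_partition_fun_tendsto[OF jet2_weight_field l] by blast
  have eq: "\<alpha> L = ln (partition_fun J L h T) / real L \<and>
      \<beta> L = 2 / T * gibbs_mean J L h T (magn L \<mu>0) / real L \<and>
      T / 2 * \<eta> L = 4 * strip_susceptibility J L \<mu>0 \<mu>1 h T"
    if "0 < L \<and> has_jet (\<lambda>s t. ln (partition_fun J L (field_shift h \<mu>0 \<mu>1 s t) T) / real L) (\<alpha> L) (\<beta> L) (\<gamma> L) (\<eta> L)" for L
  proof -
    note j = has_jet_cmult[OF has_jet_ln_partition_fun_field[of L J h \<mu>0 \<mu>1 T], of "1 / real L"]
    have "has_jet (\<lambda>s t. 1 / real L * ln (partition_fun J L (field_shift h \<mu>0 \<mu>1 s t) T)) (\<alpha> L) (\<beta> L) (\<gamma> L) (\<eta> L)"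
      using that by simp
    from has_jet_unique[OF this j] show ?thesis
      using that \<open>T > 0\<close> by (simp add: strip_susceptibility_def power2_eq_square)
  qed
  have ev': "\<forall>\<^sub>F L in sequentially. \<alpha> L = ln (partition_fun J L h T) / real L \<and>
      \<beta> L = 2 / T * gibbs_mean J L h T (magn L \<mu>0) / real L \<and>
      T / 2 * \<eta> L = 4 * strip_susceptibility J L \<mu>0 \<mu>1 h T"
    using ev by (rule eventually_mono) (rule eq)
  show "(\<lambda>L. ln (partition_fun J L h T) / real L) \<longlonglongrightarrow> ln l"
    by (rule Lim_transform_eventually[OF lim(1)]) (use ev' in \<open>auto elim: eventually_mono\<close>)
  show "(\<lambda>L. 2 / T * gibbs_mean J L h T (magn L \<mu>0) / real L) \<longlonglongrightarrow> b / l"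
    by (rule Lim_transform_eventually[OF lim(2)]) (use ev' in \<open>auto elim: eventually_mono\<close>)
  show "(\<lambda>L. 4 * strip_susceptibility J L \<mu>0 \<mu>1 h T) \<longlonglongrightarrow> T / 2 * (d / l - b * c / l\<^sup>2)"
    by (rule Lim_transform_eventually[OF tendsto_mult_left[OF lim(4)]]) (use ev' in \<open>auto elim: eventually_mono\<close>)
qed

lemma strip_free_energy_tendsto:
  assumes "T > 0"
  shows "(\<lambda>L. strip_free_energy J L h T) \<longlonglongrightarrow> - T * (ln (lambda_max J h T) / 2)"
proof -
  obtain b c d where l: "has_jet (\<lambda>s t. lambda_max J (field_shift h 0 0 s t) T) (lambda_max J h T) b c d"
    using jet2_lambda_max_field[of J h 0 0 T] by (auto elim!: jet2E)
  have "(\<lambda>L. - T / 2 * (ln (partition_fun J L h T) / real L)) \<longlonglongrightarrow> - T / 2 * ln (lambda_max J h T)"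
    by (rule tendsto_mult_left[OF gibbs_tendsto(1)[OF assms l]])
  then show ?thesis by (simp add: strip_free_energy_def)
qed

lemma free_energy_eq: "T > 0 \<Longrightarrow> free_energy J h T = - T * (ln (lambda_max J h T) / 2)"
  unfolding free_energy_def by (rule limI[OF strip_free_energy_tendsto])

text \<open>With \<open>\<phi> = ln Z / L\<close> the free energy is
  \<open>- T / 2 * \<phi>\<close>. The finite-strip quantities then become expressions in the jet of
  \<phi>, to which the limits of its components apply.\<close>

lemma thermal_tendsto:
  assumes "T > 0" and l: "has_jet (\<lambda>s t. lambda_max J h (T + s + t)) l b c d"
  shows "(\<lambda>L. strip_internal_energy J L h T) \<longlonglongrightarrow> T\<^sup>2 * (c / l / 2)"
    "(\<lambda>L. strip_entropy J L h T) \<longlonglongrightarrow> 1 / 2 * (ln l + T / l * c)"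
    "(\<lambda>L. strip_heat_capacity J L h T)
       \<longlonglongrightarrow> 2 * T * (c / l / 2) + T\<^sup>2 * ((d / l - b * c / l\<^sup>2) / 2)"
proof -
  have "T \<noteq> 0" using assms(1) by simp
  obtain \<alpha> \<beta> \<gamma> \<eta> where
    ev: "\<forall>\<^sub>F L in sequentially. 0 < L \<and>
      has_jet (\<lambda>s t. ln (partition_fun J L h (T + s + t)) / real L) (\<alpha> L) (\<beta> L) (\<gamma> L) (\<eta> L)" and
    lim: "\<alpha> \<longlonglongrightarrow> ln l" "\<beta> \<longlonglongrightarrow> b / l" "\<gamma> \<longlonglongrightarrow> c / l" "\<eta> \<longlonglongrightarrow> d / l - b * c / l\<^sup>2"
    using has_jet_ln_partition_fun_tendsto[OF jet2_weight_temperature[OF \<open>T \<noteq> 0\<close>] l] by blast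
  have eq: "T\<^sup>2 * (\<gamma> L / 2) = strip_internal_energy J L h T \<and>
      1 / 2 * (\<alpha> L + T * \<gamma> L) = strip_entropy J L h T \<and>
      2 * T * (\<gamma> L / 2) + T\<^sup>2 * (\<eta> L / 2) = strip_heat_capacity J L h T"
    if L: "0 < L \<and> has_jet (\<lambda>s t. ln (partition_fun J L h (T + s + t)) / real L) (\<alpha> L) (\<beta> L) (\<gamma> L) (\<eta> L)" for L
  proof -
    define \<phi> where "\<phi> t = ln (partition_fun J L h t) / real L" for t
    have j\<phi>: "has_jet (\<lambda>s t. \<phi> (T + s + t)) (\<alpha> L) (\<beta> L) (\<gamma> L) (\<eta> L)" using L by (simp add: \<phi>_def)
    note \<phi> = has_jet_shift_deriv[OF j\<phi>]
    define G where "G t = strip_free_energy J L h t / t" for t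
    \<comment> \<open>At \<open>t = 0\<close> the quotient has the default value 0, so the identity
      holds only away from 0; since T is nonzero, it does hold near T.\<close>
    have G: "G t = - 1 / 2 * \<phi> t" if "t \<noteq> 0" for t
      using that L by (simp add: G_def \<phi>_def strip_free_energy_def)
    have "jet2 (\<lambda>s t. T + s + t)"
      by (intro jet2_add jet2_const jet2I[OF has_jet_fst] jet2I[OF has_jet_snd])
    then have "\<forall>\<^sub>F s in nhds 0. \<forall>\<^sub>F t in nhds 0. T + s + t \<noteq> 0"
      using jet2_eventually_nonzero[of "\<lambda>s t. T + s + t"] \<open>T \<noteq> 0\<close> by simp
    then have "\<forall>\<^sub>F s in nhds 0. \<forall>\<^sub>F t in nhds 0. - 1 / 2 * \<phi> (T + s + t) = G (T + s + t)"
      by (auto elim!: eventually_mono simp: G)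
    from has_jet_shift_deriv[OF has_jet_cong_ev[OF has_jet_cmult[OF j\<phi>, of "- 1 / 2"] this]]
    have dG: "(G has_real_derivative - 1 / 2 * \<gamma> L) (at T)" "(deriv G has_real_derivative - 1 / 2 * \<eta> L) (at T)"
      by auto
    have u: "strip_internal_energy J L h t = - t\<^sup>2 * deriv G t" for t
      unfolding strip_internal_energy_def G_def[abs_def] ..
    have "((\<lambda>t. - t\<^sup>2 * deriv G t) has_real_derivative 2 * T * (\<gamma> L / 2) + T\<^sup>2 * (\<eta> L / 2)) (at T)"
      using dG(2) DERIV_imp_deriv[OF dG(1)] by (auto intro!: derivative_eq_intros)
    then have c: "strip_heat_capacity J L h T = 2 * T * (\<gamma> L / 2) + T\<^sup>2 * (\<eta> L / 2)"
      unfolding strip_heat_capacity_def u by (rule DERIV_imp_deriv)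
    have "((\<lambda>t. - t / 2 * \<phi> t) has_real_derivative - (1 / 2 * (\<alpha> L + T * \<gamma> L))) (at T)"
      using \<phi>(1,2) by (auto intro!: derivative_eq_intros simp: field_simps)
    moreover have "strip_free_energy J L h = (\<lambda>t. - t / 2 * \<phi> t)"
      by (rule ext) (simp add: strip_free_energy_def \<phi>_def)
    ultimately have "(strip_free_energy J L h has_real_derivative - (1 / 2 * (\<alpha> L + T * \<gamma> L))) (at T)"
      by (simp only:)
    then have "strip_entropy J L h T = 1 / 2 * (\<alpha> L + T * \<gamma> L)"
      unfolding strip_entropy_def by (simp only: DERIV_imp_deriv minus_minus)
    then show ?thesis using c u[of T] DERIV_imp_deriv[OF dG(1)] by simp
  qed
  have ev': "\<forall>\<^sub>F L in sequentially. T\<^sup>2 * (\<gamma> L / 2) = strip_internal_energy J L h T \<and>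
      1 / 2 * (\<alpha> L + T * \<gamma> L) = strip_entropy J L h T \<and>
      2 * T * (\<gamma> L / 2) + T\<^sup>2 * (\<eta> L / 2) = strip_heat_capacity J L h T"
    using ev by (rule eventually_mono) (rule eq)
  have "(\<lambda>L. T\<^sup>2 * (\<gamma> L / 2)) \<longlonglongrightarrow> T\<^sup>2 * (c / l / 2)" by (intro tendsto_intros lim) simp
  then show "(\<lambda>L. strip_internal_energy J L h T) \<longlonglongrightarrow> T\<^sup>2 * (c / l / 2)"
    by (rule Lim_transform_eventually) (use ev' in \<open>auto elim: eventually_mono\<close>)
  have "(\<lambda>L. 1 / 2 * (\<alpha> L + T * \<gamma> L)) \<longlonglongrightarrow> 1 / 2 * (ln l + T * (c / l))" by (intro tendsto_intros lim)
  then have "(\<lambda>L. strip_entropy J L h T) \<longlonglongrightarrow> 1 / 2 * (ln l + T * (c / l))"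
    by (rule Lim_transform_eventually) (use ev' in \<open>auto elim: eventually_mono\<close>)
  then show "(\<lambda>L. strip_entropy J L h T) \<longlonglongrightarrow> 1 / 2 * (ln l + T / l * c)" by simp
  have "(\<lambda>L. 2 * T * (\<gamma> L / 2) + T\<^sup>2 * (\<eta> L / 2))
      \<longlonglongrightarrow> 2 * T * (c / l / 2) + T\<^sup>2 * ((d / l - b * c / l\<^sup>2) / 2)" by (intro tendsto_intros lim) simp_all
  then show "(\<lambda>L. strip_heat_capacity J L h T)
       \<longlonglongrightarrow> 2 * T * (c / l / 2) + T\<^sup>2 * ((d / l - b * c / l\<^sup>2) / 2)"
    by (rule Lim_transform_eventually) (use ev' in \<open>auto elim: eventually_mono\<close>)
qed

lemma thermodynamics_zero_field:
  assumes "T > 0"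
  shows "lambda_max1 J field_differentiable at T"
    "deriv (lambda_max1 J) field_differentiable at T"
    "(\<lambda>L. strip_internal_energy J L zero_field T)
         \<longlonglongrightarrow> T\<^sup>2 * deriv (\<lambda>t. ln (lambda_max1 J t) / 2) T"
    "(\<lambda>L. strip_entropy J L zero_field T)
         \<longlonglongrightarrow> 1 / 2 * (ln (lambda_max1 J T) + T / lambda_max1 J T * deriv (lambda_max1 J) T)"
    "(\<lambda>L. strip_heat_capacity J L zero_field T)
         \<longlonglongrightarrow> 2 * T * deriv (\<lambda>t. ln (lambda_max1 J t) / 2) T
             + T\<^sup>2 * deriv (deriv (\<lambda>t. ln (lambda_max1 J t) / 2)) T"
proof -
  have fun_eq: "lambda_max1 J = lambda_max J zero_field"
    by (rule ext) (rule lambda_max1_eq)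
  obtain b c d where l: "has_jet (\<lambda>s t. lambda_max J zero_field (T + s + t)) (lambda_max1 J T) b c d"
    using jet2_lambda_max_temperature[of T J zero_field] assms by (auto elim!: jet2E simp: lambda_max1_eq)
  have pos: "0 < lambda_max1 J T" by (simp add: lambda_max1_eq lambda_max_pos)
  note d1 = has_jet_shift_deriv[OF l, folded fun_eq]
  show "lambda_max1 J field_differentiable at T" "deriv (lambda_max1 J) field_differentiable at T"
    using d1(2,3) by (auto simp: field_differentiable_def)
  have "has_jet (\<lambda>s t. 1 / 2 * ln (lambda_max1 J (T + s + t))) (1 / 2 * ln (lambda_max1 J T))
      (1 / 2 * (b / lambda_max1 J T)) (1 / 2 * (c / lambda_max1 J T))
      (1 / 2 * (d / lambda_max1 J T - b * c / (lambda_max1 J T)\<^sup>2))"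
    unfolding fun_eq by (intro has_jet_cmult has_jet_ln) (use l pos in \<open>simp_all add: fun_eq\<close>)
  then have j: "has_jet (\<lambda>s t. (\<lambda>t. ln (lambda_max1 J t) / 2) (T + s + t)) (1 / 2 * ln (lambda_max1 J T))
      (1 / 2 * (b / lambda_max1 J T)) (1 / 2 * (c / lambda_max1 J T))
      (1 / 2 * (d / lambda_max1 J T - b * c / (lambda_max1 J T)\<^sup>2))" by simp
  note d2 = has_jet_shift_deriv(2,3)[OF j, THEN DERIV_imp_deriv]
  note lims = thermal_tendsto[OF assms l]
  show "(\<lambda>L. strip_internal_energy J L zero_field T)
         \<longlonglongrightarrow> T\<^sup>2 * deriv (\<lambda>t. ln (lambda_max1 J t) / 2) T"
    unfolding d2(1) using lims(1) by (simp add: mult.commute)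
  show "(\<lambda>L. strip_entropy J L zero_field T)
         \<longlonglongrightarrow> 1 / 2 * (ln (lambda_max1 J T) + T / lambda_max1 J T * deriv (lambda_max1 J) T)"
    unfolding DERIV_imp_deriv[OF d1(2)] by (rule lims(2))
  show "(\<lambda>L. strip_heat_capacity J L zero_field T)
         \<longlonglongrightarrow> 2 * T * deriv (\<lambda>t. ln (lambda_max1 J t) / 2) T
             + T\<^sup>2 * deriv (deriv (\<lambda>t. ln (lambda_max1 J t) / 2)) T"
    unfolding d2 using lims(3) by (simp add: mult.commute)
qed

lemma field_response:
  fixes J :: coupling and T :: real and h :: field
  assumes "T > 0"
  defines "F \<equiv> \<lambda>h. lambda_max J h T"
  shows "pdh_exists \<mu>1 F h" "pdh_exists \<mu>0 (pdh \<mu>1 F) h"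
    "- pdh \<mu>1 (\<lambda>h. free_energy J h T) h = T / 2 * (1 / F h) * pdh \<mu>1 F h"
    "- pdh \<mu>0 (pdh \<mu>1 (\<lambda>h. free_energy J h T)) h
       = T / 2 * (1 / F h * pdh \<mu>0 (pdh \<mu>1 F) h - 1 / (F h)\<^sup>2 * pdh \<mu>0 F h * pdh \<mu>1 F h)"
    "(\<lambda>L. 4 * strip_susceptibility J L \<mu>0 \<mu>1 h T)
       \<longlonglongrightarrow> T / 2 * (1 / F h * pdh \<mu>0 (pdh \<mu>1 F) h - 1 / (F h)\<^sup>2 * pdh \<mu>0 F h * pdh \<mu>1 F h)"
    "(\<lambda>L. 2 / T * gibbs_mean J L h T (magn L \<mu>0) / real L) \<longlonglongrightarrow> pdh \<mu>0 F h / F h"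
proof -
  obtain b c d where l: "has_jet (\<lambda>s t. F (field_shift h \<mu>0 \<mu>1 s t)) (F h) b c d"
    using jet2_lambda_max_field[of J h \<mu>0 \<mu>1 T] unfolding F_def by (auto elim!: jet2E)
  note p = has_jet_field_shift_imp_pdh[OF l]
  show "pdh_exists \<mu>1 F h" "pdh_exists \<mu>0 (pdh \<mu>1 F) h" by fact+
  have pos: "0 < F h" unfolding F_def by (rule lambda_max_pos)
  have "has_jet (\<lambda>s t. free_energy J (field_shift h \<mu>0 \<mu>1 s t) T) (- T / 2 * ln (F h))
      (- T / 2 * (b / F h)) (- T / 2 * (c / F h)) (- T / 2 * (d / F h - b * c / (F h)\<^sup>2))"
    using has_jet_cmult[OF has_jet_ln[OF l pos], of "- T / 2"]
    by (simp add: free_energy_eq[OF assms(1)] F_def)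
  note f = has_jet_field_shift_imp_pdh[OF this]
  show "- pdh \<mu>1 (\<lambda>h. free_energy J h T) h = T / 2 * (1 / F h) * pdh \<mu>1 F h"
    unfolding f(3) p(3) by simp
  show "- pdh \<mu>0 (pdh \<mu>1 (\<lambda>h. free_energy J h T)) h
       = T / 2 * (1 / F h * pdh \<mu>0 (pdh \<mu>1 F) h - 1 / (F h)\<^sup>2 * pdh \<mu>0 F h * pdh \<mu>1 F h)"
    unfolding f(4) p(2-4) by simp
  show "(\<lambda>L. 4 * strip_susceptibility J L \<mu>0 \<mu>1 h T)
       \<longlonglongrightarrow> T / 2 * (1 / F h * pdh \<mu>0 (pdh \<mu>1 F) h - 1 / (F h)\<^sup>2 * pdh \<mu>0 F h * pdh \<mu>1 F h)"
    using gibbs_tendsto(3)[OF assms(1) l[unfolded F_def]] unfolding p(2-4) by (simp add: F_def)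
  show "(\<lambda>L. 2 / T * gibbs_mean J L h T (magn L \<mu>0) / real L) \<longlonglongrightarrow> pdh \<mu>0 F h / F h"
    using gibbs_tendsto(2)[OF assms(1) l[unfolded F_def]] unfolding p(2) by (simp add: F_def)
qed

lemma strip_magnetization_zero_field:
  "0 < L \<Longrightarrow> strip_magnetization J L \<mu> zero_field T = 1 / 3"
  by (simp add: strip_magnetization_def gibbs_mean_magn_zero_field)

text \<open>The limit of the Gibbs means is known exactly by symmetry, and uniqueness of limits
  passes it on to the derivative of the eigenvalue. The factor 2 beside 1/3 reflects that every site
  lies in two plaquettes.\<close>

lemma magnetization_zero_field:
  assumes "T > 0"
  shows "T / 2 * (1 / lambda_max J zero_field T) * pdh \<mu> (\<lambda>h. lambda_max J h T) zero_field = 2 * (1 / 3)"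
proof -
  have "\<forall>\<^sub>F L in sequentially. 2 / T * gibbs_mean J L zero_field T (magn L \<mu>) / real L = 4 / (3 * T)"
    using eventually_gt_at_top[of 0] by eventually_elim (simp add: gibbs_mean_magn_zero_field)
  then have "(\<lambda>L. 2 / T * gibbs_mean J L zero_field T (magn L \<mu>) / real L) \<longlonglongrightarrow> 4 / (3 * T)"
    by (rule tendsto_eventually)
  then have "pdh \<mu> (\<lambda>h. lambda_max J h T) zero_field / lambda_max J zero_field T = 4 / (3 * T)"
    using field_response(6)[OF assms] LIMSEQ_unique by blast
  then have "T / 2 * (pdh \<mu> (\<lambda>h. lambda_max J h T) zero_field / lambda_max J zero_field T) = T / 2 * (4 / (3 * T))"
    by simp
  then show ?thesis using assms by simp
qed

text \<open>Magnetization and susceptibility occur in both readings, through Gibbs moments and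
  through field derivatives of the free energy. For this Hamiltonian the readings differ by the
  factors 2 and 4, one factor 2 for each field derivative. Since \<open>deriv\<close> and division
  are total, the statement also asserts that the derivatives of the principal eigenvalue exist and
  that the secular denominator is nonzero.\<close>

theorem theorem2p4:
  fixes J :: coupling and T :: real
  assumes "T > 0"
  shows
    "(\<comment> \<open>the principal eigenvalues and the derivatives used below exist\<close>
      eigenvalue (Theta1 J T) (lambda_max1 J T) \<and> lambda_max1 J T > 0 \<and>
      lambda_max J zero_field T = lambda_max1 J T \<and>
      (\<lambda>t. lambda_max1 J t) field_differentiable at T \<and>
      deriv (\<lambda>t. lambda_max1 J t) field_differentiable at T \<and>
      (\<forall>h. eigenvalue (Theta J h T) (lambda_max J h T) \<and> lambda_max J h T > 0 \<and>
           (\<Sum>n\<le>8. (real n + 1) * sec_coeff J (n + 1) h T * lambda_max J h T ^ n) \<noteq> 0 \<and>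
           (\<forall>\<mu>0 \<mu>1. pdh_exists \<mu>1 (\<lambda>h. lambda_max J h T) h \<and>
                    pdh_exists \<mu>0 (pdh \<mu>1 (\<lambda>h. lambda_max J h T)) h)))
     \<and> (\<comment> \<open>free energy, internal energy, entropy, heat capacity\<close>
      (\<forall>h. (\<lambda>L. strip_free_energy J L h T) \<longlonglongrightarrow> free_energy J h T) \<and>
      (\<forall>h. free_energy J h T = - T * (ln (lambda_max J h T) / 2)) \<and>
      free_energy J zero_field T = - T * (ln (lambda_max1 J T) / 2) \<and>
      (\<lambda>L. strip_internal_energy J L zero_field T)
         \<longlonglongrightarrow> T\<^sup>2 * deriv (\<lambda>t. ln (lambda_max1 J t) / 2) T \<and>
      (\<lambda>L. strip_entropy J L zero_field T)
         \<longlonglongrightarrow> 1 / 2 * (ln (lambda_max1 J T)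
                 + T / lambda_max1 J T * deriv (\<lambda>t. lambda_max1 J t) T) \<and>
      (\<lambda>L. strip_heat_capacity J L zero_field T)
         \<longlonglongrightarrow> 2 * T * deriv (\<lambda>t. ln (lambda_max1 J t) / 2) T
             + T\<^sup>2 * deriv (deriv (\<lambda>t. ln (lambda_max1 J t) / 2)) T)
     \<and> (\<comment> \<open>partial magnetizations: as limits of Gibbs means, and from the free energy\<close>
      \<forall>\<mu>.
      (\<lambda>L. strip_magnetization J L \<mu> zero_field T) \<longlonglongrightarrow> 1 / 3 \<and>
      - pdh \<mu> (\<lambda>h. free_energy J h T) zero_field
         = T / 2 * (1 / lambda_max1 J T) * pdh \<mu> (\<lambda>h. lambda_max J h T) zero_field \<and>
      T / 2 * (1 / lambda_max1 J T) * pdh \<mu> (\<lambda>h. lambda_max J h T) zero_field = 2 * (1 / 3))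
     \<and> (\<comment> \<open>partial susceptibilities: from the free energy, and as limits of covariances\<close>
      \<forall>\<mu>0 \<mu>1.
      - pdh \<mu>0 (pdh \<mu>1 (\<lambda>h. free_energy J h T)) zero_field
         = T / 2 * (1 / lambda_max1 J T * pdh \<mu>0 (pdh \<mu>1 (\<lambda>h. lambda_max J h T)) zero_field
                    - 1 / (lambda_max1 J T)\<^sup>2 * pdh \<mu>0 (\<lambda>h. lambda_max J h T) zero_field
                                           * pdh \<mu>1 (\<lambda>h. lambda_max J h T) zero_field) \<and>
      (\<lambda>L. 4 * strip_susceptibility J L \<mu>0 \<mu>1 zero_field T)
         \<longlonglongrightarrow> T / 2 * (1 / lambda_max1 J T * pdh \<mu>0 (pdh \<mu>1 (\<lambda>h. lambda_max J h T)) zero_field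
                    - 1 / (lambda_max1 J T)\<^sup>2 * pdh \<mu>0 (\<lambda>h. lambda_max J h T) zero_field
                                           * pdh \<mu>1 (\<lambda>h. lambda_max J h T) zero_field))
     \<and> (\<comment> \<open>partial derivatives of the principal eigenvalue\<close>
      \<forall>h \<mu>. pdh \<mu> (\<lambda>h. lambda_max J h T) h
         = - (\<Sum>n\<le>9. pdh \<mu> (\<lambda>h. sec_coeff J n h T) h * lambda_max J h T ^ n)
           / (\<Sum>n\<le>8. (real n + 1) * sec_coeff J (n + 1) h T * lambda_max J h T ^ n))
     \<and> (\<forall>h \<mu>0 \<mu>1. pdh \<mu>0 (pdh \<mu>1 (\<lambda>h. lambda_max J h T)) h
         = - 1 / (\<Sum>n\<le>8. (real n + 1) * sec_coeff J (n + 1) h T * lambda_max J h T ^ n)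
           * ((\<Sum>n\<le>9. pdh \<mu>0 (pdh \<mu>1 (\<lambda>h. sec_coeff J n h T)) h * lambda_max J h T ^ n)
              + pdh \<mu>1 (\<lambda>h. lambda_max J h T) h
                * (\<Sum>n\<le>8. (real n + 1) * pdh \<mu>0 (\<lambda>h. sec_coeff J (n + 1) h T) h
                           * lambda_max J h T ^ n)
              + pdh \<mu>0 (\<lambda>h. lambda_max J h T) h
                * ((\<Sum>n\<le>8. (real n + 1) * pdh \<mu>1 (\<lambda>h. sec_coeff J (n + 1) h T) h
                            * lambda_max J h T ^ n)
                   + pdh \<mu>1 (\<lambda>h. lambda_max J h T) h
                     * (\<Sum>n\<le>7. (real n + 2) * (real n + 1) * sec_coeff J (n + 2) h T
                                * lambda_max J h T ^ n))))"
proof (intro conjI allI)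
  show "eigenvalue (Theta1 J T) (lambda_max1 J T)" by (rule eigenvalue_Theta1)
  show "lambda_max1 J T > 0" by (simp add: lambda_max1_eq lambda_max_pos)
  show "lambda_max J zero_field T = lambda_max1 J T" by (simp add: lambda_max1_eq)
  show "free_energy J zero_field T = - T * (ln (lambda_max1 J T) / 2)"
    by (simp add: free_energy_eq[OF assms] lambda_max1_eq)
  show "(\<lambda>L. strip_magnetization J L \<mu> zero_field T) \<longlonglongrightarrow> 1 / 3" for \<mu>
    by (rule tendsto_eventually, rule eventually_mono[OF eventually_gt_at_top[of 0]])
       (rule strip_magnetization_zero_field)
  show "(\<lambda>L. strip_free_energy J L h T) \<longlonglongrightarrow> free_energy J h T" for h
    unfolding free_energy_eq[OF assms] by (rule strip_free_energy_tendsto[OF assms])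
qed (rule thermodynamics_zero_field[OF assms] eigenvalue_lambda_max lambda_max_pos
      secular_derivative_nonzero free_energy_eq[OF assms] lambda_max_pdh field_response[OF assms]
    | (simp only: lambda_max1_eq, rule field_response[OF assms] magnetization_zero_field[OF assms]))+

end
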